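(* There is an absolute constant $L_0\le 16(\ln2)^{-1}+8$ and, for every $\alpha>0$, a constant $L_\alpha>0$ such that the following holds. Let $X_1,\dots,X_n$ be i.i.d. $\mathbf X$-valued random variables with common density $s_\star\in L^2(\mu)$. Let $(S_m)_{m\in\mathcal M}$ be a collection of linear subspaces of $L^2(\mu)$ and, for all $m\in\mathcal M$, let $s_m$ be the orthogonal projection of $s_\star$ onto $S_m$. Assume that there exist a probability measure $\pi$ on $\mathcal M$, a sequence $\varepsilon_n\to0$ and $\delta_o\in(0,1)$ such that $$\forall m\in\mathcal M,\qquad \frac{\|s_m-s_{m_o}\|_\infty\ln\left(\frac4{\pi(m)\delta_o}\right)}{n\|s_\star-s_m\|^2+P\Psi_m}\le\varepsilon_n ,$$ where $m_o$ is a minimizer over $m\in\mathcal M$ of $n\|s_\star-s_m\|^2+P\Psi_m$. Let $\delta\ge\delta_o$, $\delta\in(0,1)$, let $\varepsilon_n'=4\sqrt{\varepsilon_n}+\varepsilon_n/3$ and let $n_o$ be such that $\varepsilon_n'\le1/2$ for all $n\ge n_o$. Let $$r_m(\delta)=\frac{\sqrt{\|\Psi_m\|_\infty}\,\ln\left(\frac2{\pi(m)\delta}\right)}n .$$ Let $\hat\theta$ be the selected index defined in the context, with a penalty $\mathrm{pen}$ such that, for some $\nu\in(0,1)$ and all $m\in\mathcal M$, $$\mathrm{pen}(m)\ge\left(\frac52+2L_0\nu\right)\frac{P\Psi_m}n+\frac{2L_0\|s_\star\|}{\nu}r_m(\delta)+\frac{2L_0}{\nu^3}r_m^2(\delta).$$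 Then, for all $n\ge n_o$, with probability larger than $1-\delta$, for all $\theta\in\Theta$, $$L_\alpha\|\hat s_{\hat\theta}-s_\star\|^2\le\|\hat s_\theta-s_\star\|^2+\min_{m\in\mathcal M_\theta}\left\{\|\breve s_{\theta,m}-\hat s_\theta\|^2+2\,\mathrm{pen}(m)\right\}.$$
   Context: $(\mathbf X,\mathcal X,\mu)$ is a measured space, $\|\cdot\|$ the norm of $L^2(\mu)$, $P$ the common distribution (with density $s_\star$ with respect to $\mu$), $Pt=\int t\,s_\star d\mu$ and $P_nt=\frac1n\sum_{i=1}^nt(X_i)$. $(\hat s_\theta)_{\theta\in\Theta}$ is a collection of estimators of $s_\star$ (functions in $L^2(\mu)$ depending on the data). For each $\theta\in\Theta$, $\mathcal M_\theta$ is a (possibly random) nonempty subset of $\mathcal M$, and for each $m\in\mathcal M_\theta$, $\breve s_{\theta,m}$ is an estimator with values in $S_m$ (for example the orthogonal projection of $\hat s_\theta$ onto $S_m$). $\Psi_m=\sup\{t^2: t\in S_m,\ \|t\|\le1\}$ (pointwise supremum). $\mathrm{pen}:\mathcal M\to\mathbb R^+$. For $\alpha>0$, $$\mathrm{crit}_\alpha(\theta)=\min_{m\in\mathcal M_\theta}\left\{\|\breve s_{\theta,m}\|^2-2P_n\breve s_{\theta,m}+\alpha\|\breve s_{\theta,m}-\hat s_\theta\|^2+\mathrm{pen}(m)\right\},\qquad \hat\theta\in\arg\min_{\theta\in\Theta}\mathrm{crit}_\alpha(\theta).$$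
   Formalization: Each S_m is assumed to have a countable L²-dense subset: automatic when μ is σ-finite, as ‖Ψ_m‖_∞ is finite, while for non-separable S_m over a non-σ-finite μ the claim can fail. ‖Ψ_m‖_∞ < ∞ and π(m) > 0, implicit in a finite penalty, are made explicit. *)

theory Defs
  imports "HOL-Probability.Probability"
begin

(* The elements of the models are genuine functions, not classes modulo null sets:
   otherwise the pointwise supremum Psi below would be meaningless. *)

definition l2_space :: "'x measure \<Rightarrow> ('x \<Rightarrow> real) set" where
  "l2_space \<mu> = {f \<in> borel_measurable \<mu>. integrable \<mu> (\<lambda>x. (f x)\<^sup>2)}"

definition l2_norm :: "'x measure \<Rightarrow> ('x \<Rightarrow> real) \<Rightarrow> real" where
  "l2_norm \<mu> f = sqrt (LINT x|\<mu>. (f x)\<^sup>2)"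

definition l2_subspace :: "'x measure \<Rightarrow> ('x \<Rightarrow> real) set \<Rightarrow> bool" where
  "l2_subspace \<mu> S \<longleftrightarrow> S \<subseteq> l2_space \<mu> \<and> (\<lambda>x. 0) \<in> S \<and>
     (\<forall>f\<in>S. \<forall>g\<in>S. (\<lambda>x. f x + g x) \<in> S) \<and> (\<forall>c::real. \<forall>f\<in>S. (\<lambda>x. c * f x) \<in> S)"

(* Automatic when S is finite-dimensional or the L2 space of \<mu> is separable.  Without it,
   Psi and the suprema over S of the empirical process need not be measurable. *)
definition l2_separable :: "'x measure \<Rightarrow> ('x \<Rightarrow> real) set \<Rightarrow> bool" where
  "l2_separable \<mu> S \<longleftrightarrow>
     (\<exists>D\<subseteq>S. countable D \<and> (\<forall>t\<in>S. \<forall>e>0. \<exists>d\<in>D. l2_norm \<mu> (\<lambda>x. t x - d x) < e))"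

definition is_orth_proj ::
  "'x measure \<Rightarrow> ('x \<Rightarrow> real) set \<Rightarrow> ('x \<Rightarrow> real) \<Rightarrow> ('x \<Rightarrow> real) \<Rightarrow> bool" where
  "is_orth_proj \<mu> S f p \<longleftrightarrow> p \<in> S \<and> (\<forall>t\<in>S. (LINT x|\<mu>. (f x - p x) * t x) = 0)"

definition Psi :: "'x measure \<Rightarrow> ('x \<Rightarrow> real) set \<Rightarrow> 'x \<Rightarrow> real" where
  "Psi \<mu> S x = (SUP t\<in>{t \<in> S. l2_norm \<mu> t \<le> 1}. (t x)\<^sup>2)"

(* Finiteness of the sup-norm of Psi, needed for the real-valued suprema to be proper. *)
definition Psi_bounded :: "'x measure \<Rightarrow> ('x \<Rightarrow> real) set \<Rightarrow> bool" where
  "Psi_bounded \<mu> S \<longleftrightarrow>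
     (\<exists>B. \<forall>t\<in>S. l2_norm \<mu> t \<le> 1 \<longrightarrow> (\<forall>x\<in>space \<mu>. (t x)\<^sup>2 \<le> B))"

definition sup_norm :: "'x measure \<Rightarrow> ('x \<Rightarrow> real) \<Rightarrow> real" where
  "sup_norm \<mu> f = (SUP x\<in>space \<mu>. \<bar>f x\<bar>)"

definition dens_mean :: "'x measure \<Rightarrow> ('x \<Rightarrow> real) \<Rightarrow> ('x \<Rightarrow> real) \<Rightarrow> real" where
  "dens_mean \<mu> s t = (LINT x|\<mu>. t x * s x)"

definition emp_mean :: "(nat \<Rightarrow> 'w \<Rightarrow> 'x) \<Rightarrow> nat \<Rightarrow> 'w \<Rightarrow> ('x \<Rightarrow> real) \<Rightarrow> real" where
  "emp_mean X n \<omega> t = (\<Sum>i=1..n. t (X i \<omega>)) / real n"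

definition risk ::
  "'x measure \<Rightarrow> ('x \<Rightarrow> real) \<Rightarrow> nat \<Rightarrow> ('x \<Rightarrow> real) set \<Rightarrow> ('x \<Rightarrow> real) \<Rightarrow> real" where
  "risk \<mu> s n S p =
     real n * (l2_norm \<mu> (\<lambda>x. s x - p x))\<^sup>2 + dens_mean \<mu> s (Psi \<mu> S)"

definition r_term :: "'x measure \<Rightarrow> nat \<Rightarrow> ('x \<Rightarrow> real) set \<Rightarrow> real \<Rightarrow> real \<Rightarrow> real" where
  "r_term \<mu> n S p \<delta> = sqrt (sup_norm \<mu> (Psi \<mu> S)) * ln (2 / (p * \<delta>)) / real n"

(* The arguments b and h are the values, at a sample point \<omega>, of the S_m-valued estimator
   and of the estimator it approximates; c is the penalty pen(m). *)
definition pen_cost ::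
  "'x measure \<Rightarrow> (nat \<Rightarrow> 'w \<Rightarrow> 'x) \<Rightarrow> nat \<Rightarrow> real \<Rightarrow> 'w \<Rightarrow>
     ('x \<Rightarrow> real) \<Rightarrow> ('x \<Rightarrow> real) \<Rightarrow> real \<Rightarrow> real" where
  "pen_cost \<mu> X n \<alpha> \<omega> b h c =
     (l2_norm \<mu> b)\<^sup>2 - 2 * emp_mean X n \<omega> b
       + \<alpha> * (l2_norm \<mu> (\<lambda>x. b x - h x))\<^sup>2 + c"

definition crit ::
  "'x measure \<Rightarrow> (nat \<Rightarrow> 'w \<Rightarrow> 'x) \<Rightarrow> nat \<Rightarrow> real \<Rightarrow> ('m \<Rightarrow> real) \<Rightarrow>
     ('t \<Rightarrow> 'w \<Rightarrow> 'm set) \<Rightarrow> ('t \<Rightarrow> 'w \<Rightarrow> 'x \<Rightarrow> real) \<Rightarrow>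
     ('t \<Rightarrow> 'm \<Rightarrow> 'w \<Rightarrow> 'x \<Rightarrow> real) \<Rightarrow> 'w \<Rightarrow> 't \<Rightarrow> real" where
  "crit \<mu> X n \<alpha> pen Mod shat sbr \<omega> \<theta> =
     (INF m\<in>Mod \<theta> \<omega>. pen_cost \<mu> X n \<alpha> \<omega> (sbr \<theta> m \<omega>) (shat \<theta> \<omega>) (pen m))"

(* Type variables are quantified outside every formula, so constants that are merely asserted
   to exist could still depend on the types of the sample space and of the index sets.
   A positive lower bound that mentions only \<alpha> excludes this, since the oracle inequality for
   some constant implies it for every smaller one.  Its exact value is immaterial. *)
definition const_floor :: "real \<Rightarrow> real" where
  "const_floor \<alpha> = \<alpha> / (1000 * (1 + \<alpha>)\<^sup>2)"

end

theory Submission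
  imports Defs
begin

text \<open>
  For \<open>t \<in> S\<^sub>m\<close> the fluctuation \<open>(P\<^sub>n - P)(t - s\<^bsub>m_o\<^esub>)\<close> splits into \<open>(P\<^sub>n - P)(t - s\<^sub>m)\<close> and
  \<open>(P\<^sub>n - P)(s\<^sub>m - s\<^bsub>m_o\<^esub>)\<close>.  The first is at most \<open>\<parallel>t - s\<^sub>m\<parallel> Z\<^sub>m\<close>, where \<open>n Z\<^sub>m\<close> is the norm of
  a sum of \<open>n\<close> i.i.d. centred vectors of a Hilbert space.  Instead of Talagrand's inequality a
  direct exponential supermartingale is used: with \<open>W\<close> the mean squared norm of one vector and
  \<open>T\<^sub>k\<close> the partial sums, the process \<open>N\<^sub>k = sqrt (a + (n - k) W + \<parallel>T\<^sub>k\<parallel>\<^sup>2)\<close> satisfies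
  \<open>N\<^sub>k\<^sub>+\<^sub>1 \<le> N\<^sub>k + Y\<close> with \<open>Y\<close> conditionally centred, bounded, and of variance governed by the
  weak variance \<open>\<parallel>s\<parallel> sqrt \<parallel>\<Psi>\<^sub>m\<parallel>\<^sub>\<infinity>\<close>; hence \<open>Z\<^sub>m\<^sup>2\<close> exceeds \<open>P\<Psi>\<^sub>m / n\<close> only by a
  small factor and by the terms in \<open>r\<^sub>m\<close> that the penalty contains.  The second is handled by
  Bernstein's inequality, bounding \<open>P f\<^sup>2\<close> for \<open>f = s\<^sub>m - s\<^bsub>m_o\<^esub>\<close> by
  \<open>\<integral> f\<^sup>2 \<bar>s\<^sub>m\<bar> + \<integral> f\<^sup>2 \<bar>s - s\<^sub>m\<bar>\<close>: the first integral is again paid by \<open>r\<^sub>m\<close>, the second by the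
  hypothesis on \<open>\<epsilon>\<^sub>n\<close>.  Altogether \<open>2 \<bar>(P\<^sub>n - P)(t - s\<^bsub>m_o\<^esub>)\<bar> \<le> 19/20 \<parallel>t - s\<parallel>\<^sup>2 + pen(m)\<close> for
  all models at once, and the comparison of criteria is then deterministic.
\<close>

section \<open>Bernstein's inequality\<close>

text \<open>The quadratic Taylor polynomials at \<open>w\<close> and \<open>- w\<close> multiply to
  1 + w^4 / 4, which is at least 1, so the lower bound on \<open>exp w\<close> inverts into an upper
  bound on \<open>exp (- w)\<close>.\<close>

lemma exp_le_quadratic_nonpos:
  fixes z :: real
  assumes "z \<le> 0"
  shows "exp z \<le> 1 + z + z\<^sup>2 / 2"
proof -
  define w where "w = - z"
  have w: "0 \<le> w" using assms by (simp add: w_def)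
  have p: "1 + w + w\<^sup>2 / 2 \<le> exp w" using exp_lower_Taylor_quadratic[OF w] .
  have q: "0 \<le> 1 - w + w\<^sup>2 / 2"
    using zero_le_power2[of "w - 1"] by (simp add: power2_eq_square algebra_simps)
  have "1 \<le> (1 + w + w\<^sup>2 / 2) * (1 - w + w\<^sup>2 / 2)"
    using mult_nonneg_nonneg[OF zero_le_square[of w] zero_le_square[of w]]
    by (simp add: power2_eq_square algebra_simps)
  also have "\<dots> \<le> exp w * (1 - w + w\<^sup>2 / 2)"
    by (rule mult_right_mono[OF p q])
  finally have "exp (- w) \<le> 1 - w + w\<^sup>2 / 2"
    by (simp add: exp_minus field_simps)
  then show ?thesis by (simp add: w_def)
qed

lemma two_times_three_power_le_fact: "2 * 3 ^ k \<le> (fact (k + 2) :: real)"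
proof (induction k)
  case (Suc k)
  have "2 * 3 ^ Suc k = 3 * (2 * 3 ^ k :: real)" by simp
  also have "\<dots> \<le> real (Suc (k + 2)) * fact (k + 2)"
    using Suc by (intro mult_mono) auto
  also have "\<dots> = fact (Suc k + 2)" by (simp add: algebra_simps)
  finally show ?case .
qed simp

text \<open>For positive \<open>z\<close> the Taylor remainder is dominated term by term by a
  geometric series of ratio \<open>z / 3\<close>, because \<open>fact (k + 2)\<close> is at least
  \<open>2 * 3 ^ k\<close>. For the other sign the quadratic bound is already smaller.\<close>

lemma exp_le_bernstein:
  fixes z B :: real
  assumes "z \<le> B" "0 \<le> B" "B < 3"
  shows "exp z \<le> 1 + z + z\<^sup>2 / (2 * (1 - B / 3))"
proof (cases "z \<le> 0")
  case True
  have "z\<^sup>2 / 2 \<le> z\<^sup>2 / (2 * (1 - B / 3))"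
    using assms by (intro divide_left_mono) auto
  with exp_le_quadratic_nonpos[OF True] show ?thesis by linarith
next
  case False
  then have z: "0 \<le> z" by simp
  have lt: "\<bar>z / 3\<bar> < 1" using assms z by simp
  have gs: "(\<lambda>k. (z / 3) ^ k) sums (1 / (1 - z / 3))"
    using geometric_sums[of "z / 3"] lt by simp
  have gs': "(\<lambda>k. z\<^sup>2 / 2 * (z / 3) ^ k) sums (z\<^sup>2 / 2 * (1 / (1 - z / 3)))"
    by (rule sums_mult[OF gs])
  have sm: "summable (\<lambda>k. inverse (fact (k + 2)) * z ^ (k + 2))"
    using summable_ignore_initial_segment[OF summable_exp[of z], of 2] by (simp add: field_simps)
  have le: "inverse (fact (k + 2)) * z ^ (k + 2) \<le> z\<^sup>2 / 2 * (z / 3) ^ k" for k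
  proof -
    have "inverse (fact (k + 2)) \<le> inverse (2 * 3 ^ k :: real)"
      by (rule le_imp_inverse_le[OF two_times_three_power_le_fact]) simp
    then have "inverse (fact (k + 2)) * z ^ (k + 2) \<le> inverse (2 * 3 ^ k) * z ^ (k + 2)"
      using z by (intro mult_right_mono) auto
    also have "\<dots> = z\<^sup>2 / 2 * (z / 3) ^ k"
      by (simp add: field_simps power_add power2_eq_square)
    finally show ?thesis .
  qed
  have "exp z = 1 + z + (\<Sum>k. inverse (fact (k + 2)) * z ^ (k + 2))"
    using exp_first_two_terms[of z] by (simp add: divide_inverse scaleR_conv_of_real)
  also have "(\<Sum>k. inverse (fact (k + 2)) * z ^ (k + 2)) \<le> (\<Sum>k. z\<^sup>2 / 2 * (z / 3) ^ k)"
    by (rule suminf_le[OF le sm]) (use gs' sums_summable in blast)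
  also have "\<dots> = z\<^sup>2 / (2 * (1 - z / 3))"
    using gs' by (simp add: sums_iff)
  also have "\<dots> \<le> z\<^sup>2 / (2 * (1 - B / 3))"
    using assms z by (intro divide_left_mono mult_pos_pos) auto
  finally show ?thesis by simp
qed

lemma (in prob_space) integrable_bounded_measurable:
  fixes f :: "'a \<Rightarrow> real"
  assumes "f \<in> borel_measurable M" "\<And>x. x \<in> space M \<Longrightarrow> \<bar>f x\<bar> \<le> C"
  shows "integrable M f"
  by (rule integrable_const_bound[where B = C]) (use assms in auto)

text \<open>\<open>C\<close> secures integrability, while the exponent involves the one-sided bound
  \<open>B\<close>. The mean of \<open>Y\<close> stays in the exponent, so that centred increments
  and uncentred summands are both covered.\<close>

lemma (in prob_space) expectation_exp_le_bernstein:
  fixes Y :: "'a \<Rightarrow> real"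
  assumes [measurable]: "Y \<in> borel_measurable M"
    and bdd: "\<And>x. x \<in> space M \<Longrightarrow> \<bar>Y x\<bar> \<le> C"
    and ub: "\<And>x. x \<in> space M \<Longrightarrow> Y x \<le> B"
    and B: "0 \<le> B" and lam: "0 \<le> lam" "lam * B < 3"
    and var: "expectation (\<lambda>x. (Y x)\<^sup>2) \<le> v"
  shows "(\<integral>\<^sup>+x. ennreal (exp (lam * Y x)) \<partial>M)
    \<le> ennreal (exp (lam * expectation Y + lam\<^sup>2 * v / (2 * (1 - lam * B / 3))))"
proof -
  define d where "d = 2 * (1 - lam * B / 3)"
  have d: "0 < d" using lam(2) by (simp add: d_def field_simps)
  have Y: "integrable M Y" by (rule integrable_bounded_measurable[OF _ bdd]) auto
  have Y2: "integrable M (\<lambda>x. (Y x)\<^sup>2)"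
  proof (rule integrable_bounded_measurable[where C = "C\<^sup>2"])
    fix x assume "x \<in> space M"
    from power_mono[OF bdd[OF this], of 2] show "\<bar>(Y x)\<^sup>2\<bar> \<le> C\<^sup>2" by simp
  qed measurable
  let ?g = "\<lambda>x. 1 + lam * Y x + lam\<^sup>2 / d * (Y x)\<^sup>2"
  have g: "integrable M ?g" using Y Y2 by simp
  have le: "exp (lam * Y x) \<le> ?g x" if "x \<in> space M" for x
    using exp_le_bernstein[OF mult_left_mono[OF ub[OF that] lam(1)] mult_nonneg_nonneg[OF lam(1) B] lam(2)]
    by (simp add: d_def power_mult_distrib)
  have "(\<integral>\<^sup>+x. ennreal (exp (lam * Y x)) \<partial>M) \<le> (\<integral>\<^sup>+x. ennreal (?g x) \<partial>M)"
    by (intro nn_integral_mono ennreal_leI le)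
  also have "\<dots> = ennreal (expectation ?g)"
    by (intro nn_integral_eq_integral g AE_I2) (use le exp_ge_zero order_trans in blast)
  also have "expectation ?g = 1 + (lam * expectation Y + lam\<^sup>2 / d * expectation (\<lambda>x. (Y x)\<^sup>2))"
    using Y Y2 by (simp add: prob_space)
  also have "\<dots> \<le> exp (lam * expectation Y + lam\<^sup>2 / d * expectation (\<lambda>x. (Y x)\<^sup>2))"
    by (rule exp_ge_add_one_self)
  also have "\<dots> \<le> exp (lam * expectation Y + lam\<^sup>2 / d * v)"
    using var d by (intro exp_le_cancel_iff[THEN iffD2] add_left_mono mult_left_mono) auto
  finally show ?thesis by (simp add: d_def ennreal_leI)
qed

text \<open>Chernoff's bound. The moment generating function enters through a hypothesis, so that
  the same tail serves sums of real variables and norms of vector sums.\<close>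

lemma (in prob_space) bernstein_tail:
  fixes T :: "'a \<Rightarrow> real"
  assumes [measurable]: "T \<in> borel_measurable M"
    and mgf: "\<And>lam. 0 < lam \<Longrightarrow> lam * B < 3 \<Longrightarrow> (\<integral>\<^sup>+x. ennreal (exp (lam * T x)) \<partial>M)
      \<le> ennreal (exp (lam * t0 + lam\<^sup>2 * V / (2 * (1 - lam * B / 3))))"
    and B: "0 \<le> B" and V: "0 < V" and x: "0 < x"
  shows "prob {w \<in> space M. t0 + sqrt (2 * V * x) + B * x / 3 < T w} \<le> exp (- x)"
proof -
  \<comment> \<open>With this \<open>q\<close> and the \<open>lam\<close> built from it,
    \<open>1 - lam * B / 3\<close> becomes \<open>lam * q\<close> and
    \<open>sqrt (2 * V * x)\<close> becomes \<open>2 * x * q\<close>, so the Chernoff exponent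
    collapses to exactly \<open>- x\<close>.\<close>
  define q where "q = sqrt (V / (2 * x))"
  have q: "0 < q" using V x by (simp add: q_def)
  define lam where "lam = 1 / (B / 3 + q)"
  have den: "0 < B / 3 + q" using B q by linarith
  have lam: "0 < lam" using den by (simp add: lam_def)
  have one: "1 - lam * B / 3 = lam * q"
    using den by (simp add: lam_def field_simps)
  have "0 < lam * q" using lam q by simp
  then have lB: "lam * B < 3" using one by linarith
  have q2: "q\<^sup>2 = V / (2 * x)" using V x by (simp add: q_def)
  have Vq: "V = 2 * x * q\<^sup>2" using q2 x by simp
  have sq: "sqrt (2 * V * x) = 2 * x * q"
    by (rule real_sqrt_unique) (use x q in \<open>auto simp: Vq power2_eq_square\<close>)
  define t where "t = t0 + sqrt (2 * V * x) + B * x / 3"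
  have "lam * (t0 + sqrt (2 * V * x) + B * x / 3) - lam\<^sup>2 * V / (2 * (1 - lam * B / 3)) - lam * t0
     = lam * (2 * x * q + B * x / 3) - lam * x * q"
    unfolding one sq using lam q by (simp add: Vq field_simps power2_eq_square)
  also have "\<dots> = x * (lam * (B / 3 + q))" by (simp add: algebra_simps)
  also have "\<dots> = x" using den by (simp add: lam_def)
  finally have eq: "lam * t0 + lam\<^sup>2 * V / (2 * (1 - lam * B / 3)) - lam * t = - x"
    by (simp add: t_def)
  have "emeasure M {w \<in> space M. t < T w}
      \<le> (\<integral>\<^sup>+w. ennreal (exp (- lam * t)) * ennreal (exp (lam * T w)) \<partial>M)"
  proof -
    have "emeasure M {w \<in> space M. t < T w} = (\<integral>\<^sup>+w. indicator {w \<in> space M. t < T w} w \<partial>M)"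
      by simp
    also have "\<dots> \<le> (\<integral>\<^sup>+w. ennreal (exp (- lam * t)) * ennreal (exp (lam * T w)) \<partial>M)"
    proof (intro nn_integral_mono)
      fix w assume "w \<in> space M"
      have "1 \<le> exp (- lam * t) * exp (lam * T w)" if "t < T w"
        using that lam by (simp flip: exp_add add: algebra_simps)
      then show "indicator {w \<in> space M. t < T w} w
          \<le> ennreal (exp (- lam * t)) * ennreal (exp (lam * T w))"
        by (auto simp: indicator_def simp flip: ennreal_mult)
    qed
    finally show ?thesis .
  qed
  also have "\<dots> = ennreal (exp (- lam * t)) * (\<integral>\<^sup>+w. ennreal (exp (lam * T w)) \<partial>M)"
    by (rule nn_integral_cmult) simp
  also have "\<dots> \<le> ennreal (exp (- lam * t)) *
      ennreal (exp (lam * t0 + lam\<^sup>2 * V / (2 * (1 - lam * B / 3))))"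
    by (intro mult_left_mono mgf lam lB) simp
  also have "\<dots> = ennreal (exp (- x))"
    by (simp add: eq[symmetric] algebra_simps flip: ennreal_mult exp_add)
  finally show ?thesis
    by (simp add: t_def emeasure_eq_measure)
qed

section \<open>Norms of sums of independent Hilbert space vectors\<close>

text \<open>The right-hand side is the tangent at \<open>N\<^sup>2\<close> of the concave square
  root.\<close>

lemma sqrt_le_tangent:
  fixes N t :: real
  assumes "0 < N" "0 \<le> t"
  shows "sqrt t \<le> (N\<^sup>2 + t) / (2 * N)"
proof -
  have "0 \<le> (N - sqrt t)\<^sup>2" by simp
  then have "2 * N * sqrt t \<le> N\<^sup>2 + t"
    using assms by (simp add: power2_diff)
  then show ?thesis using assms by (simp add: field_simps)
qed

text \<open>One summand \<open>y\<close> is integrated out while the others, with sum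
  \<open>v\<close>, are fixed. The tangent of the square root at \<open>N\<^sup>2\<close> bounds the
  norm by \<open>N + Y\<close>, and the extra \<open>W\<close> in the radicand of \<open>N\<close>
  makes \<open>Y\<close> centred. The bound \<open>c\<^sup>2 \<le> a\<close> keeps \<open>N\<close>
  away from zero and so bounds \<open>Y\<close>; \<open>h * W \<le> a\<close> controls the variance
  of its quadratic part.\<close>

lemma (in prob_space) hilbert_norm_step:
  fixes y :: "'j \<Rightarrow> 'a \<Rightarrow> real" and v :: "'j \<Rightarrow> real"
  assumes J: "finite J"
    and y [measurable]: "\<And>j. j \<in> J \<Longrightarrow> y j \<in> borel_measurable M"
    and bdd: "\<And>x. x \<in> space M \<Longrightarrow> (\<Sum>j\<in>J. (y j x)\<^sup>2) \<le> R\<^sup>2" and R: "0 \<le> R"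
    and mean: "\<And>j. j \<in> J \<Longrightarrow> expectation (y j) = 0"
    and weak: "\<And>u. (\<Sum>j\<in>J. (u j)\<^sup>2) \<le> 1 \<Longrightarrow> expectation (\<lambda>x. (\<Sum>j\<in>J. u j * y j x)\<^sup>2) \<le> sg"
    and W: "W = expectation (\<lambda>x. \<Sum>j\<in>J. (y j x)\<^sup>2)"
    and a: "c\<^sup>2 \<le> a" "h * W \<le> a" and c: "0 < c" and h: "0 < h"
    and B: "B = R + R\<^sup>2 / (2 * c)" and lam: "0 \<le> lam" "lam * B < 3"
  shows "(\<integral>\<^sup>+x. ennreal (exp (lam * sqrt (a + (\<Sum>j\<in>J. (v j + y j x)\<^sup>2)))) \<partial>M)
    \<le> ennreal (exp (lam\<^sup>2 * (2 * sg + R\<^sup>2 / (2 * h)) / (2 * (1 - lam * B / 3))))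
      * ennreal (exp (lam * sqrt (a + W + (\<Sum>j\<in>J. (v j)\<^sup>2))))"
proof -
  define N where "N = sqrt (a + W + (\<Sum>j\<in>J. (v j)\<^sup>2))"
  define n2 where "n2 = (\<lambda>x. \<Sum>j\<in>J. (y j x)\<^sup>2)"
  define u where "u = (\<lambda>j. v j / N)"
  define Y where "Y = (\<lambda>x. (\<Sum>j\<in>J. u j * y j x) + (n2 x - W) / (2 * N))"
  have n2_nonneg: "0 \<le> n2 x" for x by (simp add: n2_def sum_nonneg)
  have n2_le: "n2 x \<le> R\<^sup>2" if "x \<in> space M" for x using bdd[OF that] by (simp add: n2_def)
  have [measurable]: "n2 \<in> borel_measurable M" unfolding n2_def by measurable
  have int_n2: "integrable M n2"
    by (rule integrable_bounded_measurable[where C = "R\<^sup>2"]) (use n2_nonneg n2_le in auto)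
  have EW: "expectation n2 = W" by (simp add: W n2_def)
  have W0: "0 \<le> W" unfolding EW[symmetric] using n2_nonneg by (intro integral_nonneg_AE) auto
  have WR: "W \<le> R\<^sup>2"
    using integral_mono_AE[OF int_n2, of "\<lambda>_. R\<^sup>2"] n2_le by (simp add: EW prob_space)
  have v0: "0 \<le> (\<Sum>j\<in>J. (v j)\<^sup>2)" by (simp add: sum_nonneg)
  have rad: "c\<^sup>2 \<le> a + W + (\<Sum>j\<in>J. (v j)\<^sup>2)" using a W0 v0 by linarith
  have Nc: "c \<le> N" unfolding N_def using rad by (rule real_le_rsqrt)
  have N: "0 < N" using Nc c by linarith
  have N2: "N\<^sup>2 = a + W + (\<Sum>j\<in>J. (v j)\<^sup>2)"
    unfolding N_def using order_trans[OF zero_le_power2 rad] by simp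
  \<comment> \<open>\<open>N\<close> dominates the norm of \<open>v\<close>, so the direction
    \<open>u\<close> lies in the unit ball and the weak variance applies to it.\<close>
  have u: "(\<Sum>j\<in>J. (u j)\<^sup>2) \<le> 1"
  proof -
    have "(\<Sum>j\<in>J. (u j)\<^sup>2) = (\<Sum>j\<in>J. (v j)\<^sup>2) / N\<^sup>2"
      by (simp add: u_def power_divide sum_divide_distrib)
    also have "\<dots> \<le> 1"
    proof -
      have "0 \<le> a" using order_trans[OF zero_le_power2 a(1)] .
      then have "(\<Sum>j\<in>J. (v j)\<^sup>2) \<le> N\<^sup>2" using N2 W0 by linarith
      then show ?thesis using N by simp
    qed
    finally show ?thesis .
  qed
  have yb: "\<bar>y j x\<bar> \<le> R" if "j \<in> J" "x \<in> space M" for j x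
  proof -
    have "(y j x)\<^sup>2 \<le> n2 x" unfolding n2_def by (rule member_le_sum) (use that J in auto)
    then have "(y j x)\<^sup>2 \<le> R\<^sup>2" using n2_le[OF that(2)] by linarith
    then show ?thesis using R by (simp add: abs_le_square_iff[symmetric])
  qed
  have uy: "\<bar>\<Sum>j\<in>J. u j * y j x\<bar> \<le> R" if "x \<in> space M" for x
  proof -
    have "(\<Sum>j\<in>J. u j * y j x)\<^sup>2 \<le> (\<Sum>j\<in>J. (u j)\<^sup>2) * n2 x"
      unfolding n2_def by (rule Cauchy_Schwarz_ineq_sum)
    also have "\<dots> \<le> 1 * R\<^sup>2"
      by (intro mult_mono u n2_le that n2_nonneg) auto
    finally show ?thesis using R by (simp add: abs_le_square_iff[symmetric])
  qed
  have qb: "\<bar>(n2 x - W) / (2 * N)\<bar> \<le> R\<^sup>2 / (2 * c)" if "x \<in> space M" for x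
  proof -
    have "\<bar>n2 x - W\<bar> \<le> R\<^sup>2" using n2_le[OF that] n2_nonneg[of x] W0 WR by linarith
    then show ?thesis using N Nc c by (auto simp: abs_divide intro!: frac_le)
  qed
  have Yb: "\<bar>Y x\<bar> \<le> B" if "x \<in> space M" for x
    unfolding Y_def B using uy[OF that] qb[OF that] by linarith
  have B0: "0 \<le> B" using R c by (simp add: B)
  have [measurable]: "Y \<in> borel_measurable M" unfolding Y_def by measurable
  have int_y: "integrable M (y j)" if "j \<in> J" for j
    by (rule integrable_bounded_measurable[where C = R]) (use that yb in auto)
  have EY: "expectation Y = 0"
  proof -
    have "expectation Y = (\<Sum>j\<in>J. u j * expectation (y j)) + (expectation n2 - W) / (2 * N)"
      using int_y int_n2 by (simp add: Y_def prob_space)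
    then show ?thesis by (simp add: mean EW)
  qed
  have EY2: "expectation (\<lambda>x. (Y x)\<^sup>2) \<le> 2 * sg + R\<^sup>2 / (2 * h)"
  proof -
    let ?p = "\<lambda>x. \<Sum>j\<in>J. u j * y j x"
    have int_p: "integrable M (\<lambda>x. (?p x)\<^sup>2)"
    proof (rule integrable_bounded_measurable[where C = "R\<^sup>2"])
      fix x assume "x \<in> space M"
      from power_mono[OF uy[OF this], of 2] show "\<bar>(?p x)\<^sup>2\<bar> \<le> R\<^sup>2" by simp
    qed measurable
    have int_r: "integrable M (\<lambda>x. 2 * (?p x)\<^sup>2 + 1 / (2 * N\<^sup>2) * (R\<^sup>2 * n2 x - 2 * W * n2 x + W\<^sup>2))"
      using int_p int_n2 by simp
    have "expectation (\<lambda>x. (Y x)\<^sup>2)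
        \<le> expectation (\<lambda>x. 2 * (?p x)\<^sup>2 + 1 / (2 * N\<^sup>2) * (R\<^sup>2 * n2 x - 2 * W * n2 x + W\<^sup>2))"
    proof (rule integral_mono_AE[OF _ int_r AE_I2])
      show "integrable M (\<lambda>x. (Y x)\<^sup>2)"
      proof (rule integrable_bounded_measurable[where C = "B\<^sup>2"])
        fix x assume "x \<in> space M"
        from power_mono[OF Yb[OF this], of 2] show "\<bar>(Y x)\<^sup>2\<bar> \<le> B\<^sup>2" by simp
      qed measurable
      fix x assume x: "x \<in> space M"
      have "(Y x)\<^sup>2 \<le> 2 * (?p x)\<^sup>2 + 2 * ((n2 x - W) / (2 * N))\<^sup>2"
        unfolding Y_def using zero_le_power2[of "?p x - (n2 x - W) / (2 * N)"]
        by (simp add: power2_sum power2_diff)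
      also have "2 * ((n2 x - W) / (2 * N))\<^sup>2 = 1 / (2 * N\<^sup>2) * (n2 x * n2 x - 2 * W * n2 x + W\<^sup>2)"
        using N by (simp add: field_simps power2_eq_square)
      \<comment> \<open>The fourth moment is traded for \<open>R\<^sup>2\<close> times the second,
        so only \<open>W\<close> remains to be controlled.\<close>
      also have "\<dots> \<le> 1 / (2 * N\<^sup>2) * (R\<^sup>2 * n2 x - 2 * W * n2 x + W\<^sup>2)"
        using mult_right_mono[OF n2_le[OF x] n2_nonneg[of x]] by (intro mult_left_mono) auto
      finally show "(Y x)\<^sup>2 \<le> 2 * (?p x)\<^sup>2 + 1 / (2 * N\<^sup>2) * (R\<^sup>2 * n2 x - 2 * W * n2 x + W\<^sup>2)"
        by simp
    qed
    also have "\<dots> = 2 * expectation (\<lambda>x. (?p x)\<^sup>2) + 1 / (2 * N\<^sup>2) * (R\<^sup>2 * W - 2 * W * W + W\<^sup>2)"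
      using int_p int_n2 by (simp add: prob_space EW)
    also have "\<dots> \<le> 2 * sg + 1 / (2 * N\<^sup>2) * (R\<^sup>2 * W)"
      using weak[OF u] by (intro add_mono mult_left_mono) (auto simp: power2_eq_square)
    \<comment> \<open>\<open>N\<^sup>2\<close> is at least \<open>h * W\<close>, so \<open>W\<close>
      cancels.\<close>
    also have "1 / (2 * N\<^sup>2) * (R\<^sup>2 * W) \<le> R\<^sup>2 / (2 * h)"
    proof -
      have "h * W \<le> N\<^sup>2" using N2 a W0 v0 by linarith
      from mult_left_mono[OF this, of "R\<^sup>2"] show ?thesis using N h by (simp add: field_simps)
    qed
    finally show ?thesis by simp
  qed
  have "(\<integral>\<^sup>+x. ennreal (exp (lam * sqrt (a + (\<Sum>j\<in>J. (v j + y j x)\<^sup>2)))) \<partial>M)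
      \<le> (\<integral>\<^sup>+x. ennreal (exp (lam * N)) * ennreal (exp (lam * Y x)) \<partial>M)"
  proof (rule nn_integral_mono)
    fix x assume "x \<in> space M"
    let ?t = "a + (\<Sum>j\<in>J. (v j + y j x)\<^sup>2)"
    have "0 \<le> (\<Sum>j\<in>J. (v j + y j x)\<^sup>2)" by (simp add: sum_nonneg)
    then have "0 \<le> ?t" using a(1) zero_le_power2[of c] by linarith
    note tan = sqrt_le_tangent[OF N this]
    have t: "?t = N\<^sup>2 + 2 * (\<Sum>j\<in>J. v j * y j x) + (n2 x - W)"
      by (simp add: N2 n2_def power2_sum sum.distrib sum_distrib_left algebra_simps)
    have "(N\<^sup>2 + ?t) / (2 * N) = N + ((\<Sum>j\<in>J. v j * y j x) / N + (n2 x - W) / (2 * N))"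
      unfolding t using N by (simp add: field_simps power2_eq_square)
    also have "(\<Sum>j\<in>J. v j * y j x) / N = (\<Sum>j\<in>J. u j * y j x)"
      by (simp add: u_def sum_divide_distrib)
    also have "N + ((\<Sum>j\<in>J. u j * y j x) + (n2 x - W) / (2 * N)) = N + Y x"
      by (simp add: Y_def)
    finally have "sqrt ?t \<le> N + Y x" using tan by simp
    from mult_left_mono[OF this lam(1)] have "lam * sqrt ?t \<le> lam * N + lam * Y x"
      by (simp add: distrib_left)
    then show "ennreal (exp (lam * sqrt ?t)) \<le> ennreal (exp (lam * N)) * ennreal (exp (lam * Y x))"
      by (simp flip: ennreal_mult exp_add)
  qed
  also have "\<dots> = ennreal (exp (lam * N)) * (\<integral>\<^sup>+x. ennreal (exp (lam * Y x)) \<partial>M)"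
    by (rule nn_integral_cmult) simp
  also have "\<dots> \<le> ennreal (exp (lam * N)) *
      ennreal (exp (lam * expectation Y + lam\<^sup>2 * (2 * sg + R\<^sup>2 / (2 * h)) / (2 * (1 - lam * B / 3))))"
    by (intro mult_left_mono expectation_exp_le_bernstein[where C = B] EY2 lam B0)
      (use Yb abs_le_D1 in auto)
  finally show ?thesis by (simp add: EY N_def mult.commute)
qed

text \<open>Induction on the index set, integrating out the newest coordinate first. Each step moves
  one \<open>W\<close> into the radicand, so the induction hypothesis is used with
  \<open>a + W\<close> in place of \<open>a\<close>, and the radicand ends at \<open>a\<close> plus
  one \<open>W\<close> for each index.\<close>

lemma hilbert_norm_mgf:
  fixes Q :: "'a measure" and y :: "'j \<Rightarrow> 'a \<Rightarrow> real" and I :: "'i set"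
  assumes Q: "prob_space Q" and J: "finite J"
    and y [measurable]: "\<And>j. j \<in> J \<Longrightarrow> y j \<in> borel_measurable Q"
    and bdd: "\<And>x. x \<in> space Q \<Longrightarrow> (\<Sum>j\<in>J. (y j x)\<^sup>2) \<le> R\<^sup>2" and R: "0 \<le> R"
    and mean: "\<And>j. j \<in> J \<Longrightarrow> (LINT x|Q. y j x) = 0"
    and weak: "\<And>u. (\<Sum>j\<in>J. (u j)\<^sup>2) \<le> 1 \<Longrightarrow> (LINT x|Q. (\<Sum>j\<in>J. u j * y j x)\<^sup>2) \<le> sg"
    and W: "W = (LINT x|Q. (\<Sum>j\<in>J. (y j x)\<^sup>2))"
    and I: "finite I"
    and a: "c\<^sup>2 \<le> a" "h * W \<le> a" and c: "0 < c" and h: "0 < h"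
    and B: "B = R + R\<^sup>2 / (2 * c)" and lam: "0 \<le> lam" "lam * B < 3"
  shows "(\<integral>\<^sup>+x. ennreal (exp (lam * sqrt (a + (\<Sum>j\<in>J. (\<Sum>i\<in>I. y j (x i))\<^sup>2)))) \<partial>Pi\<^sub>M I (\<lambda>_. Q))
    \<le> ennreal (exp (lam\<^sup>2 * (2 * sg + R\<^sup>2 / (2 * h)) / (2 * (1 - lam * B / 3)))) ^ card I
      * ennreal (exp (lam * sqrt (a + real (card I) * W)))"
  using I a
proof (induction I arbitrary: a)
  case empty
  then show ?case
    using prob_space.emeasure_space_1[OF prob_space_PiM, of "{} :: 'i set" "\<lambda>_. Q"] by (simp add: Q)
next
  case (insert i I)
  interpret Q: prob_space Q by fact
  interpret product_sigma_finite "\<lambda>_. Q" ..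
  define E where "E = ennreal (exp (lam\<^sup>2 * (2 * sg + R\<^sup>2 / (2 * h)) / (2 * (1 - lam * B / 3))))"
  have W0: "0 \<le> W" unfolding W by (intro integral_nonneg_AE) (simp add: sum_nonneg)
  have meas: "(\<lambda>x. ennreal (exp (lam * sqrt (a + (\<Sum>j\<in>J. (\<Sum>k\<in>insert i I. y j (x k))\<^sup>2)))))
      \<in> borel_measurable (Pi\<^sub>M (insert i I) (\<lambda>_. Q))"
    by measurable
  have meas': "(\<lambda>x. ennreal (exp (lam * sqrt (a + W + (\<Sum>j\<in>J. (\<Sum>k\<in>I. y j (x k))\<^sup>2)))))
      \<in> borel_measurable (Pi\<^sub>M I (\<lambda>_. Q))"
    by measurable
  have "(\<integral>\<^sup>+x. ennreal (exp (lam * sqrt (a + (\<Sum>j\<in>J. (\<Sum>k\<in>insert i I. y j (x k))\<^sup>2))))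
        \<partial>Pi\<^sub>M (insert i I) (\<lambda>_. Q))
      = (\<integral>\<^sup>+x. (\<integral>\<^sup>+z. ennreal (exp (lam * sqrt (a + (\<Sum>j\<in>J. (\<Sum>k\<in>insert i I. y j ((x(i := z)) k))\<^sup>2)))) \<partial>Q)
          \<partial>Pi\<^sub>M I (\<lambda>_. Q))"
    by (rule product_nn_integral_insert[OF insert.hyps(1,2) meas])
  also have "\<dots> \<le> (\<integral>\<^sup>+x. E * ennreal (exp (lam * sqrt (a + W + (\<Sum>j\<in>J. (\<Sum>k\<in>I. y j (x k))\<^sup>2))))
          \<partial>Pi\<^sub>M I (\<lambda>_. Q))"
  proof (rule nn_integral_mono)
    fix x
    have "(\<Sum>k\<in>insert i I. y j ((x(i := z)) k)) = (\<Sum>k\<in>I. y j (x k)) + y j z" for j z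
    proof -
      have "(\<Sum>k\<in>I. y j ((x(i := z)) k)) = (\<Sum>k\<in>I. y j (x k))"
        using insert.hyps by (intro sum.cong) auto
      then show ?thesis using insert.hyps by (simp add: add.commute)
    qed
    then show "(\<integral>\<^sup>+z. ennreal (exp (lam * sqrt (a + (\<Sum>j\<in>J. (\<Sum>k\<in>insert i I. y j ((x(i := z)) k))\<^sup>2)))) \<partial>Q)
      \<le> E * ennreal (exp (lam * sqrt (a + W + (\<Sum>j\<in>J. (\<Sum>k\<in>I. y j (x k))\<^sup>2))))"
      unfolding E_def
      using Q.hilbert_norm_step[OF J y bdd R mean weak W insert.prems c h B lam,
          of "\<lambda>j. \<Sum>k\<in>I. y j (x k)"]
      by simp
  qed
  also have "\<dots> = E * (\<integral>\<^sup>+x. ennreal (exp (lam * sqrt (a + W + (\<Sum>j\<in>J. (\<Sum>k\<in>I. y j (x k))\<^sup>2))))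
          \<partial>Pi\<^sub>M I (\<lambda>_. Q))"
    by (rule nn_integral_cmult[OF meas'])
  also have "\<dots> \<le> E * (E ^ card I * ennreal (exp (lam * sqrt (a + W + real (card I) * W))))"
    unfolding E_def using insert.prems W0 by (intro mult_left_mono insert.IH) auto
  finally show ?case
    unfolding E_def using insert.hyps by (simp add: algebra_simps)
qed

text \<open>The mean-square term enters with the factor \<open>1 + A\<close>, \<open>A\<close> arbitrary; symmetrisation would cost a
  factor that the penalty constant 5/2 cannot absorb.\<close>

lemma hilbert_norm_tail:
  fixes Q :: "'a measure" and y :: "'j \<Rightarrow> 'a \<Rightarrow> real" and I :: "'i set"
  assumes Q: "prob_space Q" and J: "finite J"
    and y [measurable]: "\<And>j. j \<in> J \<Longrightarrow> y j \<in> borel_measurable Q"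
    and bdd: "\<And>x. x \<in> space Q \<Longrightarrow> (\<Sum>j\<in>J. (y j x)\<^sup>2) \<le> R\<^sup>2" and R: "0 < R"
    and mean: "\<And>j. j \<in> J \<Longrightarrow> (LINT x|Q. y j x) = 0"
    and weak: "\<And>u. (\<Sum>j\<in>J. (u j)\<^sup>2) \<le> 1 \<Longrightarrow> (LINT x|Q. (\<Sum>j\<in>J. u j * y j x)\<^sup>2) \<le> sg"
    and W: "W = (LINT x|Q. (\<Sum>j\<in>J. (y j x)\<^sup>2))"
    and I: "finite I" "n = real (card I)" "0 < n"
    and c: "0 < c" and A: "0 < A" and x: "0 < x"
  shows "measure (Pi\<^sub>M I (\<lambda>_. Q)) {w \<in> space (Pi\<^sub>M I (\<lambda>_. Q)).
      sqrt ((1 + A) * (n * W) + c\<^sup>2) + sqrt (2 * (2 * n * sg + R\<^sup>2 / (2 * A)) * x)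
        + (R + R\<^sup>2 / (2 * c)) * x / 3 < sqrt (\<Sum>j\<in>J. (\<Sum>i\<in>I. y j (w i))\<^sup>2)} \<le> exp (- x)"
proof -
  interpret P: prob_space "Pi\<^sub>M I (\<lambda>_. Q)" by (rule prob_space_PiM[OF Q])
  define B where "B = R + R\<^sup>2 / (2 * c)"
  \<comment> \<open>With \<open>h = A * n\<close> the \<open>n\<close> variance contributions
    \<open>R\<^sup>2 / (2 * h)\<close> add up to \<open>R\<^sup>2 / (2 * A)\<close>, and with the
    next \<open>a\<close> the final radicand is
    \<open>(1 + A) * (n * W) + c\<^sup>2\<close>.\<close>
  define h where "h = A * n"
  define a where "a = h * W + c\<^sup>2"
  have h: "0 < h" using A I by (simp add: h_def)
  have W0: "0 \<le> W" unfolding W by (intro integral_nonneg_AE) (simp add: sum_nonneg)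
  have sg0: "0 \<le> sg" using weak[of "\<lambda>_. 0"] by simp
  have V: "0 < 2 * n * sg + R\<^sup>2 / (2 * A)"
    using sg0 I(3) R A by (intro add_nonneg_pos mult_nonneg_nonneg divide_pos_pos) auto
  have a: "c\<^sup>2 \<le> a" "h * W \<le> a" using h W0 by (auto simp: a_def)
  have B0: "0 \<le> B" using R c by (simp add: B_def)
  have nh: "n * (2 * sg + R\<^sup>2 / (2 * h)) = 2 * n * sg + R\<^sup>2 / (2 * A)"
    using I(3) A by (simp add: h_def field_simps)
  have aW: "a + n * W = (1 + A) * (n * W) + c\<^sup>2" by (simp add: a_def h_def algebra_simps)
  show ?thesis
    unfolding B_def[symmetric]
  proof (rule P.bernstein_tail[OF _ _ B0 V x])
    show "(\<lambda>w. sqrt (\<Sum>j\<in>J. (\<Sum>i\<in>I. y j (w i))\<^sup>2)) \<in> borel_measurable (Pi\<^sub>M I (\<lambda>_. Q))"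
      by measurable
    fix lam :: real assume lam: "0 < lam" "lam * B < 3"
    have "(\<integral>\<^sup>+w. ennreal (exp (lam * sqrt (\<Sum>j\<in>J. (\<Sum>i\<in>I. y j (w i))\<^sup>2))) \<partial>Pi\<^sub>M I (\<lambda>_. Q))
        \<le> (\<integral>\<^sup>+w. ennreal (exp (lam * sqrt (a + (\<Sum>j\<in>J. (\<Sum>i\<in>I. y j (w i))\<^sup>2)))) \<partial>Pi\<^sub>M I (\<lambda>_. Q))"
      using lam a(1) order_trans[OF zero_le_power2 a(1)]
      by (intro nn_integral_mono ennreal_leI) simp
    also have "\<dots> \<le> ennreal (exp (lam\<^sup>2 * (2 * sg + R\<^sup>2 / (2 * h)) / (2 * (1 - lam * B / 3)))) ^ card I
        * ennreal (exp (lam * sqrt (a + real (card I) * W)))"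
      by (rule hilbert_norm_mgf[OF Q J y bdd _ mean weak W I(1) a c h B_def])
        (use lam R in auto)
    also have "\<dots> = ennreal (exp (n * (lam\<^sup>2 * (2 * sg + R\<^sup>2 / (2 * h)) / (2 * (1 - lam * B / 3))))
        * exp (lam * sqrt (a + n * W)))"
      by (simp add: ennreal_power ennreal_mult I flip: exp_of_nat_mult)
    also have "exp (n * (lam\<^sup>2 * (2 * sg + R\<^sup>2 / (2 * h)) / (2 * (1 - lam * B / 3))))
        * exp (lam * sqrt (a + n * W))
      = exp (lam * sqrt (a + n * W) + lam\<^sup>2 * (n * (2 * sg + R\<^sup>2 / (2 * h))) / (2 * (1 - lam * B / 3)))"
      by (simp add: mult_exp_exp algebra_simps)
    finally show "(\<integral>\<^sup>+w. ennreal (exp (lam * sqrt (\<Sum>j\<in>J. (\<Sum>i\<in>I. y j (w i))\<^sup>2))) \<partial>Pi\<^sub>M I (\<lambda>_. Q))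
      \<le> ennreal (exp (lam * sqrt ((1 + A) * (n * W) + c\<^sup>2)
          + lam\<^sup>2 * (2 * n * sg + R\<^sup>2 / (2 * A)) / (2 * (1 - lam * B / 3))))"
      unfolding nh aW .
  qed
qed

section \<open>Square integrable functions and models\<close>

definition l2_inner :: "'x measure \<Rightarrow> ('x \<Rightarrow> real) \<Rightarrow> ('x \<Rightarrow> real) \<Rightarrow> real" where
  "l2_inner \<mu> f g = (LINT x|\<mu>. f x * g x)"

lemma l2_spaceD [measurable_dest]: "f \<in> l2_space \<mu> \<Longrightarrow> f \<in> borel_measurable \<mu>"
  by (simp add: l2_space_def)

lemma l2_space_integrable_power2: "f \<in> l2_space \<mu> \<Longrightarrow> integrable \<mu> (\<lambda>x. (f x)\<^sup>2)"
  by (simp add: l2_space_def)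

lemma l2_space_integrable_mult:
  assumes "f \<in> l2_space \<mu>" "g \<in> l2_space \<mu>"
  shows "integrable \<mu> (\<lambda>x. f x * g x)"
proof (rule Bochner_Integration.integrable_bound)
  show "integrable \<mu> (\<lambda>x. (f x)\<^sup>2 + (g x)\<^sup>2)"
    using assms by (simp add: l2_space_def)
  show "(\<lambda>x. f x * g x) \<in> borel_measurable \<mu>"
    using assms by (auto simp: l2_space_def)
  have "\<bar>a * b\<bar> \<le> a\<^sup>2 + b\<^sup>2" for a b :: real
  proof -
    have "0 \<le> (\<bar>a\<bar> - \<bar>b\<bar>)\<^sup>2" by simp
    then have "2 * (\<bar>a\<bar> * \<bar>b\<bar>) \<le> a\<^sup>2 + b\<^sup>2" by (simp add: power2_diff)
    moreover have "0 \<le> \<bar>a\<bar> * \<bar>b\<bar>" by simp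
    ultimately show ?thesis unfolding abs_mult by linarith
  qed
  then show "AE x in \<mu>. norm (f x * g x) \<le> norm ((f x)\<^sup>2 + (g x)\<^sup>2)"
    by (simp add: abs_mult[symmetric] del: abs_mult)
qed

lemma l2_space_cmult: "f \<in> l2_space \<mu> \<Longrightarrow> (\<lambda>x. c * f x) \<in> l2_space \<mu>"
  by (auto simp: l2_space_def power_mult_distrib)

lemma l2_space_add:
  assumes "f \<in> l2_space \<mu>" "g \<in> l2_space \<mu>"
  shows "(\<lambda>x. f x + g x) \<in> l2_space \<mu>"
  using assms l2_space_integrable_mult[OF assms]
  by (auto simp: l2_space_def power2_sum mult.assoc)

lemma l2_space_diff:
  assumes "f \<in> l2_space \<mu>" "g \<in> l2_space \<mu>"
  shows "(\<lambda>x. f x - g x) \<in> l2_space \<mu>"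
  using l2_space_add[OF assms(1) l2_space_cmult[OF assms(2), of "-1"]] by simp

lemma l2_space_abs: "f \<in> l2_space \<mu> \<Longrightarrow> (\<lambda>x. \<bar>f x\<bar>) \<in> l2_space \<mu>"
  by (auto simp: l2_space_def)

lemma l2_norm_nonneg [simp]: "0 \<le> l2_norm \<mu> f"
  by (simp add: l2_norm_def)

lemma l2_norm_power2: "(l2_norm \<mu> f)\<^sup>2 = (LINT x|\<mu>. (f x)\<^sup>2)"
  by (simp add: l2_norm_def)

lemma l2_norm_power2_inner: "(l2_norm \<mu> f)\<^sup>2 = l2_inner \<mu> f f"
  by (simp add: l2_norm_def l2_inner_def power2_eq_square)

lemma l2_norm_cmult: "l2_norm \<mu> (\<lambda>x. c * f x) = \<bar>c\<bar> * l2_norm \<mu> f"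
  by (simp add: l2_norm_def power_mult_distrib real_sqrt_mult)

lemma l2_norm_abs: "l2_norm \<mu> (\<lambda>x. \<bar>f x\<bar>) = l2_norm \<mu> f"
  by (simp add: l2_norm_def)

lemma l2_norm_minus: "l2_norm \<mu> (\<lambda>x. f x - g x) = l2_norm \<mu> (\<lambda>x. g x - f x)"
  by (simp add: l2_norm_def power2_commute)

lemma l2_inner_commute: "l2_inner \<mu> f g = l2_inner \<mu> g f"
  by (simp add: l2_inner_def mult.commute)

lemma l2_inner_cmult_left: "l2_inner \<mu> (\<lambda>x. c * f x) g = c * l2_inner \<mu> f g"
  by (simp add: l2_inner_def mult.assoc)

lemma l2_inner_sum_left:
  assumes "\<And>j. j \<in> J \<Longrightarrow> f j \<in> l2_space \<mu>" "g \<in> l2_space \<mu>"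
  shows "l2_inner \<mu> (\<lambda>x. \<Sum>j\<in>J. c j * f j x) g = (\<Sum>j\<in>J. c j * l2_inner \<mu> (f j) g)"
proof -
  have "l2_inner \<mu> (\<lambda>x. \<Sum>j\<in>J. c j * f j x) g = (LINT x|\<mu>. (\<Sum>j\<in>J. c j * (f j x * g x)))"
    by (simp add: l2_inner_def sum_distrib_right mult.assoc)
  also have "\<dots> = (\<Sum>j\<in>J. c j * l2_inner \<mu> (f j) g)"
    using assms by (subst Bochner_Integration.integral_sum) (auto simp: l2_inner_def l2_space_integrable_mult)
  finally show ?thesis .
qed

lemma l2_inner_diff_left:
  assumes "f \<in> l2_space \<mu>" "f' \<in> l2_space \<mu>" "g \<in> l2_space \<mu>"
  shows "l2_inner \<mu> (\<lambda>x. f x - f' x) g = l2_inner \<mu> f g - l2_inner \<mu> f' g"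
  using assms by (simp add: l2_inner_def left_diff_distrib l2_space_integrable_mult)

lemma l2_inner_cong:
  assumes "\<And>x. x \<in> space \<mu> \<Longrightarrow> f x = f' x" "\<And>x. x \<in> space \<mu> \<Longrightarrow> g x = g' x"
  shows "l2_inner \<mu> f g = l2_inner \<mu> f' g'"
  unfolding l2_inner_def by (rule Bochner_Integration.integral_cong) (use assms in auto)

lemma l2_norm_power2_add:
  assumes "f \<in> l2_space \<mu>" "g \<in> l2_space \<mu>"
  shows "(l2_norm \<mu> (\<lambda>x. f x + g x))\<^sup>2 = (l2_norm \<mu> f)\<^sup>2 + 2 * l2_inner \<mu> f g + (l2_norm \<mu> g)\<^sup>2"
  using assms l2_space_integrable_mult[OF assms]
  by (simp add: l2_norm_power2 l2_inner_def power2_sum mult.assoc l2_space_def)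

lemma l2_norm_power2_diff:
  assumes "f \<in> l2_space \<mu>" "g \<in> l2_space \<mu>"
  shows "(l2_norm \<mu> (\<lambda>x. f x - g x))\<^sup>2 = (l2_norm \<mu> f)\<^sup>2 - 2 * l2_inner \<mu> f g + (l2_norm \<mu> g)\<^sup>2"
  using assms l2_space_integrable_mult[OF assms]
  by (simp add: l2_norm_power2 l2_inner_def power2_diff mult.assoc l2_space_def)

text \<open>Nonnegativity of the squared norm of \<open>p * f - q * g\<close>, taken at coefficients
  that balance the two norms.\<close>

lemma l2_cauchy_schwarz:
  assumes f: "f \<in> l2_space \<mu>" and g: "g \<in> l2_space \<mu>"
  shows "l2_inner \<mu> f g \<le> l2_norm \<mu> f * l2_norm \<mu> g"
proof -
  define a b where "a = l2_norm \<mu> f" and "b = l2_norm \<mu> g"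
  have ab: "0 \<le> a" "0 \<le> b" by (auto simp: a_def b_def)
  have q: "2 * (p * q) * l2_inner \<mu> f g \<le> p\<^sup>2 * a\<^sup>2 + q\<^sup>2 * b\<^sup>2" for p q
  proof -
    have "0 \<le> (l2_norm \<mu> (\<lambda>x. p * f x - q * g x))\<^sup>2" by simp
    also have "\<dots> = p\<^sup>2 * a\<^sup>2 - 2 * (p * q) * l2_inner \<mu> f g + q\<^sup>2 * b\<^sup>2"
      by (simp add: l2_norm_power2_diff l2_space_cmult f g l2_norm_cmult l2_inner_def a_def b_def
          power_mult_distrib algebra_simps)
    finally show ?thesis by simp
  qed
  show ?thesis
  proof (cases "a = 0 \<or> b = 0")
    case False
    then have p: "0 < a * b" using ab by simp
    from q[of b a] have "2 * (a * b) * l2_inner \<mu> f g \<le> 2 * (a * b) * (a * b)"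
      by (simp add: algebra_simps power2_eq_square)
    then show ?thesis using p unfolding a_def[symmetric] b_def[symmetric]
      by (simp only: mult.assoc mult_le_cancel_left_pos zero_less_numeral) (metis mult.assoc mult_le_cancel_left_pos)
  next
    case True
    have "l2_inner \<mu> f g \<le> 0"
    proof (rule ccontr)
      assume "\<not> l2_inner \<mu> f g \<le> 0"
      then have i: "0 < l2_inner \<mu> f g" by simp
      \<comment> \<open>A function of norm zero may be given the coefficient \<open>r\<close> at no
        cost, and \<open>r\<close> is chosen so that the cross term exceeds what the other norm
        allows.\<close>
      define r where "r = (a\<^sup>2 + b\<^sup>2 + 1) / l2_inner \<mu> f g"
      have r: "r * l2_inner \<mu> f g = a\<^sup>2 + b\<^sup>2 + 1" using i by (simp add: r_def)
      have a2: "0 \<le> a\<^sup>2" "0 \<le> b\<^sup>2" by auto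
      have "2 * (r * l2_inner \<mu> f g) \<le> a\<^sup>2 + b\<^sup>2"
        using True q[of r 1] q[of 1 r] by (auto simp: mult.assoc)
      then show False using r a2 by linarith
    qed
    then show ?thesis using ab by (metis a_def b_def mult_nonneg_nonneg order_trans)
  qed
qed

lemma l2_cauchy_schwarz_abs:
  assumes f: "f \<in> l2_space \<mu>" and g: "g \<in> l2_space \<mu>"
  shows "\<bar>l2_inner \<mu> f g\<bar> \<le> l2_norm \<mu> f * l2_norm \<mu> g"
  using l2_cauchy_schwarz[OF f g] l2_cauchy_schwarz[OF l2_space_cmult[OF f, of "-1"] g]
  by (simp add: l2_inner_cmult_left[of \<mu> "-1" f g, simplified] l2_norm_cmult[of \<mu> "-1" f, simplified] abs_le_iff)

lemma l2_norm_triangle: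
  assumes "f \<in> l2_space \<mu>" "g \<in> l2_space \<mu>"
  shows "l2_norm \<mu> (\<lambda>x. f x + g x) \<le> l2_norm \<mu> f + l2_norm \<mu> g"
proof (rule power2_le_imp_le)
  show "(l2_norm \<mu> (\<lambda>x. f x + g x))\<^sup>2 \<le> (l2_norm \<mu> f + l2_norm \<mu> g)\<^sup>2"
    using l2_cauchy_schwarz[OF assms] by (simp add: l2_norm_power2_add[OF assms] power2_sum)
qed simp

section \<open>Linear subspaces and Gram-Schmidt directions\<close>

lemma l2_subspace_add: "l2_subspace \<mu> S \<Longrightarrow> f \<in> S \<Longrightarrow> g \<in> S \<Longrightarrow> (\<lambda>x. f x + g x) \<in> S"
  unfolding l2_subspace_def by (elim conjE) (drule (1) bspec)+

lemma l2_subspace_cmult: "l2_subspace \<mu> S \<Longrightarrow> f \<in> S \<Longrightarrow> (\<lambda>x. c * f x) \<in> S"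
  unfolding l2_subspace_def by (elim conjE) (drule spec, drule (1) bspec)

lemma l2_subspace_zero: "l2_subspace \<mu> S \<Longrightarrow> (\<lambda>x. 0) \<in> S"
  unfolding l2_subspace_def by (elim conjE)

lemma l2_subspace_diff:
  assumes "l2_subspace \<mu> S" "f \<in> S" "g \<in> S"
  shows "(\<lambda>x. f x - g x) \<in> S"
  using l2_subspace_add[OF assms(1,2) l2_subspace_cmult[OF assms(1,3), of "-1"]] by simp

lemma l2_subspace_sum:
  assumes S: "l2_subspace \<mu> S" and "\<And>j. j \<in> J \<Longrightarrow> f j \<in> S"
  shows "(\<lambda>x. \<Sum>j\<in>J. c j * f j x) \<in> S"
  using assms(2)
proof (induction J rule: infinite_finite_induct)
  case (insert j J)
  have "(\<lambda>x. c j * f j x + (\<Sum>j\<in>J. c j * f j x)) \<in> S"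
    by (rule l2_subspace_add[OF S l2_subspace_cmult[OF S]]) (use insert in auto)
  with insert.hyps show ?case by simp
qed (simp_all add: l2_subspace_zero[OF S])

text \<open>A direction that depends on its predecessors is normalised to the zero function, because
  \<open>y / 0 = 0\<close>; this spares a case distinction on linear independence.\<close>

function gram_schmidt :: "'x measure \<Rightarrow> (nat \<Rightarrow> 'x \<Rightarrow> real) \<Rightarrow> nat \<Rightarrow> 'x \<Rightarrow> real" where
  "gram_schmidt \<mu> d k =
     (let e = (\<lambda>x. d k x - (\<Sum>j<k. l2_inner \<mu> (d k) (gram_schmidt \<mu> d j) * gram_schmidt \<mu> d j x))
      in (\<lambda>x. 1 / l2_norm \<mu> e * e x))"
  by pat_completeness auto
termination by (relation "Wellfounded.measure (\<lambda>(_, _, k). k)") auto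

declare gram_schmidt.simps [simp del]

text \<open>Point evaluations have norm at most \<open>b\<close> on \<open>S\<close>, so a function
  of norm zero vanishes at every point and convergence in norm is uniform. This lets genuine
  functions be treated like elements of a Hilbert space.\<close>

locale eval_bounded_model =
  fixes \<mu> :: "'x measure" and S :: "('x \<Rightarrow> real) set" and b :: real
  assumes subspace: "l2_subspace \<mu> S"
    and separable: "l2_separable \<mu> S"
    and b_nonneg: "0 \<le> b"
    and eval_bound: "\<And>t x. t \<in> S \<Longrightarrow> x \<in> space \<mu> \<Longrightarrow> \<bar>t x\<bar> \<le> b * l2_norm \<mu> t"
begin

lemma S_l2: "t \<in> S \<Longrightarrow> t \<in> l2_space \<mu>"
  using subspace by (auto simp: l2_subspace_def)

lemma S_measurable [measurable_dest]: "t \<in> S \<Longrightarrow> t \<in> borel_measurable \<mu>"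
  using S_l2 l2_spaceD by blast

definition dense_seq :: "nat \<Rightarrow> 'x \<Rightarrow> real" where
  "dense_seq = (SOME d. (\<forall>k. d k \<in> S) \<and> (\<forall>t\<in>S. \<forall>e>0. \<exists>k. l2_norm \<mu> (\<lambda>x. t x - d k x) < e))"

lemma dense_seq:
  shows dense_seq_in: "dense_seq k \<in> S"
    and dense_seq_dense: "t \<in> S \<Longrightarrow> 0 < e \<Longrightarrow> \<exists>k. l2_norm \<mu> (\<lambda>x. t x - dense_seq k x) < e"
proof -
  obtain D where D: "D \<subseteq> S" "countable D" "\<And>t e. t \<in> S \<Longrightarrow> 0 < e \<Longrightarrow> \<exists>d\<in>D. l2_norm \<mu> (\<lambda>x. t x - d x) < e"
    using separable unfolding l2_separable_def by blast
  have "(\<lambda>x. 0) \<in> S" by (rule l2_subspace_zero[OF subspace])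
  from D(3)[OF this zero_less_one] have "D \<noteq> {}" by auto
  then have r: "range (from_nat_into D) = D" using D(2) by (simp add: range_from_nat_into)
  let ?P = "\<lambda>d. (\<forall>k. d k \<in> S) \<and> (\<forall>t\<in>S. \<forall>e>0. \<exists>k::nat. l2_norm \<mu> (\<lambda>x. t x - d k x) < e)"
  have "?P (from_nat_into D)"
  proof (intro conjI allI ballI impI)
    show "from_nat_into D k \<in> S" for k using r D(1) by blast
    fix t and e :: real assume "t \<in> S" "0 < e"
    from D(3)[OF this] obtain d where "d \<in> D" "l2_norm \<mu> (\<lambda>x. t x - d x) < e" by blast
    moreover from this(1) r obtain k where "d = from_nat_into D k" by (metis imageE)
    ultimately show "\<exists>k. l2_norm \<mu> (\<lambda>x. t x - from_nat_into D k x) < e" by blast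
  qed
  then have "?P dense_seq" unfolding dense_seq_def by (rule someI[of ?P])
  then show "dense_seq k \<in> S" "t \<in> S \<Longrightarrow> 0 < e \<Longrightarrow> \<exists>k. l2_norm \<mu> (\<lambda>x. t x - dense_seq k x) < e"
    by blast+
qed

abbreviation "gs \<equiv> gram_schmidt \<mu> dense_seq"

definition resid :: "nat \<Rightarrow> 'x \<Rightarrow> real" where
  "resid k = (\<lambda>x. dense_seq k x - (\<Sum>j<k. l2_inner \<mu> (dense_seq k) (gs j) * gs j x))"

lemma gs_eq: "gs k = (\<lambda>x. 1 / l2_norm \<mu> (resid k) * resid k x)"
  by (subst gram_schmidt.simps) (simp add: resid_def Let_def)

lemma gs_in: "gs k \<in> S"
proof (induction k rule: less_induct)
  case (less k)
  have "resid k \<in> S" unfolding resid_def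
    by (intro l2_subspace_diff[OF subspace dense_seq_in] l2_subspace_sum[OF subspace]) (use less in auto)
  then show ?case unfolding gs_eq by (rule l2_subspace_cmult[OF subspace])
qed

lemma resid_in: "resid k \<in> S"
  unfolding resid_def
  by (intro l2_subspace_diff[OF subspace dense_seq_in] l2_subspace_sum[OF subspace]) (use gs_in in auto)

lemma zero_of_norm_zero:
  assumes "t \<in> S" "l2_norm \<mu> t = 0" "x \<in> space \<mu>"
  shows "t x = 0"
  using eval_bound[OF assms(1,3)] assms(2) by simp

lemma norm_gs: "l2_norm \<mu> (gs k) = (if l2_norm \<mu> (resid k) = 0 then 0 else 1)"
  unfolding gs_eq[of k] l2_norm_cmult by simp

lemma inner_gs_self: "l2_inner \<mu> (gs k) (gs k) = (if l2_norm \<mu> (resid k) = 0 then 0 else 1)"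
  by (simp add: norm_gs flip: l2_norm_power2_inner)

lemma inner_gs_zero:
  assumes "l2_norm \<mu> (gs k) = 0"
  shows "l2_inner \<mu> f (gs k) = 0"
proof -
  have "l2_inner \<mu> f (gs k) = l2_inner \<mu> f (\<lambda>_. 0)"
    by (rule l2_inner_cong) (use zero_of_norm_zero[OF gs_in assms] in auto)
  then show ?thesis by (simp add: l2_inner_def)
qed

text \<open>The squared norm of a direction is 0 or 1, and where it is 0 every inner product with it
  is 0 too. Projection coefficients thus need no distinction between proper and degenerate
  directions.\<close>

lemma inner_gs_absorb: "l2_inner \<mu> f (gs j) * l2_inner \<mu> (gs j) (gs j) = l2_inner \<mu> f (gs j)"
  using inner_gs_zero[of j f] by (auto simp: norm_gs inner_gs_self)

lemma inner_gs_orth: "i < k \<Longrightarrow> l2_inner \<mu> (gs k) (gs i) = 0"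
proof (induction k arbitrary: i rule: less_induct)
  case (less k)
  let ?c = "\<lambda>j. l2_inner \<mu> (dense_seq k) (gs j)"
  have orth: "l2_inner \<mu> (gs j) (gs i) = 0" if "j < k" "j \<noteq> i" for j
  proof (cases "i < j")
    case True then show ?thesis using less.IH[of j i] that by simp
  next
    case False
    then have "j < i" using that by simp
    then show ?thesis using less.IH[of i j] less.prems by (simp add: l2_inner_commute)
  qed
  have "l2_inner \<mu> (resid k) (gs i)
      = ?c i - (\<Sum>j<k. ?c j * l2_inner \<mu> (gs j) (gs i))"
    unfolding resid_def
    by (subst l2_inner_diff_left)
      (auto simp: l2_inner_sum_left S_l2 gs_in dense_seq_in intro!: S_l2 l2_subspace_sum[OF subspace])
  also have "(\<Sum>j<k. ?c j * l2_inner \<mu> (gs j) (gs i)) = ?c i * l2_inner \<mu> (gs i) (gs i)"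
    using less.prems orth by (subst sum.remove[of _ i]) (auto intro!: sum.neutral)
  finally have "l2_inner \<mu> (resid k) (gs i) = 0" by (simp add: inner_gs_absorb)
  then show ?case unfolding gs_eq[of k] l2_inner_cmult_left by simp
qed

lemma inner_gs: "i \<noteq> k \<Longrightarrow> l2_inner \<mu> (gs k) (gs i) = 0"
  using inner_gs_orth[of i k] inner_gs_orth[of k i] l2_inner_commute[of \<mu> "gs k" "gs i"]
  by (cases "i < k") auto

lemma inner_sum_gs:
  "l2_inner \<mu> (\<lambda>x. \<Sum>j<K. u j * gs j x) (gs i) = (if i < K then u i * l2_inner \<mu> (gs i) (gs i) else 0)"
proof -
  have "l2_inner \<mu> (\<lambda>x. \<Sum>j<K. u j * gs j x) (gs i) = (\<Sum>j<K. u j * l2_inner \<mu> (gs j) (gs i))"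
    by (rule l2_inner_sum_left) (auto intro: S_l2 gs_in)
  also have "\<dots> = (\<Sum>j<K. if j = i then u i * l2_inner \<mu> (gs i) (gs i) else 0)"
    by (rule sum.cong) (auto simp: inner_gs)
  finally show ?thesis by simp
qed

text \<open>Equality may fail because a degenerate direction contributes to the right-hand side but
  not to the norm.\<close>

lemma norm_sum_gs: "(l2_norm \<mu> (\<lambda>x. \<Sum>j<K. u j * gs j x))\<^sup>2 \<le> (\<Sum>j<K. (u j)\<^sup>2)"
proof -
  let ?f = "\<lambda>x. \<Sum>j<K. u j * gs j x"
  have f: "?f \<in> l2_space \<mu>" by (intro S_l2 l2_subspace_sum[OF subspace] gs_in)
  have "(l2_norm \<mu> ?f)\<^sup>2 = (\<Sum>j<K. u j * l2_inner \<mu> (gs j) ?f)"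
    unfolding l2_norm_power2_inner by (rule l2_inner_sum_left) (auto intro: S_l2 gs_in f)
  also have "\<dots> = (\<Sum>j<K. u j * (u j * l2_inner \<mu> (gs j) (gs j)))"
    by (rule sum.cong) (auto simp: l2_inner_commute[of \<mu> "gs _" ?f] inner_sum_gs)
  also have "\<dots> \<le> (\<Sum>j<K. (u j)\<^sup>2)"
    by (rule sum_mono) (simp add: inner_gs_self power2_eq_square)
  finally show ?thesis .
qed

text \<open>A residual of norm zero vanishes at every point of the space, so \<open>resid k\<close>
  is always a multiple of \<open>gs k\<close>. The multiple is the last coefficient because the
  earlier directions are orthogonal to \<open>gs k\<close>.\<close>

lemma dense_seq_expand:
  assumes "x \<in> space \<mu>"
  shows "dense_seq k x = (\<Sum>j<Suc k. l2_inner \<mu> (dense_seq k) (gs j) * gs j x)"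
proof -
  let ?r = "l2_norm \<mu> (resid k)"
  have res: "resid k x = ?r * gs k x" if "x \<in> space \<mu>" for x
    using zero_of_norm_zero[OF resid_in, of k x] that by (cases "?r = 0") (auto simp: gs_eq[of k])
  have e: "dense_seq k x = (\<Sum>j<k. l2_inner \<mu> (dense_seq k) (gs j) * gs j x) + resid k x" for x
    by (simp add: resid_def)
  have "l2_inner \<mu> (dense_seq k) (gs k) = l2_inner \<mu> (\<lambda>x. dense_seq k x - resid k x) (gs k) + l2_inner \<mu> (resid k) (gs k)"
    by (simp add: l2_inner_diff_left S_l2 dense_seq_in resid_in gs_in)
  also have "l2_inner \<mu> (\<lambda>x. dense_seq k x - resid k x) (gs k) = 0"
    by (simp add: resid_def inner_sum_gs)
  also have "l2_inner \<mu> (resid k) (gs k) = l2_inner \<mu> (\<lambda>x. ?r * gs k x) (gs k)"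
    by (rule l2_inner_cong) (use res in auto)
  also have "\<dots> = ?r" by (simp add: l2_inner_cmult_left inner_gs_self)
  finally have "l2_inner \<mu> (dense_seq k) (gs k) = ?r" by simp
  then show ?thesis using res[OF assms] e[of x] by simp
qed

lemma dense_seq_parseval: "(\<Sum>j<Suc k. (l2_inner \<mu> (dense_seq k) (gs j))\<^sup>2) = (l2_norm \<mu> (dense_seq k))\<^sup>2"
proof -
  let ?c = "\<lambda>j. l2_inner \<mu> (dense_seq k) (gs j)"
  have "(l2_norm \<mu> (dense_seq k))\<^sup>2 = l2_inner \<mu> (\<lambda>x. \<Sum>j<Suc k. ?c j * gs j x) (dense_seq k)"
    unfolding l2_norm_power2_inner by (rule l2_inner_cong) (use dense_seq_expand in auto)
  also have "\<dots> = (\<Sum>j<Suc k. ?c j * l2_inner \<mu> (gs j) (dense_seq k))"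
    by (rule l2_inner_sum_left) (auto intro: S_l2 gs_in dense_seq_in)
  finally show ?thesis by (simp add: power2_eq_square l2_inner_commute[of \<mu> "gs _"])
qed

section \<open>Diagonals of the reproducing kernels of the finite spans, and their limit
  \<open>Psi\<close>\<close>

definition gram :: "nat \<Rightarrow> 'x \<Rightarrow> real" where
  "gram K x = (\<Sum>j<K. (gs j x)\<^sup>2)"

lemma gram_nonneg: "0 \<le> gram K x"
  by (simp add: gram_def sum_nonneg)

lemma gram_measurable [measurable]: "gram K \<in> borel_measurable \<mu>"
  using S_measurable[OF gs_in] unfolding gram_def by measurable

lemma gram_mono: "incseq (\<lambda>K. gram K x)"
  by (rule incseq_SucI) (simp add: gram_def)

lemma gram_attained:
  assumes "x \<in> space \<mu>"
  shows "\<exists>t\<in>S. l2_norm \<mu> t \<le> 1 \<and> (t x)\<^sup>2 = gram K x"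
proof (cases "gram K x = 0")
  case True
  have "(\<lambda>x. 0) \<in> S" by (rule l2_subspace_zero[OF subspace])
  then show ?thesis using True by (intro bexI[of _ "\<lambda>x. 0"]) (auto simp: l2_norm_def)
next
  case False
  let ?g = "sqrt (gram K x)"
  have g: "0 < gram K x" using False gram_nonneg[of K x] by simp
  \<comment> \<open>The equality case of Cauchy-Schwarz: coefficients proportional to the values of
    the directions at \<open>x\<close>.\<close>
  let ?t = "\<lambda>z. \<Sum>j<K. gs j x / ?g * gs j z"
  have "?t \<in> S" by (intro l2_subspace_sum[OF subspace] gs_in)
  moreover have "(l2_norm \<mu> ?t)\<^sup>2 \<le> 1\<^sup>2"
  proof -
    have "(l2_norm \<mu> ?t)\<^sup>2 \<le> (\<Sum>j<K. (gs j x / ?g)\<^sup>2)" by (rule norm_sum_gs)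
    also have "\<dots> = gram K x / ?g\<^sup>2" by (simp add: gram_def power_divide sum_divide_distrib)
    also have "\<dots> = 1" using g by simp
    finally show ?thesis by simp
  qed
  then have "l2_norm \<mu> ?t \<le> 1" by (rule power2_le_imp_le) simp
  moreover have "?t x = ?g"
  proof -
    have "?t x = gram K x / ?g" by (simp add: gram_def power2_eq_square sum_divide_distrib)
    also have "\<dots> = ?g" using g by (simp add: real_div_sqrt)
    finally show ?thesis .
  qed
  ultimately show ?thesis using g by (intro bexI[of _ ?t]) auto
qed

lemma gram_le: "x \<in> space \<mu> \<Longrightarrow> gram K x \<le> b\<^sup>2"
proof -
  assume x: "x \<in> space \<mu>"
  obtain t where t: "t \<in> S" "l2_norm \<mu> t \<le> 1" "(t x)\<^sup>2 = gram K x" using gram_attained[OF x] by blast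
  have "\<bar>t x\<bar> \<le> b * 1" using eval_bound[OF t(1) x] mult_left_mono[OF t(2) b_nonneg] by linarith
  then have "\<bar>t x\<bar>\<^sup>2 \<le> b\<^sup>2" using power_mono[of "\<bar>t x\<bar>" b 2] by simp
  then show ?thesis using t(3) by simp
qed

lemma eval_power2_le:
  assumes "t \<in> S" "l2_norm \<mu> t \<le> 1" "x \<in> space \<mu>"
  shows "(t x)\<^sup>2 \<le> b\<^sup>2"
proof -
  have "\<bar>t x\<bar> \<le> b * 1" using eval_bound[OF assms(1,3)] mult_left_mono[OF assms(2) b_nonneg] by linarith
  then show ?thesis using power_mono[of "\<bar>t x\<bar>" b 2] by simp
qed

lemma Psi_bdd: "x \<in> space \<mu> \<Longrightarrow> bdd_above ((\<lambda>t. (t x)\<^sup>2) ` {t \<in> S. l2_norm \<mu> t \<le> 1})"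
  using eval_power2_le by (intro bdd_aboveI2[of _ _ "b\<^sup>2"]) auto

lemma gram_le_Psi: "x \<in> space \<mu> \<Longrightarrow> gram K x \<le> Psi \<mu> S x"
proof -
  assume x: "x \<in> space \<mu>"
  obtain t where t: "t \<in> S" "l2_norm \<mu> t \<le> 1" "(t x)\<^sup>2 = gram K x" using gram_attained[OF x] by blast
  have "(t x)\<^sup>2 \<le> Psi \<mu> S x" unfolding Psi_def by (rule cSUP_upper[OF _ Psi_bdd[OF x]]) (use t in auto)
  then show ?thesis using t(3) by simp
qed

lemma Psi_nonneg: "x \<in> space \<mu> \<Longrightarrow> 0 \<le> Psi \<mu> S x"
  using gram_le_Psi[of x 0] by (simp add: gram_def)

lemma Psi_le: "x \<in> space \<mu> \<Longrightarrow> Psi \<mu> S x \<le> b\<^sup>2"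
  unfolding Psi_def
proof (rule cSUP_least)
  have "(\<lambda>x. 0) \<in> {t \<in> S. l2_norm \<mu> t \<le> 1}" using l2_subspace_zero[OF subspace] by (simp add: l2_norm_def)
  then show "{t \<in> S. l2_norm \<mu> t \<le> 1} \<noteq> {}" by blast
qed (use eval_power2_le in auto)

text \<open>Every member of the dense sequence lies in a finite span, where Cauchy-Schwarz bounds
  its value at \<open>x\<close> by its norm times \<open>sqrt g\<close>, with \<open>g\<close> the
  supremum of the kernels. Density and bounded evaluation extend the bound to the unit ball of
  \<open>S\<close>. The purpose is measurability of \<open>Psi\<close>.\<close>

lemma gram_tendsto_Psi:
  assumes x: "x \<in> space \<mu>"
  shows "(\<lambda>K. gram K x) \<longlonglongrightarrow> Psi \<mu> S x"
proof -
  have bdd: "bdd_above (range (\<lambda>K. gram K x))" using gram_le_Psi[OF x] by (intro bdd_aboveI2) auto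
  define g where "g = (SUP K. gram K x)"
  have le_g: "gram K x \<le> g" for K unfolding g_def by (rule cSUP_upper[OF _ bdd]) simp
  have g0: "0 \<le> g" using le_g[of 0] by (simp add: gram_def)
  have dk: "\<bar>dense_seq k x\<bar> \<le> l2_norm \<mu> (dense_seq k) * sqrt g" for k
  proof -
    have "(dense_seq k x)\<^sup>2 \<le> (\<Sum>j<Suc k. (l2_inner \<mu> (dense_seq k) (gs j))\<^sup>2) * gram (Suc k) x"
      unfolding dense_seq_expand[OF x, of k] gram_def by (rule Cauchy_Schwarz_ineq_sum)
    also have "\<dots> \<le> (l2_norm \<mu> (dense_seq k))\<^sup>2 * g"
      unfolding dense_seq_parseval by (intro mult_left_mono le_g) simp
    also have "\<dots> = (l2_norm \<mu> (dense_seq k) * sqrt g)\<^sup>2" using g0 by (simp add: power_mult_distrib)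
    finally show ?thesis using g0 by (simp add: abs_le_square_iff[symmetric])
  qed
  have "(t x)\<^sup>2 \<le> g" if t: "t \<in> S" "l2_norm \<mu> t \<le> 1" for t
  proof -
    have "\<bar>t x\<bar> \<le> sqrt g + e" if e: "0 < e" for e
    proof -
      \<comment> \<open>The approximation error enters twice, through evaluation with factor
        \<open>b\<close> and through the norm of \<open>dense_seq k\<close> with factor
        \<open>sqrt g\<close>; the added 1 keeps the divisor positive.\<close>
      define e' where "e' = e / (sqrt g + b + 1)"
      have den: "0 < sqrt g + b + 1" using g0 b_nonneg by (intro add_nonneg_pos add_nonneg_nonneg) auto
      have e': "0 < e'" using e den by (simp add: e'_def)
      obtain k where k: "l2_norm \<mu> (\<lambda>x. t x - dense_seq k x) < e'" using dense_seq_dense[OF t(1) e'] by blast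
      have "\<bar>t x - dense_seq k x\<bar> \<le> b * l2_norm \<mu> (\<lambda>x. t x - dense_seq k x)"
        by (rule eval_bound[OF l2_subspace_diff[OF subspace t(1) dense_seq_in] x])
      also have "\<dots> \<le> b * e'" using k b_nonneg by (intro mult_left_mono) auto
      finally have 1: "\<bar>t x - dense_seq k x\<bar> \<le> b * e'" .
      have "l2_norm \<mu> (dense_seq k) \<le> l2_norm \<mu> t + l2_norm \<mu> (\<lambda>x. dense_seq k x - t x)"
        using l2_norm_triangle[of t \<mu> "\<lambda>x. dense_seq k x - t x"] t(1) dense_seq_in
        by (simp add: S_l2 l2_space_diff)
      then have "l2_norm \<mu> (dense_seq k) \<le> 1 + e'" using t(2) k l2_norm_minus[of \<mu> t "dense_seq k"] by linarith
      then have "l2_norm \<mu> (dense_seq k) * sqrt g \<le> (1 + e') * sqrt g" by (rule mult_right_mono) (use g0 in simp)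
      with 1 dk[of k] have "\<bar>t x\<bar> \<le> sqrt g + e' * (sqrt g + b)" by (simp add: algebra_simps)
      also have "e' * (sqrt g + b) \<le> e' * (sqrt g + b + 1)" using e' by (intro mult_left_mono) auto
      also have "\<dots> = e" using den by (simp add: e'_def)
      finally show ?thesis by simp
    qed
    then have "\<bar>t x\<bar> \<le> sqrt g" by (rule field_le_epsilon)
    then have "\<bar>t x\<bar>\<^sup>2 \<le> (sqrt g)\<^sup>2" by (intro power_mono) auto
    then show ?thesis using g0 by simp
  qed
  then have "Psi \<mu> S x \<le> g" unfolding Psi_def
    using subspace by (intro cSUP_least) (auto simp: l2_subspace_def l2_norm_def intro!: exI[of _ "\<lambda>x. 0"])
  moreover have "g \<le> Psi \<mu> S x" unfolding g_def by (rule cSUP_least) (use gram_le_Psi[OF x] in auto)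
  ultimately have "g = Psi \<mu> S x" by simp
  then show ?thesis using LIMSEQ_incseq_SUP[OF bdd gram_mono] by (simp add: g_def)
qed

lemma Psi_measurable [measurable]: "Psi \<mu> S \<in> borel_measurable \<mu>"
  by (rule borel_measurable_LIMSEQ_real[OF gram_tendsto_Psi gram_measurable])

end

section \<open>Empirical processes over a model\<close>

locale iid_density_sample = prob_space \<Omega> for \<Omega> :: "'w measure" +
  fixes \<mu> :: "'x measure" and s :: "'x \<Rightarrow> real" and X :: "nat \<Rightarrow> 'w \<Rightarrow> 'x" and n :: nat
  assumes n_pos: "1 \<le> n"
    and indep: "indep_vars (\<lambda>_. \<mu>) X {1..n}"
    and distributed_X: "\<And>i. i \<in> {1..n} \<Longrightarrow> distributed \<Omega> \<mu> (X i) (\<lambda>x. ennreal (s x))"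
    and s_nonneg: "AE x in \<mu>. 0 \<le> s x"
    and s_l2: "s \<in> l2_space \<mu>"
begin

definition law :: "'x measure" where
  "law = density \<mu> (\<lambda>x. ennreal (s x))"

lemma s_measurable [measurable]: "s \<in> borel_measurable \<mu>"
  using s_l2 by (rule l2_spaceD)

lemma space_law [simp]: "space law = space \<mu>"
  and sets_law [measurable_cong, simp]: "sets law = sets \<mu>"
  by (simp_all add: law_def)

lemma X_measurable [measurable]: "i \<in> {1..n} \<Longrightarrow> X i \<in> measurable \<Omega> \<mu>"
  using distributed_X by (auto simp: distributed_def)

lemma X_space: "i \<in> {1..n} \<Longrightarrow> \<omega> \<in> space \<Omega> \<Longrightarrow> X i \<omega> \<in> space \<mu>"
  using X_measurable by (rule measurable_space)

lemma distr_X: "i \<in> {1..n} \<Longrightarrow> distr \<Omega> \<mu> (X i) = law"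
  unfolding law_def by (rule distributed_distr_eq_density[OF distributed_X])

lemma prob_space_law: "prob_space law"
  using prob_space_distr[of "X 1" \<mu>] distr_X[of 1] n_pos by simp

sublocale L: prob_space law by (rule prob_space_law)

lemma measure_law_space: "measure law (space \<mu>) = 1"
  using L.prob_space by simp

lemma integral_law:
  assumes "f \<in> borel_measurable \<mu>"
  shows "(LINT x|law. f x) = dens_mean \<mu> s f"
  unfolding law_def dens_mean_def using assms s_nonneg
  by (subst integral_density) (auto simp: mult.commute)

lemma dens_mean_inner: "dens_mean \<mu> s f = l2_inner \<mu> f s"
  by (simp add: dens_mean_def l2_inner_def)

lemma integrable_law:
  fixes f :: "'x \<Rightarrow> real"
  assumes "f \<in> borel_measurable \<mu>" "\<And>x. x \<in> space \<mu> \<Longrightarrow> \<bar>f x\<bar> \<le> C"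
  shows "integrable law f"
  by (rule L.integrable_bounded_measurable[of f C]) (use assms in auto)

lemma distr_sample: "distr \<Omega> (Pi\<^sub>M {1..n} (\<lambda>_. \<mu>)) (\<lambda>\<omega>. \<lambda>i\<in>{1..n}. X i \<omega>) = Pi\<^sub>M {1..n} (\<lambda>_. law)"
proof -
  have "distr \<Omega> (Pi\<^sub>M {1..n} (\<lambda>_. \<mu>)) (\<lambda>\<omega>. \<lambda>i\<in>{1..n}. X i \<omega>) = Pi\<^sub>M {1..n} (\<lambda>i. distr \<Omega> \<mu> (X i))"
    using indep_vars_iff_distr_eq_PiM'[where I = "{1..n}" and M' = "\<lambda>_. \<mu>" and X = X] n_pos indep by auto
  also have "\<dots> = Pi\<^sub>M {1..n} (\<lambda>_. law)"
    by (rule PiM_cong) (auto simp: distr_X)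
  finally show ?thesis .
qed

text \<open>Moves a tail event from the sample to the product measure, where coordinates can be
  integrated out one at a time.\<close>

lemma prob_sample:
  assumes "g \<in> borel_measurable (Pi\<^sub>M {1..n} (\<lambda>_. law))"
  shows "prob {\<omega> \<in> space \<Omega>. t < g (\<lambda>i\<in>{1..n}. X i \<omega>)}
    = measure (Pi\<^sub>M {1..n} (\<lambda>_. law)) {w \<in> space (Pi\<^sub>M {1..n} (\<lambda>_. law)). t < (g w :: real)}"
proof -
  have ss: "sets (Pi\<^sub>M {1..n} (\<lambda>_. law)) = sets (Pi\<^sub>M {1..n} (\<lambda>_. \<mu>))"
    by (intro sets_PiM_cong) auto
  have sp: "space (Pi\<^sub>M {1..n} (\<lambda>_. law)) = space (Pi\<^sub>M {1..n} (\<lambda>_. \<mu>))"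
    using ss by (rule sets_eq_imp_space_eq)
  have [measurable]: "g \<in> borel_measurable (Pi\<^sub>M {1..n} (\<lambda>_. \<mu>))"
    using assms measurable_cong_sets[OF ss refl] by blast
  have mX: "(\<lambda>\<omega>. \<lambda>i\<in>{1..n}. X i \<omega>) \<in> measurable \<Omega> (Pi\<^sub>M {1..n} (\<lambda>_. \<mu>))"
    by (rule measurable_restrict) (rule X_measurable)
  show ?thesis
  proof -
    have "{w \<in> space (Pi\<^sub>M {1..n} (\<lambda>_. \<mu>)). t < g w} \<in> sets (Pi\<^sub>M {1..n} (\<lambda>_. \<mu>))" by measurable
    from measure_distr[OF mX this] show ?thesis
      unfolding distr_sample sp
      by (auto intro!: arg_cong[where f = prob] measurable_space[OF mX] simp del: One_nat_def)
  qed
qed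

section \<open>Bernstein's inequality for sums over the sample\<close>

lemma bernstein_sum:
  assumes f [measurable]: "f \<in> borel_measurable \<mu>"
    and bdd: "\<And>x. x \<in> space \<mu> \<Longrightarrow> \<bar>f x\<bar> \<le> F" and F: "0 \<le> F"
    and v: "dens_mean \<mu> s (\<lambda>x. (f x)\<^sup>2) \<le> v" "0 < v" and x: "0 < x"
  shows "prob {\<omega> \<in> space \<Omega>. real n * dens_mean \<mu> s f + sqrt (2 * (real n * v) * x) + F * x / 3
      < (\<Sum>i=1..n. f (X i \<omega>))} \<le> exp (- x)"
proof -
  let ?P = "Pi\<^sub>M {1..n} (\<lambda>_. law)"
  interpret P: prob_space ?P by (rule prob_space_PiM[OF prob_space_law])
  interpret product_sigma_finite "\<lambda>_. law" ..
  have mf: "f \<in> borel_measurable law" by measurable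
  have "prob {\<omega> \<in> space \<Omega>. real n * dens_mean \<mu> s f + sqrt (2 * (real n * v) * x) + F * x / 3
      < (\<Sum>i=1..n. f (X i \<omega>))}
    = measure ?P {w \<in> space ?P. real n * dens_mean \<mu> s f + sqrt (2 * (real n * v) * x) + F * x / 3
      < (\<Sum>i=1..n. f (w i))}"
    using mf by (subst prob_sample[symmetric]) (auto intro!: arg_cong[where f = prob] sum.cong)
  also have "\<dots> \<le> exp (- x)"
  proof (rule P.bernstein_tail[OF _ _ F _ x])
    show "(\<lambda>w. \<Sum>i=1..n. f (w i)) \<in> borel_measurable ?P" using mf by measurable
    show "0 < real n * v" using v n_pos by simp
    fix lam :: real assume lam: "0 < lam" "lam * F < 3"
    let ?E = "exp (lam * dens_mean \<mu> s f + lam\<^sup>2 * v / (2 * (1 - lam * F / 3)))"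
    have one: "(\<integral>\<^sup>+x. ennreal (exp (lam * f x)) \<partial>law) \<le> ennreal ?E"
      using L.expectation_exp_le_bernstein[OF mf, of F F lam v] bdd F lam v
      by (auto simp: integral_law abs_le_iff)
    have "(\<integral>\<^sup>+w. ennreal (exp (lam * (\<Sum>i=1..n. f (w i)))) \<partial>?P)
        = (\<integral>\<^sup>+w. (\<Prod>i\<in>{1..n}. ennreal (exp (lam * f (w i)))) \<partial>?P)"
      by (simp add: sum_distrib_left exp_sum prod_ennreal)
    also have "\<dots> = (\<Prod>i\<in>{1..n}. \<integral>\<^sup>+x. ennreal (exp (lam * f x)) \<partial>law)"
      using mf by (intro product_nn_integral_prod) auto
    also have "\<dots> \<le> (\<Prod>i\<in>{1..n}. ennreal ?E)"
      using one by (intro prod_mono_ennreal) auto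
    also have "\<dots> = ennreal (exp (real n * (lam * dens_mean \<mu> s f + lam\<^sup>2 * v / (2 * (1 - lam * F / 3)))))"
      by (simp add: ennreal_power flip: exp_of_nat_mult)
    also have "real n * (lam * dens_mean \<mu> s f + lam\<^sup>2 * v / (2 * (1 - lam * F / 3)))
        = lam * (real n * dens_mean \<mu> s f) + lam\<^sup>2 * (real n * v) / (2 * (1 - lam * F / 3))"
      by (simp add: algebra_simps)
    finally show "(\<integral>\<^sup>+w. ennreal (exp (lam * (\<Sum>i=1..n. f (w i)))) \<partial>?P)
      \<le> ennreal (exp (lam * (real n * dens_mean \<mu> s f) + lam\<^sup>2 * (real n * v) / (2 * (1 - lam * F / 3))))" .
  qed
  finally show ?thesis .
qed

end

section \<open>Uniform deviations over the functions of one model\<close>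

locale model_sample = iid_density_sample \<Omega> \<mu> s X n + eval_bounded_model \<mu> S b
  for \<Omega> :: "'w measure" and \<mu> :: "'x measure" and s X n S b
begin

lemma S_integrable_law: "t \<in> S \<Longrightarrow> integrable law t"
  by (rule integrable_law[OF S_measurable eval_bound])

lemma S_bound: "t \<in> S \<Longrightarrow> \<bar>dens_mean \<mu> s t\<bar> \<le> l2_norm \<mu> t * l2_norm \<mu> s"
  unfolding dens_mean_inner by (rule l2_cauchy_schwarz_abs[OF S_l2 s_l2])

lemma integrable_law_power2: "t \<in> S \<Longrightarrow> integrable law (\<lambda>x. (t x)\<^sup>2)"
proof (rule integrable_law)
  assume t: "t \<in> S"
  show "(\<lambda>x. (t x)\<^sup>2) \<in> borel_measurable \<mu>" using S_measurable[OF t] by measurable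
  show "\<bar>(t x)\<^sup>2\<bar> \<le> (b * l2_norm \<mu> t)\<^sup>2" if "x \<in> space \<mu>" for x
    using power_mono[OF eval_bound[OF t that], of 2] by simp
qed

text \<open>One factor of the square is bounded pointwise by evaluation, the other is integrated
  against \<open>s\<close> by Cauchy-Schwarz. This yields the weak variance
  \<open>b * l2_norm \<mu> s\<close> on the unit ball.\<close>

lemma second_moment_le:
  assumes t: "t \<in> S"
  shows "(LINT x|law. (t x)\<^sup>2) \<le> b * l2_norm \<mu> s * (l2_norm \<mu> t)\<^sup>2"
proof -
  note [measurable] = S_measurable[OF t]
  let ?c = "b * l2_norm \<mu> t"
  have c: "0 \<le> ?c" using b_nonneg by simp
  have i: "integrable law (\<lambda>x. ?c * \<bar>t x\<bar>)" using S_integrable_law[OF t] by simp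
  have "(LINT x|law. (t x)\<^sup>2) \<le> (LINT x|law. ?c * \<bar>t x\<bar>)"
    by (rule integral_mono_AE[OF integrable_law_power2[OF t] i AE_I2])
      (use mult_right_mono[OF eval_bound[OF t] abs_ge_zero] in
        \<open>simp add: power2_eq_square abs_mult_self_eq[of "t _", symmetric] del: abs_mult_self_eq\<close>)
  also have "\<dots> = ?c * l2_inner \<mu> (\<lambda>x. \<bar>t x\<bar>) s"
    by (simp add: integral_law dens_mean_inner)
  also have "\<dots> \<le> ?c * (l2_norm \<mu> t * l2_norm \<mu> s)"
    using l2_cauchy_schwarz[OF l2_space_abs[OF S_l2[OF t]] s_l2]
    by (intro mult_left_mono c) (simp add: l2_norm_abs)
  finally show ?thesis by (simp add: power2_eq_square algebra_simps)
qed

lemma mean_power2_le: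
  assumes t: "t \<in> S"
  shows "(dens_mean \<mu> s t)\<^sup>2 \<le> (LINT x|law. (t x)\<^sup>2)"
    and "(LINT x|law. (t x - dens_mean \<mu> s t)\<^sup>2) = (LINT x|law. (t x)\<^sup>2) - (dens_mean \<mu> s t)\<^sup>2"
proof -
  note [measurable] = S_measurable[OF t]
  have m: "(LINT x|law. t x) = dens_mean \<mu> s t" by (rule integral_law) measurable
  show "(LINT x|law. (t x - dens_mean \<mu> s t)\<^sup>2) = (LINT x|law. (t x)\<^sup>2) - (dens_mean \<mu> s t)\<^sup>2"
    using L.variance_eq[OF S_integrable_law[OF t] integrable_law_power2[OF t]] by (simp add: m)
  moreover have "0 \<le> (LINT x|law. (t x - dens_mean \<mu> s t)\<^sup>2)" by simp
  ultimately show "(dens_mean \<mu> s t)\<^sup>2 \<le> (LINT x|law. (t x)\<^sup>2)" by linarith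
qed

text \<open>The threshold of \<open>hilbert_norm_tail\<close> for \<open>n\<close> vectors with
  \<open>R = 2 * b\<close>, weak variance \<open>b * l2_norm \<mu> s\<close> and
  \<open>c = b * x\<close>, where the mean squared norm is replaced by its upper bound, the mean of
  \<open>Psi\<close>.\<close>

definition radius :: "real \<Rightarrow> real \<Rightarrow> real" where
  "radius A x = sqrt ((1 + A) * (real n * dens_mean \<mu> s (Psi \<mu> S)) + (b * x)\<^sup>2)
     + sqrt (2 * (2 * real n * (b * l2_norm \<mu> s) + (2 * b)\<^sup>2 / (2 * A)) * x)
     + (2 * b + (2 * b)\<^sup>2 / (2 * (b * x))) * x / 3"

text \<open>The coordinates of the random vectors are the centred values of the first
  \<open>K\<close> directions. The threshold does not depend on \<open>K\<close>, which permits the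
  later passage to the limit.\<close>

lemma gs_tail:
  assumes b: "0 < b" and A: "0 < A" and x: "0 < x"
  shows "prob {\<omega> \<in> space \<Omega>. radius A x
      < sqrt (\<Sum>j<K. (\<Sum>i=1..n. gs j (X i \<omega>) - dens_mean \<mu> s (gs j))\<^sup>2)} \<le> exp (- x)"
proof -
  let ?P = "Pi\<^sub>M {1..n} (\<lambda>_. law)"
  interpret P: prob_space ?P by (rule prob_space_PiM[OF prob_space_law])
  note [measurable] = S_measurable[OF gs_in]
  define p where "p = (\<lambda>j. dens_mean \<mu> s (gs j))"
  define y where "y = (\<lambda>j x. gs j x - p j)"
  have y [measurable]: "y j \<in> borel_measurable law" for j unfolding y_def by measurable
  have int_gram: "integrable law (gram K)"
    by (rule integrable_law[where C = "b\<^sup>2"]) (use gram_le gram_nonneg in auto)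
  have gram_int: "(LINT x|law. gram K x) = (\<Sum>j<K. (LINT x|law. (gs j x)\<^sup>2))"
    unfolding gram_def by (rule Bochner_Integration.integral_sum) (rule integrable_law_power2[OF gs_in])
  \<comment> \<open>Jensen's inequality in each coordinate, then the pointwise bound on the
    kernel.\<close>
  have sum_p: "(\<Sum>j<K. (p j)\<^sup>2) \<le> b\<^sup>2"
  proof -
    have "(\<Sum>j<K. (p j)\<^sup>2) \<le> (LINT x|law. gram K x)"
      unfolding gram_int p_def by (intro sum_mono mean_power2_le(1) gs_in)
    also have "\<dots> \<le> (LINT x|law. b\<^sup>2)"
      by (rule integral_mono_AE[OF int_gram]) (use gram_le in auto)
    finally show ?thesis by (simp add: measure_law_space)
  qed
  define W where "W = (LINT x|law. (\<Sum>j<K. (y j x)\<^sup>2))"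
  \<comment> \<open>Centring only decreases second moments, and every kernel stays below
    \<open>Psi\<close>.\<close>
  have WD: "W \<le> dens_mean \<mu> s (Psi \<mu> S)"
  proof -
    have "integrable law (\<lambda>x. (y j x)\<^sup>2)" for j
      unfolding y_def power2_diff
      using integrable_law_power2[OF gs_in] S_integrable_law[OF gs_in] by simp
    then have "W = (\<Sum>j<K. (LINT x|law. (y j x)\<^sup>2))"
      unfolding W_def by (rule Bochner_Integration.integral_sum)
    also have "\<dots> \<le> (\<Sum>j<K. (LINT x|law. (gs j x)\<^sup>2))"
      unfolding y_def p_def by (intro sum_mono) (simp add: mean_power2_le(2)[OF gs_in])
    also have "\<dots> = (LINT x|law. gram K x)" by (simp add: gram_int)
    also have "\<dots> \<le> (LINT x|law. Psi \<mu> S x)"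
      by (rule integral_mono_AE[OF int_gram])
        (use gram_le_Psi Psi_nonneg Psi_le in \<open>auto intro!: integrable_law[where C = "b\<^sup>2"]\<close>)
    finally show ?thesis by (simp add: integral_law)
  qed
  have W0: "0 \<le> W" unfolding W_def by (intro integral_nonneg_AE) (simp add: sum_nonneg)
  have bdd: "(\<Sum>j<K. (y j x)\<^sup>2) \<le> (2 * b)\<^sup>2" if "x \<in> space \<mu>" for x
  proof -
    have "(\<Sum>j<K. (y j x)\<^sup>2) \<le> (\<Sum>j<K. 2 * (gs j x)\<^sup>2 + 2 * (p j)\<^sup>2)"
    proof (rule sum_mono)
      fix j
      show "(y j x)\<^sup>2 \<le> 2 * (gs j x)\<^sup>2 + 2 * (p j)\<^sup>2"
        using zero_le_power2[of "gs j x + p j"] by (simp add: y_def power2_sum power2_diff)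
    qed
    also have "\<dots> = 2 * gram K x + 2 * (\<Sum>j<K. (p j)\<^sup>2)"
      by (simp add: gram_def sum.distrib sum_distrib_left)
    finally show ?thesis using gram_le[OF that, of K] sum_p by (simp add: power_mult_distrib)
  qed
  have mean: "(LINT x|law. y j x) = 0" for j
    using S_integrable_law[OF gs_in] by (simp add: y_def p_def integral_law measure_law_space)
  \<comment> \<open>A combination of the coordinates is a centred function of the model, to which
    \<open>second_moment_le\<close> applies.\<close>
  have weak: "(LINT x|law. (\<Sum>j<K. u j * y j x)\<^sup>2) \<le> b * l2_norm \<mu> s" if u: "(\<Sum>j<K. (u j)\<^sup>2) \<le> 1" for u
  proof -
    let ?t = "\<lambda>x. \<Sum>j<K. u j * gs j x"
    have t: "?t \<in> S" by (intro l2_subspace_sum[OF subspace] gs_in)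
    have pt: "dens_mean \<mu> s ?t = (\<Sum>j<K. u j * p j)"
      unfolding dens_mean_inner p_def by (rule l2_inner_sum_left) (auto intro: S_l2 gs_in s_l2)
    have "(LINT x|law. (\<Sum>j<K. u j * y j x)\<^sup>2) = (LINT x|law. (?t x - dens_mean \<mu> s ?t)\<^sup>2)"
      by (simp add: pt y_def right_diff_distrib sum_subtractf)
    also have "\<dots> \<le> (LINT x|law. (?t x)\<^sup>2)" unfolding mean_power2_le(2)[OF t] by simp
    also have "\<dots> \<le> b * l2_norm \<mu> s * (l2_norm \<mu> ?t)\<^sup>2" by (rule second_moment_le[OF t])
    also have "\<dots> \<le> b * l2_norm \<mu> s * 1"
      using norm_sum_gs[of u K] u b_nonneg by (intro mult_left_mono) auto
    finally show ?thesis by simp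
  qed
  define T where "T = sqrt ((1 + A) * (real n * W) + (b * x)\<^sup>2)
      + sqrt (2 * (2 * real n * (b * l2_norm \<mu> s) + (2 * b)\<^sup>2 / (2 * A)) * x)
      + (2 * b + (2 * b)\<^sup>2 / (2 * (b * x))) * x / 3"
  have T: "T \<le> radius A x"
    unfolding T_def radius_def using WD A by (simp add: mult_left_mono)
  have meas: "(\<lambda>w. sqrt (\<Sum>j<K. (\<Sum>i=1..n. y j (w i))\<^sup>2)) \<in> borel_measurable ?P"
    by measurable
  have "prob {\<omega> \<in> space \<Omega>. radius A x < sqrt (\<Sum>j<K. (\<Sum>i=1..n. y j (X i \<omega>))\<^sup>2)}
      = prob {\<omega> \<in> space \<Omega>. radius A x < sqrt (\<Sum>j<K. (\<Sum>i=1..n. y j ((\<lambda>i\<in>{1..n}. X i \<omega>) i))\<^sup>2)}"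
    by (auto intro!: arg_cong[where f = prob] sum.cong)
  also have "\<dots> = measure ?P {w \<in> space ?P. radius A x < sqrt (\<Sum>j<K. (\<Sum>i=1..n. y j (w i))\<^sup>2)}"
    by (rule prob_sample[OF meas])
  also have "\<dots> \<le> measure ?P {w \<in> space ?P. T < sqrt (\<Sum>j<K. (\<Sum>i=1..n. y j (w i))\<^sup>2)}"
    by (rule P.finite_measure_mono) (use T meas in auto)
  also have "\<dots> \<le> exp (- x)"
    unfolding T_def
    by (rule hilbert_norm_tail[OF prob_space_law _ y _ _ mean weak W_def])
      (use bdd b A x n_pos in auto)
  finally show ?thesis unfolding y_def p_def .
qed

text \<open>The events for growing \<open>K\<close> increase, so their union obeys the same bound.
  Outside the union, Cauchy-Schwarz in the Gram-Schmidt coordinates settles the dense sequence, and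
  continuity in the norm settles the remaining functions.\<close>

lemma uniform_tail:
  assumes A: "0 < A" and x: "0 < x"
  shows "\<exists>E\<in>events. prob E \<le> exp (- x) \<and>
    (\<forall>\<omega>\<in>space \<Omega> - E. \<forall>t\<in>S. \<bar>\<Sum>i=1..n. t (X i \<omega>) - dens_mean \<mu> s t\<bar> \<le> radius A x * l2_norm \<mu> t)"
proof (cases "b = 0")
  \<comment> \<open>Here every function of the model vanishes on the space. The case is separate
    because the tail bound is taken with \<open>c = b * x\<close>, which must be positive.\<close>
  case True
  have z: "t y = 0" if "t \<in> S" "y \<in> space \<mu>" for t y
    using eval_bound[OF that] True by simp
  have zs: "(\<Sum>i=1..n. t (X i \<omega>) - dens_mean \<mu> s t) = 0" if "t \<in> S" "\<omega> \<in> space \<Omega>" for t \<omega>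
  proof -
    have "dens_mean \<mu> s t = l2_inner \<mu> (\<lambda>_. 0) s"
      unfolding dens_mean_inner by (rule l2_inner_cong) (use z that in auto)
    then have "dens_mean \<mu> s t = 0" by (simp add: l2_inner_def)
    then show ?thesis using z[OF that(1) X_space[OF _ that(2)]] by simp
  qed
  have "0 \<le> dens_mean \<mu> s (Psi \<mu> S)"
    unfolding integral_law[OF Psi_measurable, symmetric]
    by (intro integral_nonneg_AE) (use Psi_nonneg in auto)
  then have "0 \<le> radius A x" unfolding radius_def using A by (simp add: True)
  then show ?thesis by (intro bexI[of _ "{}"]) (auto simp: zs simp del: One_nat_def)
next
  case False
  then have b: "0 < b" using b_nonneg by simp
  note [measurable] = S_measurable[OF gs_in]
  define r where "r = radius A x"
  define L where "L = (\<lambda>t \<omega>. \<Sum>i=1..n. t (X i \<omega>) - dens_mean \<mu> s t)"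
  define E where "E = (\<lambda>K. {\<omega> \<in> space \<Omega>. r < sqrt (\<Sum>j<K. (L (gs j) \<omega>)\<^sup>2)})"
  have [measurable]: "L (gs j) \<in> borel_measurable \<Omega>" for j
    unfolding L_def by measurable
  have E: "E K \<in> events" for K unfolding E_def by measurable
  have inc: "incseq E"
  proof (rule incseq_SucI)
    fix K
    have "sqrt (\<Sum>j<K. (L (gs j) \<omega>)\<^sup>2) \<le> sqrt (\<Sum>j<Suc K. (L (gs j) \<omega>)\<^sup>2)" for \<omega> by simp
    then show "E K \<subseteq> E (Suc K)" unfolding E_def by (auto intro: less_le_trans)
  qed
  have "(\<lambda>K. prob (E K)) \<longlonglongrightarrow> prob (\<Union>K. E K)"
    by (rule finite_Lim_measure_incseq) (use E inc in auto)
  then have pr: "prob (\<Union>K. E K) \<le> exp (- x)"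
    by (rule LIMSEQ_le_const2) (use gs_tail[OF b A x] in \<open>auto simp: E_def L_def r_def\<close>)
  have good: "\<bar>L t \<omega>\<bar> \<le> r * l2_norm \<mu> t" if \<omega>: "\<omega> \<in> space \<Omega> - (\<Union>K. E K)" and t: "t \<in> S" for t \<omega>
  proof -
    have sp: "X i \<omega> \<in> space \<mu>" if "i \<in> {1..n}" for i using X_space[OF that] \<omega> by simp
    have le: "sqrt (\<Sum>j<K. (L (gs j) \<omega>)\<^sup>2) \<le> r" for K using \<omega> by (auto simp: E_def not_less)
    have r0: "0 \<le> r" using le[of 0] by simp
    have Lk: "\<bar>L (dense_seq k) \<omega>\<bar> \<le> r * l2_norm \<mu> (dense_seq k)" for k
    proof -
      let ?c = "\<lambda>j. l2_inner \<mu> (dense_seq k) (gs j)"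
      have dm: "dens_mean \<mu> s (dense_seq k) = (\<Sum>j<Suc k. ?c j * dens_mean \<mu> s (gs j))"
      proof -
        have "dens_mean \<mu> s (dense_seq k) = l2_inner \<mu> (\<lambda>x. \<Sum>j<Suc k. ?c j * gs j x) s"
          unfolding dens_mean_inner by (rule l2_inner_cong) (use dense_seq_expand in auto)
        also have "\<dots> = (\<Sum>j<Suc k. ?c j * dens_mean \<mu> s (gs j))"
          unfolding dens_mean_inner by (rule l2_inner_sum_left) (auto intro: S_l2 gs_in s_l2)
        finally show ?thesis .
      qed
      have "L (dense_seq k) \<omega>
          = (\<Sum>i=1..n. \<Sum>j<Suc k. ?c j * (gs j (X i \<omega>) - dens_mean \<mu> s (gs j)))"
        unfolding L_def
      proof (rule sum.cong[OF refl])
        fix i assume "i \<in> {1..n}"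
        from dense_seq_expand[OF sp[OF this], of k]
        show "dense_seq k (X i \<omega>) - dens_mean \<mu> s (dense_seq k)
            = (\<Sum>j<Suc k. ?c j * (gs j (X i \<omega>) - dens_mean \<mu> s (gs j)))"
          by (simp add: dm right_diff_distrib sum_subtractf)
      qed
      also have "\<dots> = (\<Sum>j<Suc k. ?c j * L (gs j) \<omega>)"
        unfolding L_def sum_distrib_left by (rule sum.swap)
      finally have "(L (dense_seq k) \<omega>)\<^sup>2 \<le> (\<Sum>j<Suc k. (?c j)\<^sup>2) * (\<Sum>j<Suc k. (L (gs j) \<omega>)\<^sup>2)"
        using Cauchy_Schwarz_ineq_sum[of ?c "\<lambda>j. L (gs j) \<omega>" "{..<Suc k}"] by simp
      also have "\<dots> \<le> (l2_norm \<mu> (dense_seq k))\<^sup>2 * r\<^sup>2"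
        unfolding dense_seq_parseval
        by (intro mult_left_mono sqrt_le_D le) simp
      finally have "(L (dense_seq k) \<omega>)\<^sup>2 \<le> (r * l2_norm \<mu> (dense_seq k))\<^sup>2"
        by (simp add: power_mult_distrib mult.commute)
      then show ?thesis using r0 by (simp add: abs_le_square_iff[symmetric])
    qed
    \<comment> \<open>A Lipschitz bound whose constant grows with \<open>n\<close>; it only has to
      be finite, since the approximation error can be made arbitrarily small.\<close>
    have crude: "\<bar>L g \<omega>\<bar> \<le> real n * (b + l2_norm \<mu> s) * l2_norm \<mu> g" if g: "g \<in> S" for g
    proof -
      have "\<bar>L g \<omega>\<bar> \<le> (\<Sum>i=1..n. \<bar>g (X i \<omega>) - dens_mean \<mu> s g\<bar>)"
        unfolding L_def by (rule sum_abs)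
      also have "\<dots> \<le> (\<Sum>i=1..n. (b + l2_norm \<mu> s) * l2_norm \<mu> g)"
      proof (rule sum_mono)
        fix i assume "i \<in> {1..n}"
        from eval_bound[OF g sp[OF this]] S_bound[OF g]
        show "\<bar>g (X i \<omega>) - dens_mean \<mu> s g\<bar> \<le> (b + l2_norm \<mu> s) * l2_norm \<mu> g"
          by (simp add: algebra_simps)
      qed
      finally show ?thesis by simp
    qed
    have "\<bar>L t \<omega>\<bar> \<le> r * l2_norm \<mu> t + e" if e: "0 < e" for e
    proof -
      define C where "C = r + real n * (b + l2_norm \<mu> s) + 1"
      have C: "0 < C" using r0 b by (simp add: C_def add_nonneg_pos)
      obtain k where k: "l2_norm \<mu> (\<lambda>x. t x - dense_seq k x) < e / C"
        using dense_seq_dense[OF t, of "e / C"] e C by auto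
      let ?g = "\<lambda>x. t x - dense_seq k x"
      have g: "?g \<in> S" by (rule l2_subspace_diff[OF subspace t dense_seq_in])
      have split: "L t \<omega> = L (dense_seq k) \<omega> + L ?g \<omega>"
        unfolding L_def dens_mean_inner
        by (simp add: l2_inner_diff_left S_l2 t dense_seq_in s_l2 flip: sum.distrib)
      have "l2_norm \<mu> (dense_seq k) \<le> l2_norm \<mu> t + l2_norm \<mu> (\<lambda>x. dense_seq k x - t x)"
        using l2_norm_triangle[of t \<mu> "\<lambda>x. dense_seq k x - t x"] t dense_seq_in
        by (simp add: S_l2 l2_space_diff)
      then have "l2_norm \<mu> (dense_seq k) \<le> l2_norm \<mu> t + l2_norm \<mu> ?g"
        using l2_norm_minus[of \<mu> t "dense_seq k"] by simp
      then have "r * l2_norm \<mu> (dense_seq k) \<le> r * (l2_norm \<mu> t + l2_norm \<mu> ?g)"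
        using r0 by (rule mult_left_mono)
      then have "\<bar>L t \<omega>\<bar> \<le> r * l2_norm \<mu> t + (r + real n * (b + l2_norm \<mu> s)) * l2_norm \<mu> ?g"
        using split Lk[of k] crude[OF g] by (simp add: algebra_simps)
      also have "(r + real n * (b + l2_norm \<mu> s)) * l2_norm \<mu> ?g \<le> C * l2_norm \<mu> ?g"
        by (rule mult_right_mono) (auto simp: C_def)
      also have "\<dots> \<le> C * (e / C)" using k C by (intro mult_left_mono) auto
      also have "\<dots> = e" using C by simp
      finally show ?thesis by simp
    qed
    then show ?thesis by (rule field_le_epsilon)
  qed
  show ?thesis
  proof (intro bexI[of _ "\<Union>K. E K"] conjI ballI)
    show "(\<Union>K. E K) \<in> events" using E by auto
  qed (use pr good in \<open>auto simp: L_def r_def\<close>)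
qed

end

section \<open>The evaluation bound supplied by the sup-norm of \<open>Psi\<close>\<close>

lemma sup_norm_ge:
  assumes "\<And>x. x \<in> space \<mu> \<Longrightarrow> \<bar>f x\<bar> \<le> C" "x \<in> space \<mu>"
  shows "\<bar>f x\<bar> \<le> sup_norm \<mu> f"
  unfolding sup_norm_def using assms by (intro cSUP_upper bdd_aboveI2) auto

text \<open>Rescaling to norm one gives the bound when the norm is positive. When it is zero, all
  multiples of \<open>t\<close> lie in the unit ball, so \<open>t x\<close> must vanish for
  \<open>Psi\<close> to stay bounded.\<close>

lemma eval_bounded_model_Psi:
  assumes S: "l2_subspace \<mu> S" and sep: "l2_separable \<mu> S" and B: "Psi_bounded \<mu> S"
    and ne: "space \<mu> \<noteq> {}"
  shows "eval_bounded_model \<mu> S (sqrt (sup_norm \<mu> (Psi \<mu> S)))"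
proof
  obtain C where C: "\<And>t x. t \<in> S \<Longrightarrow> l2_norm \<mu> t \<le> 1 \<Longrightarrow> x \<in> space \<mu> \<Longrightarrow> (t x)\<^sup>2 \<le> C"
    using B unfolding Psi_bounded_def by blast
  have zero: "(\<lambda>x. 0) \<in> {t \<in> S. l2_norm \<mu> t \<le> 1}"
    using l2_subspace_zero[OF S] by (simp add: l2_norm_def)
  have le_Psi: "(t x)\<^sup>2 \<le> Psi \<mu> S x" if "t \<in> S" "l2_norm \<mu> t \<le> 1" "x \<in> space \<mu>" for t x
    unfolding Psi_def using that C by (intro cSUP_upper bdd_aboveI2[of _ _ C]) auto
  have Psi_le: "Psi \<mu> S x \<le> C" if "x \<in> space \<mu>" for x
    unfolding Psi_def using zero C that by (intro cSUP_least) blast+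
  have Psi0: "0 \<le> Psi \<mu> S x" if "x \<in> space \<mu>" for x
    using le_Psi[of "\<lambda>x. 0", OF _ _ that] zero by simp
  define M where "M = sup_norm \<mu> (Psi \<mu> S)"
  have le_M: "Psi \<mu> S x \<le> M" if "x \<in> space \<mu>" for x
    using sup_norm_ge[of \<mu> "Psi \<mu> S" C x] Psi_le Psi0 that by (simp add: M_def)
  obtain x0 where "x0 \<in> space \<mu>" using ne by blast
  then have M0: "0 \<le> M" using Psi0 le_M by (meson order_trans)
  then show "0 \<le> sqrt (sup_norm \<mu> (Psi \<mu> S))" by (simp add: M_def)
  fix t x assume t: "t \<in> S" and x: "x \<in> space \<mu>"
  have le: "c\<^sup>2 * (t x)\<^sup>2 \<le> M" if "\<bar>c\<bar> * l2_norm \<mu> t \<le> 1" for c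
    using le_Psi[OF l2_subspace_cmult[OF S t] _ x, of c] le_M[OF x] that
    by (simp add: l2_norm_cmult power_mult_distrib)
  have "(t x)\<^sup>2 \<le> M * (l2_norm \<mu> t)\<^sup>2"
  proof (cases "l2_norm \<mu> t = 0")
    case False
    have "(1 / l2_norm \<mu> t)\<^sup>2 * (t x)\<^sup>2 \<le> M" by (rule le) (use False in simp)
    moreover have "0 < (l2_norm \<mu> t)\<^sup>2" using False by simp
    ultimately show ?thesis by (simp add: power_divide pos_divide_le_eq)
  next
    case True
    have "(t x)\<^sup>2 = 0"
    proof (rule ccontr)
      assume "(t x)\<^sup>2 \<noteq> 0"
      then have p: "0 < (t x)\<^sup>2" by simp
      \<comment> \<open>Chosen so that the scaled value has square \<open>M + 1\<close>, beyond the
        supremum \<open>M\<close>.\<close>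
      define c where "c = sqrt ((M + 1) / (t x)\<^sup>2)"
      have "c\<^sup>2 = (M + 1) / (t x)\<^sup>2" using M0 p by (simp add: c_def)
      then have "c\<^sup>2 * (t x)\<^sup>2 = M + 1" using p by simp
      then show False using le[of c] True by simp
    qed
    then show ?thesis using M0 by simp
  qed
  then have "sqrt ((t x)\<^sup>2) \<le> sqrt (M * (l2_norm \<mu> t)\<^sup>2)" by (rule real_sqrt_le_mono)
  then show "\<bar>t x\<bar> \<le> sqrt (sup_norm \<mu> (Psi \<mu> S)) * l2_norm \<mu> t"
    by (simp add: real_sqrt_mult M_def)
qed (use S sep in auto)

section \<open>Weighted squares and orthogonal projections\<close>

lemma two_mult_le_weighted:
  fixes a b :: real
  assumes "0 < k"
  shows "2 * (a * b) \<le> k * a\<^sup>2 + b\<^sup>2 / k"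
proof -
  have "0 \<le> (k * a - b)\<^sup>2 / k" using assms by simp
  also have "\<dots> = k * a\<^sup>2 - 2 * (a * b) + b\<^sup>2 / k"
    using assms by (simp add: power2_diff field_simps) (simp add: power2_eq_square)
  finally show ?thesis by simp
qed

lemma power2_sum_le_weighted:
  fixes a b g :: real
  assumes "0 < g"
  shows "(a + b)\<^sup>2 \<le> (1 + g) * a\<^sup>2 + (1 + 1 / g) * b\<^sup>2"
  using two_mult_le_weighted[OF assms, of a b] by (simp add: power2_sum algebra_simps)

lemma l2_orth_proj:
  assumes S: "l2_subspace \<mu> S" and s: "s \<in> l2_space \<mu>" and p: "is_orth_proj \<mu> S s p"
  shows l2_orth_proj_pythagoras: "t \<in> S \<Longrightarrow> (l2_norm \<mu> (\<lambda>x. t x - s x))\<^sup>2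
      = (l2_norm \<mu> (\<lambda>x. t x - p x))\<^sup>2 + (l2_norm \<mu> (\<lambda>x. s x - p x))\<^sup>2"
    and l2_orth_proj_norm_le: "l2_norm \<mu> p \<le> l2_norm \<mu> s"
proof -
  have pS: "p \<in> S" and orth: "\<And>t. t \<in> S \<Longrightarrow> l2_inner \<mu> (\<lambda>x. s x - p x) t = 0"
    using p by (auto simp: is_orth_proj_def l2_inner_def)
  have l2: "\<And>t. t \<in> S \<Longrightarrow> t \<in> l2_space \<mu>" using S by (auto simp: l2_subspace_def)
  show "(l2_norm \<mu> (\<lambda>x. t x - s x))\<^sup>2
      = (l2_norm \<mu> (\<lambda>x. t x - p x))\<^sup>2 + (l2_norm \<mu> (\<lambda>x. s x - p x))\<^sup>2" if t: "t \<in> S"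
  proof -
    have tp: "(\<lambda>x. t x - p x) \<in> S" by (rule l2_subspace_diff[OF S t pS])
    have "(l2_norm \<mu> (\<lambda>x. (t x - p x) - (s x - p x)))\<^sup>2
      = (l2_norm \<mu> (\<lambda>x. t x - p x))\<^sup>2 - 2 * l2_inner \<mu> (\<lambda>x. t x - p x) (\<lambda>x. s x - p x)
        + (l2_norm \<mu> (\<lambda>x. s x - p x))\<^sup>2"
      by (rule l2_norm_power2_diff[OF l2[OF tp] l2_space_diff[OF s l2[OF pS]]])
    then show ?thesis using orth[OF tp] by (simp add: l2_inner_commute[of \<mu> "\<lambda>x. t x - p x"])
  qed
  have "(l2_norm \<mu> p)\<^sup>2 = l2_inner \<mu> s p"
    using orth[OF pS] l2_inner_diff_left[OF s l2[OF pS] l2[OF pS]] by (simp add: l2_norm_power2_inner)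
  also have "\<dots> \<le> l2_norm \<mu> s * l2_norm \<mu> p" by (rule l2_cauchy_schwarz[OF s l2[OF pS]])
  finally have "l2_norm \<mu> p * l2_norm \<mu> p \<le> l2_norm \<mu> s * l2_norm \<mu> p" by (simp add: power2_eq_square)
  then show "l2_norm \<mu> p \<le> l2_norm \<mu> s"
    using l2_norm_nonneg[of \<mu> p] l2_norm_nonneg[of \<mu> s] by (cases "l2_norm \<mu> p = 0") auto
qed

section \<open>The centred empirical process\<close>

context iid_density_sample
begin

definition emp_process :: "'w \<Rightarrow> ('x \<Rightarrow> real) \<Rightarrow> real" where
  "emp_process \<omega> t = emp_mean X n \<omega> t - dens_mean \<mu> s t"

lemma emp_process_sum: "emp_process \<omega> t = (\<Sum>i=1..n. t (X i \<omega>) - dens_mean \<mu> s t) / real n"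
  using n_pos by (simp add: emp_process_def emp_mean_def sum_subtractf diff_divide_distrib)

lemma emp_process_diff:
  assumes "t \<in> l2_space \<mu>" "u \<in> l2_space \<mu>"
  shows "emp_process \<omega> (\<lambda>x. t x - u x) = emp_process \<omega> t - emp_process \<omega> u"
  using assms s_l2
  by (simp add: emp_process_def emp_mean_def dens_mean_inner l2_inner_diff_left sum_subtractf diff_divide_distrib)

text \<open>The bounds for \<open>f\<close> and \<open>- f\<close> together. For
  \<open>F = 0\<close> the variance bound \<open>v\<close> may be zero, and there the process
  vanishes outright; hence the conditional form of its positivity.\<close>

lemma bernstein_two_sided:
  assumes f [measurable]: "f \<in> borel_measurable \<mu>"
    and bdd: "\<And>x. x \<in> space \<mu> \<Longrightarrow> \<bar>f x\<bar> \<le> F" and F: "0 \<le> F"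
    and v: "dens_mean \<mu> s (\<lambda>x. (f x)\<^sup>2) \<le> v" "F \<noteq> 0 \<Longrightarrow> 0 < v" and x: "0 < x"
  shows "\<exists>E\<in>events. prob E \<le> 2 * exp (- x) \<and>
    (\<forall>\<omega>\<in>space \<Omega> - E. real n * \<bar>emp_process \<omega> f\<bar> \<le> sqrt (2 * (real n * v) * x) + F * x / 3)"
proof -
  have np: "0 < real n" using n_pos by simp
  have en: "real n * \<bar>emp_process \<omega> f\<bar> = \<bar>(\<Sum>i=1..n. f (X i \<omega>)) - real n * dens_mean \<mu> s f\<bar>" for \<omega>
    unfolding emp_process_sum using np by (simp add: abs_divide sum_subtractf)
  show ?thesis
  proof (cases "F = 0")
    case True
    then have z: "f y = 0" if "y \<in> space \<mu>" for y using bdd[OF that] by simp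
    have "dens_mean \<mu> s f = l2_inner \<mu> (\<lambda>_. 0) s"
      unfolding dens_mean_inner by (rule l2_inner_cong) (use z in auto)
    then have d: "dens_mean \<mu> s f = 0" by (simp add: l2_inner_def)
    have "dens_mean \<mu> s (\<lambda>x. (f x)\<^sup>2) = l2_inner \<mu> (\<lambda>_. 0) s"
      unfolding dens_mean_inner by (rule l2_inner_cong) (use z in auto)
    then have "0 \<le> v" using v(1) by (simp add: l2_inner_def)
    then have "\<forall>\<omega>\<in>space \<Omega> - {}. real n * \<bar>emp_process \<omega> f\<bar> \<le> sqrt (2 * (real n * v) * x) + F * x / 3"
      unfolding en using z X_space x by (auto simp: d True)
    then show ?thesis by (intro bexI[of _ "{}"] conjI) auto
  next
    case False
    let ?g = "\<lambda>x. - f x"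
    let ?D = "sqrt (2 * (real n * v) * x) + F * x / 3"
    define E1 where "E1 = {\<omega> \<in> space \<Omega>. real n * dens_mean \<mu> s f + sqrt (2 * (real n * v) * x) + F * x / 3
      < (\<Sum>i=1..n. f (X i \<omega>))}"
    define E2 where "E2 = {\<omega> \<in> space \<Omega>. real n * dens_mean \<mu> s ?g + sqrt (2 * (real n * v) * x) + F * x / 3
      < (\<Sum>i=1..n. ?g (X i \<omega>))}"
    have E1: "prob E1 \<le> exp (- x)" unfolding E1_def
      by (rule bernstein_sum[OF f bdd F v(1) v(2)[OF False] x])
    have E2: "prob E2 \<le> exp (- x)" unfolding E2_def
      by (rule bernstein_sum[OF _ _ F _ v(2)[OF False] x]) (use bdd v in auto)
    have dg: "dens_mean \<mu> s ?g = - dens_mean \<mu> s f" by (simp add: dens_mean_def)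
    have [measurable]: "E1 \<in> events" "E2 \<in> events" unfolding E1_def E2_def by measurable
    have "prob (E1 \<union> E2) \<le> prob E1 + prob E2" by (rule measure_Un_le) auto
    then have pr: "prob (E1 \<union> E2) \<le> 2 * exp (- x)" using E1 E2 by linarith
    have "real n * \<bar>emp_process \<omega> f\<bar> \<le> ?D" if "\<omega> \<in> space \<Omega> - (E1 \<union> E2)" for \<omega>
      using that unfolding en E1_def E2_def dg sum_negf by (auto simp: not_less abs_le_iff)
    then show ?thesis using pr by (intro bexI[of _ "E1 \<union> E2"]) auto
  qed
qed

end

section \<open>Deviation radius and variance in terms of the penalty quantities\<close>

context model_sample
begin

lemma radius_nonneg:
  assumes "0 < A" "0 < x"
  shows "0 \<le> radius A x"
proof -
  have "0 \<le> dens_mean \<mu> s (Psi \<mu> S)"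
    unfolding integral_law[OF Psi_measurable, symmetric]
    by (intro integral_nonneg_AE) (use Psi_nonneg in auto)
  then show ?thesis unfolding radius_def using assms b_nonneg
    by (intro add_nonneg_nonneg real_sqrt_ge_zero mult_nonneg_nonneg divide_nonneg_nonneg) auto
qed

text \<open>Everything is expressed through \<open>r\<close>: the lower bound on \<open>x\<close>
  turns \<open>b\<close> and \<open>b\<^sup>2 * x\<close> into multiples of \<open>b * x\<close> and
  of its square. The weight \<open>g\<close> sets how far the factor of the main term exceeds
  \<open>1 + A\<close>, at the expense of the other terms.\<close>

lemma radius_power2_le:
  assumes A: "0 < A" and g: "0 < g" and x: "2 / 3 \<le> x" and r: "r = b * x / real n"
  shows "(radius A x / real n)\<^sup>2 \<le> (1 + g) * (1 + A) * (dens_mean \<mu> s (Psi \<mu> S) / real n)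
    + (1 + 1 / g) * (8 * (l2_norm \<mu> s * r) + (12 / A + 128 / 9) * r\<^sup>2)"
proof -
  have np: "0 < real n" using n_pos by simp
  have x0: "0 < x" using x by simp
  define D where "D = dens_mean \<mu> s (Psi \<mu> S)"
  define a where "a = l2_norm \<mu> s"
  have a0: "0 \<le> a" by (simp add: a_def)
  have D0: "0 \<le> D" unfolding D_def integral_law[OF Psi_measurable, symmetric]
    by (intro integral_nonneg_AE) (use Psi_nonneg in auto)
  have r0: "0 \<le> r" using b_nonneg x0 by (simp add: r)
  have br: "b * x = real n * r" using np by (simp add: r)
  have 1: "sqrt ((1 + A) * (real n * D) + (b * x)\<^sup>2) \<le> real n * (sqrt ((1 + A) * (D / real n)) + r)"
  proof -
    have "sqrt ((1 + A) * (real n * D) + (b * x)\<^sup>2) \<le> sqrt ((1 + A) * (real n * D)) + sqrt ((b * x)\<^sup>2)"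
      using A D0 by (intro sqrt_add_le_add_sqrt) auto
    also have "sqrt ((1 + A) * (real n * D)) = real n * sqrt ((1 + A) * (D / real n))"
    proof -
      have "(1 + A) * (real n * D) = (real n)\<^sup>2 * ((1 + A) * (D / real n))"
        using np by (simp add: power2_eq_square)
      then show ?thesis by (simp only: real_sqrt_mult[of "(real n)\<^sup>2"] real_sqrt_abs abs_of_nat)
    qed
    also have "sqrt ((b * x)\<^sup>2) = real n * r" using r0 np by (simp add: br)
    finally show ?thesis by (simp add: distrib_left)
  qed
  have bb: "b\<^sup>2 * x \<le> 3 / 2 * (real n * r)\<^sup>2"
  proof -
    have "b\<^sup>2 * x * 1 \<le> b\<^sup>2 * x * (3 / 2 * x)" using x by (intro mult_left_mono) auto
    also have "\<dots> = 3 / 2 * (b * x)\<^sup>2" by (simp add: power2_eq_square)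
    finally show ?thesis by (simp add: br)
  qed
  have 2: "sqrt (2 * (2 * real n * (b * a) + (2 * b)\<^sup>2 / (2 * A)) * x)
      \<le> real n * sqrt (4 * (a * r) + 6 / A * r\<^sup>2)"
  proof -
    have "2 * (2 * real n * (b * a) + (2 * b)\<^sup>2 / (2 * A)) * x
        = 4 * real n * a * (b * x) + 4 / A * (b\<^sup>2 * x)"
      by (simp add: power_mult_distrib algebra_simps)
    also have "\<dots> \<le> 4 * real n * a * (b * x) + 4 / A * (3 / 2 * (real n * r)\<^sup>2)"
      using A bb by (intro add_left_mono mult_left_mono) auto
    also have "\<dots> = (real n)\<^sup>2 * (4 * (a * r) + 6 / A * r\<^sup>2)"
      unfolding br by (simp add: power2_eq_square algebra_simps)
    finally have "sqrt (2 * (2 * real n * (b * a) + (2 * b)\<^sup>2 / (2 * A)) * x)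
        \<le> sqrt ((real n)\<^sup>2 * (4 * (a * r) + 6 / A * r\<^sup>2))"
      by (rule real_sqrt_le_mono)
    then show ?thesis using np by (simp add: real_sqrt_mult)
  qed
  have 3: "(2 * b + (2 * b)\<^sup>2 / (2 * (b * x))) * x / 3 \<le> real n * (5 / 3 * r)"
  proof -
    have "(2 * b + (2 * b)\<^sup>2 / (2 * (b * x))) * x / 3 = 2 / 3 * (b * x + b)"
      using x0 by (cases "b = 0") (simp_all add: power2_eq_square field_simps)
    also have "\<dots> \<le> 2 / 3 * (b * x + 3 / 2 * (b * x))"
      using mult_left_mono[OF x b_nonneg] by simp
    also have "\<dots> = real n * (5 / 3 * r)" by (simp add: br)
    finally show ?thesis .
  qed
  \<comment> \<open>\<open>U2\<close> collects \<open>r\<close> from the summand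
    \<open>(b * x)\<^sup>2\<close> in the first root and \<open>5 / 3 * r\<close> from the linear
    Bernstein term. Doubling the squares below produces the coefficients 8, \<open>12 / A\<close>
    and 128 / 9.\<close>
  define P U1 U2 where "P = sqrt ((1 + A) * (D / real n))" and "U1 = sqrt (4 * (a * r) + 6 / A * r\<^sup>2)"
    and "U2 = 8 / 3 * r"
  have "radius A x \<le> real n * (P + r) + real n * U1 + real n * (5 / 3 * r)"
    using 1 2 3 unfolding radius_def D_def[symmetric] a_def[symmetric] P_def U1_def by linarith
  also have "\<dots> = real n * (P + (U1 + U2))" by (simp add: U2_def algebra_simps)
  finally have "radius A x \<le> real n * (P + (U1 + U2))" .
  then have "radius A x / real n \<le> P + (U1 + U2)" using np by (simp add: pos_divide_le_eq mult.commute)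
  then have "(radius A x / real n)\<^sup>2 \<le> (P + (U1 + U2))\<^sup>2"
    using radius_nonneg[OF A x0] np by (intro power_mono) auto
  also have "\<dots> \<le> (1 + g) * P\<^sup>2 + (1 + 1 / g) * (U1 + U2)\<^sup>2" by (rule power2_sum_le_weighted[OF g])
  also have "\<dots> \<le> (1 + g) * P\<^sup>2 + (1 + 1 / g) * (2 * U1\<^sup>2 + 2 * U2\<^sup>2)"
    using power2_sum_le_weighted[of 1 U1 U2] g by (intro add_left_mono mult_left_mono) auto
  also have "P\<^sup>2 = (1 + A) * (D / real n)" using A D0 by (simp add: P_def)
  also have "2 * U1\<^sup>2 + 2 * U2\<^sup>2 = 8 * (a * r) + (12 / A + 128 / 9) * r\<^sup>2"
    using A a0 r0 by (simp add: U1_def U2_def power_mult_distrib power2_eq_square algebra_simps)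
  finally show ?thesis by (simp add: D_def a_def mult.assoc)
qed

text \<open>Splitting \<open>s = p + (s - p)\<close> and bounding the \<open>p\<close> part by \<open>b\<close> avoids any bound on \<open>s\<close> itself.\<close>

lemma proj_diff_second_moment:
  assumes p: "is_orth_proj \<mu> S s p" and q: "q \<in> l2_space \<mu>"
    and F: "\<And>x. x \<in> space \<mu> \<Longrightarrow> \<bar>p x - q x\<bar> \<le> F" "0 \<le> F"
    and rho: "(l2_norm \<mu> (\<lambda>x. s x - p x))\<^sup>2 \<le> rho" "(l2_norm \<mu> (\<lambda>x. s x - q x))\<^sup>2 \<le> rho"
  shows "dens_mean \<mu> s (\<lambda>x. (p x - q x)\<^sup>2) \<le> 4 * (b * l2_norm \<mu> s) * rho + 2 * F * rho"
proof -
  have pS: "p \<in> S" using p by (simp add: is_orth_proj_def)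
  note pl = S_l2[OF pS]
  let ?g = "\<lambda>x. p x - q x" and ?d = "\<lambda>x. s x - p x"
  have gl: "?g \<in> l2_space \<mu>" by (rule l2_space_diff[OF pl q])
  have dl: "?d \<in> l2_space \<mu>" by (rule l2_space_diff[OF s_l2 pl])
  have rho0: "0 \<le> rho" using rho(1) zero_le_power2 order_trans by blast
  let ?c = "b * l2_norm \<mu> p"
  have c: "0 \<le> ?c" using b_nonneg by simp
  have i1: "integrable \<mu> (\<lambda>x. (?g x)\<^sup>2)" by (rule l2_space_integrable_power2[OF gl])
  have i2: "integrable \<mu> (\<lambda>x. \<bar>?g x\<bar> * \<bar>?d x\<bar>)"
    by (rule l2_space_integrable_mult[OF l2_space_abs[OF gl] l2_space_abs[OF dl]])
  have pt: "(?g x)\<^sup>2 * s x \<le> ?c * (?g x)\<^sup>2 + F * (\<bar>?g x\<bar> * \<bar>?d x\<bar>)" if x: "x \<in> space \<mu>" for x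
  proof -
    have "(?g x)\<^sup>2 * s x \<le> (?g x)\<^sup>2 * (?c + \<bar>?d x\<bar>)"
      using eval_bound[OF pS x] by (intro mult_left_mono) auto
    also have "\<dots> = ?c * (?g x)\<^sup>2 + (?g x)\<^sup>2 * \<bar>?d x\<bar>" by (simp add: algebra_simps)
    also have "(?g x)\<^sup>2 * \<bar>?d x\<bar> \<le> F * (\<bar>?g x\<bar> * \<bar>?d x\<bar>)"
    proof -
      have "\<bar>?g x\<bar> * \<bar>?g x\<bar> * \<bar>?d x\<bar> \<le> F * \<bar>?g x\<bar> * \<bar>?d x\<bar>"
        using F(1)[OF x] by (intro mult_right_mono) auto
      then show ?thesis by (simp add: power2_eq_square mult.assoc)
    qed
    finally show ?thesis by simp
  qed
  have "dens_mean \<mu> s (\<lambda>x. (?g x)\<^sup>2) \<le> (LINT x|\<mu>. ?c * (?g x)\<^sup>2 + F * (\<bar>?g x\<bar> * \<bar>?d x\<bar>))"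
    unfolding dens_mean_def
  proof (rule integral_mono_AE')
    show "AE x in \<mu>. (?g x)\<^sup>2 * s x \<le> ?c * (?g x)\<^sup>2 + F * (\<bar>?g x\<bar> * \<bar>?d x\<bar>)"
      using pt by (rule AE_I2)
    show "AE x in \<mu>. 0 \<le> ?c * (?g x)\<^sup>2 + F * (\<bar>?g x\<bar> * \<bar>?d x\<bar>)"
      using c F(2) by (intro AE_I2 add_nonneg_nonneg mult_nonneg_nonneg b_nonneg) auto
  qed (use i1 i2 in simp)
  also have "\<dots> = ?c * (l2_norm \<mu> ?g)\<^sup>2 + F * l2_inner \<mu> (\<lambda>x. \<bar>?g x\<bar>) (\<lambda>x. \<bar>?d x\<bar>)"
    using i1 i2 by (simp add: l2_norm_power2 l2_inner_def)
  also have "\<dots> \<le> b * l2_norm \<mu> s * (4 * rho) + F * (2 * rho)"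
  proof (intro add_mono mult_mono)
    \<comment> \<open>\<open>p - q\<close> is the difference of two residuals of \<open>s\<close>,
      each of norm at most \<open>sqrt rho\<close>; this is the source of the factors 4 and
      2.\<close>
    have "l2_norm \<mu> ?g = l2_norm \<mu> (\<lambda>x. (s x - q x) + (-1) * (s x - p x))" by simp
    also have "\<dots> \<le> l2_norm \<mu> (\<lambda>x. s x - q x) + l2_norm \<mu> (\<lambda>x. (-1) * (s x - p x))"
      by (rule l2_norm_triangle[OF l2_space_diff[OF s_l2 q] l2_space_cmult[OF dl]])
    also have "\<dots> = l2_norm \<mu> (\<lambda>x. s x - q x) + l2_norm \<mu> ?d" by (subst l2_norm_cmult) simp
    also have "\<dots> \<le> sqrt rho + sqrt rho"
      using rho by (intro add_mono real_le_rsqrt) auto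
    finally have g: "l2_norm \<mu> ?g \<le> 2 * sqrt rho" by simp
    from power_mono[OF g, of 2] show "(l2_norm \<mu> ?g)\<^sup>2 \<le> 4 * rho"
      using rho0 by (simp add: power_mult_distrib)
    have d: "l2_norm \<mu> ?d \<le> sqrt rho" using rho(1) by (rule real_le_rsqrt)
    have "l2_inner \<mu> (\<lambda>x. \<bar>?g x\<bar>) (\<lambda>x. \<bar>?d x\<bar>) \<le> l2_norm \<mu> ?g * l2_norm \<mu> ?d"
      using l2_cauchy_schwarz[OF l2_space_abs[OF gl] l2_space_abs[OF dl]] by (simp add: l2_norm_abs)
    also have "\<dots> \<le> 2 * sqrt rho * sqrt rho"
      using g d rho0 by (intro mult_mono) auto
    finally show "l2_inner \<mu> (\<lambda>x. \<bar>?g x\<bar>) (\<lambda>x. \<bar>?d x\<bar>) \<le> 2 * rho" using rho0 by (simp add: mult.assoc)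
    show "l2_norm \<mu> p \<le> l2_norm \<mu> s" by (rule l2_orth_proj_norm_le[OF subspace s_l2 p])
    show "0 \<le> l2_inner \<mu> (\<lambda>x. \<bar>?g x\<bar>) (\<lambda>x. \<bar>?d x\<bar>)"
      unfolding l2_inner_def by (intro integral_nonneg_AE) simp
  qed (use b_nonneg F in auto)
  finally show ?thesis by (simp add: algebra_simps)
qed

end

text \<open>The two bounds on \<open>Z = Z\<^sub>m\<^sup>2\<close> are \<open>radius_power2_le\<close> below and above \<open>\<nu> = 1/4\<close>, with
  \<open>(A, g) = (1/4, 1/5)\<close> and \<open>(4, 2)\<close>: for small \<open>\<nu>\<close> only the factor of \<open>E = P\<Psi>\<^sub>m / n\<close> is tight,
  for large \<open>\<nu>\<close> only those of the \<open>r\<close> terms.\<close>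

lemma penalty_absorbs:
  fixes nu E a r L0 pen :: real
  assumes nu: "0 < nu" "nu < 1" and nonneg: "0 \<le> E" "0 \<le> a" "0 \<le> r" and L0: "L0 = 16 / ln 2 + 8"
    and pen: "(5 / 2 + 2 * L0 * nu) * E + 2 * L0 * a / nu * r + 2 * L0 / nu ^ 3 * r\<^sup>2 \<le> pen"
    and small: "nu \<le> 1 / 4 \<Longrightarrow> Z \<le> 3 / 2 * E + 48 * (a * r) + 374 * r\<^sup>2"
    and large: "1 / 4 < nu \<Longrightarrow> Z \<le> 15 * E + 12 * (a * r) + 26 * r\<^sup>2"
  shows "Z / (19 / 20) + 91 / 100 * E + 40 * (a * r) \<le> pen"
proof -
  have ln2: "0 < ln (2::real)" "ln (2::real) \<le> 25 / 36" using ln2_le_25_over_36 by auto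
  \<comment> \<open>This gives \<open>L0\<close> at least 31.04, rounded down so that
    \<open>2 * L0\<close> is at least 61.\<close>
  have "16 / (25 / 36) \<le> 16 / ln (2::real)" using ln2 by (intro divide_left_mono) auto
  then have L: "61 / 2 \<le> L0" by (simp add: L0)
  have ar: "0 \<le> a * r" and r2: "0 \<le> r\<^sup>2" using nonneg by auto
  have Z: "Z / (19 / 20) = 20 / 19 * Z" by simp
  define c1 c2 c3 where "c1 = 2 * L0 * nu" and "c2 = 2 * L0 / nu" and "c3 = 2 * L0 / nu ^ 3"
  have pen': "5 / 2 * E + c1 * E + c2 * (a * r) + c3 * r\<^sup>2 \<le> pen"
    using pen by (simp add: c1_def c2_def c3_def distrib_right)
  show ?thesis
  proof (cases "nu \<le> 1 / 4")
    case True
    have c1: "0 \<le> c1" using L nu by (simp add: c1_def)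
    \<comment> \<open>244 and, below, 3904 are 61 divided by \<open>nu\<close> and by
      \<open>nu ^ 3\<close> at the largest value 1 / 4 of this case.\<close>
    have c2: "244 \<le> c2"
    proof -
      have "244 * nu \<le> 2 * L0" using True L by linarith
      then show ?thesis using nu by (simp add: c2_def pos_le_divide_eq)
    qed
    have c3: "3904 \<le> c3"
    proof -
      have "nu ^ 3 \<le> (1 / 4) ^ 3" using True nu by (intro power_mono) auto
      then have "3904 * nu ^ 3 \<le> 2 * L0" using L by (simp add: power_divide)
      then show ?thesis using nu by (simp add: c3_def pos_le_divide_eq)
    qed
    \<comment> \<open>The coefficient of \<open>E\<close> needed is 30 / 19 + 91 / 100, just below 5
      / 2, so \<open>c1\<close> enters only through its sign.\<close>
    show ?thesis unfolding Z
      using mult_right_mono[OF c1 nonneg(1)] mult_right_mono[OF c2 ar] mult_right_mono[OF c3 r2]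
        pen' small[OF True] nonneg ar r2 by linarith
  next
    case False
    have c1: "61 / 4 \<le> c1"
    proof -
      have "(61 / 2) * (1 / 4) \<le> L0 * nu" using L False nu by (intro mult_mono) auto
      then show ?thesis by (simp add: c1_def)
    qed
    have c2: "61 \<le> c2"
    proof -
      have "61 * nu \<le> 2 * L0" using nu L by linarith
      then show ?thesis using nu by (simp add: c2_def pos_le_divide_eq)
    qed
    have c3: "61 \<le> c3"
    proof -
      have "nu ^ 3 \<le> 1" using nu by (intro power_le_one) auto
      then have "61 * nu ^ 3 \<le> 2 * L0" using L by linarith
      then show ?thesis using nu by (simp add: c3_def pos_le_divide_eq)
    qed
    show ?thesis unfolding Z
      using mult_right_mono[OF c1 nonneg(1)] mult_right_mono[OF c2 ar] mult_right_mono[OF c3 r2]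
        pen' large False nonneg ar r2 by linarith
  qed
qed

text \<open>The variance has two parts. The one with \<open>b * a\<close> becomes a geometric mean
  of \<open>rho\<close> and \<open>a * r\<close> and is shared between them; the one with
  \<open>F\<close> becomes a multiple of \<open>sqrt e * rho\<close> through the bound on
  \<open>F * x\<close>. The coefficient 91 / 100 is 40 / 100 from the first part plus 51 / 100 from
  the second and the linear term.\<close>

lemma bernstein_absorbs:
  fixes e :: real
  assumes e: "0 \<le> e" "4 * sqrt e + e / 3 \<le> 1 / 2" and nn: "0 < n" "0 \<le> a" "0 \<le> b" "0 \<le> F" "0 \<le> rho"
    and x: "0 < x" "x \<le> 2 * y" and F: "F * x \<le> e * (n * rho)"
    and r: "r = b * y / n" and v: "v = 4 * (b * a) * rho + 2 * F * rho"
    and T: "n * T \<le> sqrt (2 * (n * v) * x) + F * x / 3"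
  shows "2 * T \<le> 91 / 100 * rho + 40 * (a * r)"
proof -
  have ar: "0 \<le> a * r" using nn x by (simp add: r)
  have bx: "b * x \<le> 2 * (n * r)" using mult_left_mono[OF x(2) nn(3)] nn by (simp add: r)
  have "2 * (n * v) * x = 8 * (n * a * rho) * (b * x) + 4 * (n * rho) * (F * x)"
    by (simp add: v algebra_simps)
  also have "\<dots> \<le> 8 * (n * a * rho) * (2 * (n * r)) + 4 * (n * rho) * (e * (n * rho))"
    using bx F nn by (intro add_mono mult_left_mono) auto
  also have "\<dots> = n\<^sup>2 * (16 * (rho * (a * r)) + 4 * (e * rho\<^sup>2))"
    by (simp add: power2_eq_square algebra_simps)
  finally have "sqrt (2 * (n * v) * x) \<le> sqrt (n\<^sup>2 * (16 * (rho * (a * r)) + 4 * (e * rho\<^sup>2)))"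
    by (rule real_sqrt_le_mono)
  also have "\<dots> = n * sqrt (16 * (rho * (a * r)) + 4 * (e * rho\<^sup>2))"
    using nn by (simp add: real_sqrt_mult)
  also have "\<dots> \<le> n * (sqrt (16 * (rho * (a * r))) + sqrt (4 * (e * rho\<^sup>2)))"
    using nn ar e by (intro mult_left_mono sqrt_add_le_add_sqrt) auto
  also have "sqrt (16 * (rho * (a * r))) = 4 * sqrt (rho * (a * r))"
    by (simp add: real_sqrt_mult)
  also have "sqrt (4 * (e * rho\<^sup>2)) = 2 * (sqrt e * rho)"
    using nn by (simp add: real_sqrt_mult)
  finally have "n * T \<le> n * (4 * sqrt (rho * (a * r)) + 2 * (sqrt e * rho) + e * rho / 3)"
    using T F by (simp add: algebra_simps)
  then have T': "T \<le> 4 * sqrt (rho * (a * r)) + 2 * (sqrt e * rho) + e * rho / 3"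
    using nn by simp
  have "2 * (sqrt rho * sqrt (a * r)) \<le> 1 / 10 * (sqrt rho)\<^sup>2 + (sqrt (a * r))\<^sup>2 / (1 / 10)"
    by (rule two_mult_le_weighted) simp
  then have s: "8 * sqrt (rho * (a * r)) \<le> 4 / 10 * rho + 40 * (a * r)"
    using nn ar by (simp only: real_sqrt_mult[of rho] real_sqrt_pow2) simp
  \<comment> \<open>This comes from \<open>4 * sqrt e \<le> 1 / 2\<close>. Doubling \<open>T\<close>
    leaves \<open>2 / 3 * e\<close> instead of \<open>e / 3\<close>, and the excess is at most 1 /
    192.\<close>
  have se: "sqrt e \<le> 1 / 8" using e by simp
  have "e = sqrt e * sqrt e" using e by simp
  also have "\<dots> \<le> 1 / 8 * (1 / 8)" using se e by (intro mult_mono) auto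
  finally have "4 * sqrt e + 2 / 3 * e \<le> 51 / 100" using e by simp
  then have "(4 * sqrt e + 2 / 3 * e) * rho \<le> 51 / 100 * rho" using nn by (intro mult_right_mono) auto
  then show ?thesis using T' s by (simp add: algebra_simps)
qed

section \<open>The exceptional event of a single model\<close>

context model_sample
begin

text \<open>Off the uniform event the part \<open>t - p\<close> costs 19 / 20 of its squared norm
  plus a multiple of \<open>Z\<^sup>2\<close>; off the Bernstein event the fixed part
  \<open>p - q\<close> costs multiples of \<open>rho\<close> and \<open>a * r\<close>. Pythagoras
  reassembles the distance from \<open>t\<close> to \<open>s\<close>.\<close>

lemma model_event:
  assumes p: "is_orth_proj \<mu> S s p" and q: "q \<in> l2_space \<mu>"
    and F: "\<And>x. x \<in> space \<mu> \<Longrightarrow> \<bar>p x - q x\<bar> \<le> F" "0 \<le> F"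
    and rho: "rho = (l2_norm \<mu> (\<lambda>x. s x - p x))\<^sup>2 + dens_mean \<mu> s (Psi \<mu> S) / real n"
      "0 < rho" "(l2_norm \<mu> (\<lambda>x. s x - q x))\<^sup>2 \<le> rho"
    and e: "0 \<le> e" "4 * sqrt e + e / 3 \<le> 1 / 2"
    and x: "2 / 3 \<le> x" and y: "0 < y" "y \<le> 2 * x" and Fy: "F * y \<le> e * (real n * rho)"
    and nu: "0 < nu" "nu < 1" and L0: "L0 = 16 / ln 2 + 8" and r: "r = b * x / real n"
    and pen: "(5 / 2 + 2 * L0 * nu) * (dens_mean \<mu> s (Psi \<mu> S) / real n)
      + 2 * L0 * l2_norm \<mu> s / nu * r + 2 * L0 / nu ^ 3 * r\<^sup>2 \<le> pen"
  shows "\<exists>E\<in>events. prob E \<le> exp (- x) + 2 * exp (- y) \<and>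
    (\<forall>\<omega>\<in>space \<Omega> - E. \<forall>t\<in>S. 2 * \<bar>emp_process \<omega> t - emp_process \<omega> q\<bar>
      \<le> 19 / 20 * (l2_norm \<mu> (\<lambda>x. t x - s x))\<^sup>2 + pen)"
proof -
  have np: "0 < real n" using n_pos by simp
  have pS: "p \<in> S" using p by (simp add: is_orth_proj_def)
  have x0: "0 < x" using x by simp
  define D where "D = dens_mean \<mu> s (Psi \<mu> S) / real n"
  define a where "a = l2_norm \<mu> s"
  define A where "A = (if nu \<le> 1 / 4 then 1 / 4 else 4 :: real)"
  define d where "d = (l2_norm \<mu> (\<lambda>x. s x - p x))\<^sup>2"
  have d0: "0 \<le> d" by (simp add: d_def)
  have D0: "0 \<le> D" unfolding D_def integral_law[OF Psi_measurable, symmetric]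
    by (intro divide_nonneg_nonneg integral_nonneg_AE) (use Psi_nonneg in auto)
  have a0: "0 \<le> a" by (simp add: a_def)
  have r0: "0 \<le> r" using b_nonneg x0 by (simp add: r)
  have rho': "rho = d + D" by (simp add: rho(1) d_def D_def)
  have A: "0 < A" by (simp add: A_def)
  define Z where "Z = radius A x / real n"
  have Z0: "0 \<le> Z" using radius_nonneg[OF A x0] by (simp add: Z_def)
  have Zpen: "Z\<^sup>2 / (19 / 20) + 91 / 100 * D + 40 * (a * r) \<le> pen"
  proof (rule penalty_absorbs[OF nu D0 a0 r0 L0])
    show "(5 / 2 + 2 * L0 * nu) * D + 2 * L0 * a / nu * r + 2 * L0 / nu ^ 3 * r\<^sup>2 \<le> pen"
      using pen by (simp add: D_def a_def)
    show "Z\<^sup>2 \<le> 3 / 2 * D + 48 * (a * r) + 374 * r\<^sup>2" if "nu \<le> 1 / 4"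
    proof -
      have "Z\<^sup>2 \<le> (1 + 1 / 5) * (1 + A) * D + (1 + 1 / (1 / 5)) * (8 * (a * r) + (12 / A + 128 / 9) * r\<^sup>2)"
        unfolding Z_def D_def a_def by (rule radius_power2_le[OF A _ x r]) simp
      also have "\<dots> = 3 / 2 * D + 48 * (a * r) + 1120 / 3 * r\<^sup>2"
        using that by (simp add: A_def algebra_simps)
      finally show ?thesis using zero_le_power2[of r] by linarith
    qed
    show "Z\<^sup>2 \<le> 15 * D + 12 * (a * r) + 26 * r\<^sup>2" if "1 / 4 < nu"
    proof -
      have "Z\<^sup>2 \<le> (1 + 2) * (1 + A) * D + (1 + 1 / 2) * (8 * (a * r) + (12 / A + 128 / 9) * r\<^sup>2)"
        unfolding Z_def D_def a_def by (rule radius_power2_le[OF A _ x r]) simp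
      also have "\<dots> = 15 * D + 12 * (a * r) + 155 / 6 * r\<^sup>2"
        using that by (simp add: A_def algebra_simps)
      finally show ?thesis using zero_le_power2[of r] by linarith
    qed
  qed
  obtain E1 where E1: "E1 \<in> events" "prob E1 \<le> exp (- x)"
    and E1': "\<And>\<omega> t. \<omega> \<in> space \<Omega> - E1 \<Longrightarrow> t \<in> S \<Longrightarrow>
      \<bar>\<Sum>i=1..n. t (X i \<omega>) - dens_mean \<mu> s t\<bar> \<le> radius A x * l2_norm \<mu> t"
    using uniform_tail[OF A x0] by blast
  define v where "v = 4 * (b * a) * rho + 2 * F * rho"
  define f where "f = (\<lambda>x. p x - q x)"
  have fl: "f \<in> l2_space \<mu>" unfolding f_def by (rule l2_space_diff[OF S_l2[OF pS] q])
  have v1: "dens_mean \<mu> s (\<lambda>x. (f x)\<^sup>2) \<le> v"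
    unfolding f_def v_def a_def
    by (rule proj_diff_second_moment[OF p q F _ rho(3)]) (use rho' D0 in \<open>simp_all add: d_def\<close>)
  have v2: "0 < v" if "F \<noteq> 0"
    using that F(2) b_nonneg a0 rho(2) unfolding v_def by (intro add_nonneg_pos) auto
  have "\<exists>E\<in>events. prob E \<le> 2 * exp (- y) \<and> (\<forall>\<omega>\<in>space \<Omega> - E.
      real n * \<bar>emp_process \<omega> f\<bar> \<le> sqrt (2 * (real n * v) * y) + F * y / 3)"
    by (rule bernstein_two_sided[OF l2_spaceD[OF fl] _ F(2) v1 v2 y(1)]) (simp_all add: f_def F(1))
  then obtain E2 where E2: "E2 \<in> events" "prob E2 \<le> 2 * exp (- y)"
    and E2': "\<And>\<omega>. \<omega> \<in> space \<Omega> - E2 \<Longrightarrow>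
      real n * \<bar>emp_process \<omega> f\<bar> \<le> sqrt (2 * (real n * v) * y) + F * y / 3"
    by blast
  show ?thesis
  proof (intro bexI[of _ "E1 \<union> E2"] conjI ballI)
    show "E1 \<union> E2 \<in> events" using E1 E2 by auto
    show "prob (E1 \<union> E2) \<le> exp (- x) + 2 * exp (- y)"
      using measure_Un_le[OF E1(1) E2(1)] E1(2) E2(2) by linarith
    fix \<omega> t assume \<omega>: "\<omega> \<in> space \<Omega> - (E1 \<union> E2)" and t: "t \<in> S"
    define g where "g = (\<lambda>x. t x - p x)"
    have gS: "g \<in> S" unfolding g_def by (rule l2_subspace_diff[OF subspace t pS])
    have "\<bar>emp_process \<omega> g\<bar> = \<bar>\<Sum>i=1..n. g (X i \<omega>) - dens_mean \<mu> s g\<bar> / real n"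
      unfolding emp_process_sum by (simp add: abs_divide)
    also have "\<dots> \<le> radius A x * l2_norm \<mu> g / real n"
      using E1'[OF _ gS] \<omega> np by (intro divide_right_mono) auto
    finally have g: "\<bar>emp_process \<omega> g\<bar> \<le> l2_norm \<mu> g * Z" by (simp add: Z_def mult.commute)
    have g': "2 * \<bar>emp_process \<omega> g\<bar> \<le> 19 / 20 * (l2_norm \<mu> g)\<^sup>2 + Z\<^sup>2 / (19 / 20)"
      using g two_mult_le_weighted[of "19 / 20" "l2_norm \<mu> g" Z] by linarith
    have f: "2 * \<bar>emp_process \<omega> f\<bar> \<le> 91 / 100 * rho + 40 * (a * r)"
      by (rule bernstein_absorbs[OF e np a0 b_nonneg F(2) _ y Fy r v_def E2']) (use \<omega> rho in auto)
    have "emp_process \<omega> t - emp_process \<omega> q = emp_process \<omega> g + emp_process \<omega> f"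
      unfolding g_def f_def using S_l2[OF t] S_l2[OF pS] q by (simp add: emp_process_diff)
    then have "2 * \<bar>emp_process \<omega> t - emp_process \<omega> q\<bar> \<le> 2 * \<bar>emp_process \<omega> g\<bar> + 2 * \<bar>emp_process \<omega> f\<bar>"
      using abs_triangle_ineq[of "emp_process \<omega> g" "emp_process \<omega> f"] by simp
    \<comment> \<open>As \<open>rho\<close> is \<open>d + D\<close>, the share 91 / 100 of
      \<open>d\<close> fits below 19 / 20 of \<open>d\<close>, and the share of \<open>D\<close> is
      paid by the penalty through \<open>Zpen\<close>.\<close>
    also have "\<dots> \<le> 19 / 20 * ((l2_norm \<mu> g)\<^sup>2 + d) + pen"
      using g' f Zpen d0 unfolding rho' distrib_left by linarith
    also have "(l2_norm \<mu> g)\<^sup>2 + d = (l2_norm \<mu> (\<lambda>x. t x - s x))\<^sup>2"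
      unfolding g_def d_def by (rule l2_orth_proj_pythagoras[OF subspace s_l2 p t, symmetric])
    finally show "2 * \<bar>emp_process \<omega> t - emp_process \<omega> q\<bar>
      \<le> 19 / 20 * (l2_norm \<mu> (\<lambda>x. t x - s x))\<^sup>2 + pen" .
  qed
qed

end

section \<open>Union bound over the models and numerical constants\<close>

lemma (in prob_space) pmf_union_bound:
  fixes \<pi> :: "'m pmf"
  assumes "\<And>m. m \<in> set_pmf \<pi> \<Longrightarrow> \<exists>E\<in>events. prob E \<le> pmf \<pi> m * \<delta> \<and> (\<forall>\<omega>\<in>space M - E. Q m \<omega>)"
    and \<delta>: "0 \<le> \<delta>"
  shows "\<exists>A\<in>events. 1 - \<delta> \<le> prob A \<and> A \<subseteq> space M \<and> (\<forall>\<omega>\<in>A. \<forall>m\<in>set_pmf \<pi>. Q m \<omega>)"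
proof -
  obtain E where E [measurable]: "\<And>m. m \<in> set_pmf \<pi> \<Longrightarrow> E m \<in> events"
    and pE: "\<And>m. m \<in> set_pmf \<pi> \<Longrightarrow> prob (E m) \<le> pmf \<pi> m * \<delta>"
    and Q: "\<And>m \<omega>. m \<in> set_pmf \<pi> \<Longrightarrow> \<omega> \<in> space M - E m \<Longrightarrow> Q m \<omega>"
    using assms(1) by metis
  let ?U = "\<Union>m\<in>set_pmf \<pi>. E m"
  have U: "?U \<in> events" using E by (intro sets.countable_UN'') auto
  have "emeasure M ?U = (\<integral>\<^sup>+\<omega>. indicator ?U \<omega> \<partial>M)" using U by simp
  \<comment> \<open>The indicator of the union is dominated by an integral over counting measure on
    the countable support. Exchanging the integrals leaves the individual probabilities, whose
    weights sum to one.\<close>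
  also have "\<dots> \<le> (\<integral>\<^sup>+\<omega>. (\<integral>\<^sup>+m. indicator (E m) \<omega> \<partial>count_space (set_pmf \<pi>)) \<partial>M)"
  proof (rule nn_integral_mono)
    fix \<omega>
    show "(indicator ?U \<omega> :: ennreal) \<le> (\<integral>\<^sup>+m. indicator (E m) \<omega> \<partial>count_space (set_pmf \<pi>))"
    proof (cases "\<omega> \<in> ?U")
      case True
      then obtain m where m: "m \<in> set_pmf \<pi>" "\<omega> \<in> E m" by blast
      have "(1::ennreal) = (\<integral>\<^sup>+k. indicator {m} k \<partial>count_space (set_pmf \<pi>))"
        using m(1) by simp
      also have "\<dots> \<le> (\<integral>\<^sup>+k. indicator (E k) \<omega> \<partial>count_space (set_pmf \<pi>))"
        using m(2) by (intro nn_integral_mono) (auto simp: indicator_def)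
      finally show ?thesis using True by simp
    qed simp
  qed
  also have "\<dots> = (\<integral>\<^sup>+m. (\<integral>\<^sup>+\<omega>. indicator (E m) \<omega> \<partial>M) \<partial>count_space (set_pmf \<pi>))"
    by (rule nn_integral_count_space_nn_integral) auto
  also have "\<dots> \<le> (\<integral>\<^sup>+m. ennreal (pmf \<pi> m) * ennreal \<delta> \<partial>count_space (set_pmf \<pi>))"
    using pE \<delta> E by (intro nn_integral_mono) (simp add: emeasure_eq_measure ennreal_leI flip: ennreal_mult)
  also have "\<dots> = (\<integral>\<^sup>+m. ennreal (pmf \<pi> m) \<partial>count_space (set_pmf \<pi>)) * ennreal \<delta>"
    by (rule nn_integral_multc) simp
  also have "(\<integral>\<^sup>+m. ennreal (pmf \<pi> m) \<partial>count_space (set_pmf \<pi>)) = 1"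
    by (simp add: nn_integral_pmf emeasure_pmf)
  finally have "prob ?U \<le> \<delta>" using \<delta> by (simp add: emeasure_eq_measure)
  then have "1 - \<delta> \<le> prob (space M - ?U)" using prob_compl[OF U] by simp
  then show ?thesis using U Q by (intro bexI[of _ "space M - ?U"]) auto
qed

text \<open>\<open>k * \<alpha> / (k + \<alpha>)\<close> is the minimum of the quadratic form under
  \<open>u + w = 1\<close>, and the weight \<open>k / \<alpha>\<close> for the squared sum is the
  one that reaches it.\<close>

lemma weighted_power2_sum_ge:
  fixes k \<alpha> u w z :: real
  assumes "0 < k" "0 < \<alpha>" "0 \<le> z" "z \<le> u + w"
  shows "k * \<alpha> / (k + \<alpha>) * z\<^sup>2 \<le> k * u\<^sup>2 + \<alpha> * w\<^sup>2"
proof -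
  have "k * \<alpha> / (k + \<alpha>) * z\<^sup>2 \<le> k * \<alpha> / (k + \<alpha>) * (u + w)\<^sup>2"
    using assms by (intro mult_left_mono power_mono) auto
  also have "\<dots> \<le> k * \<alpha> / (k + \<alpha>) * ((1 + k / \<alpha>) * u\<^sup>2 + (1 + 1 / (k / \<alpha>)) * w\<^sup>2)"
    using assms by (intro mult_left_mono power2_sum_le_weighted) auto
  also have "\<dots> = k * u\<^sup>2 + \<alpha> * w\<^sup>2"
  proof -
    have "1 + k / \<alpha> = (k + \<alpha>) / \<alpha>" "1 + 1 / (k / \<alpha>) = (k + \<alpha>) / k" "k + \<alpha> \<noteq> 0"
      using assms by (simp_all add: field_simps)
    then have "k * \<alpha> / (k + \<alpha>) * (1 + k / \<alpha>) = k" "k * \<alpha> / (k + \<alpha>) * (1 + 1 / (k / \<alpha>)) = \<alpha>"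
      using assms by simp_all
    then show ?thesis by (metis distrib_left mult.assoc)
  qed
  finally show ?thesis .
qed

text \<open>The comparison of criteria yields the right-hand side divided by
  \<open>39 / 10 + \<alpha>\<close>. The 1000 in \<open>const_floor\<close> splits into 20, which
  matches 1 / 20, and 50, which leaves room for an elementary quadratic inequality.\<close>

lemma const_floor_le:
  assumes "0 < \<alpha>"
  shows "(39 / 10 + \<alpha>) * const_floor \<alpha> \<le> (1 / 20) * \<alpha> / (1 / 20 + \<alpha>)"
proof -
  have "(39 / 10 + \<alpha>) * (1 / 20 + \<alpha>) \<le> 50 * (1 + \<alpha>)\<^sup>2"
  proof -
    have "50 * (1 + \<alpha>)\<^sup>2 - (39 / 10 + \<alpha>) * (1 / 20 + \<alpha>) = 49 * \<alpha>\<^sup>2 + 1921 / 20 * \<alpha> + 9961 / 200"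
      by (simp add: power2_eq_square field_simps)
    then show ?thesis using assms zero_le_power2[of \<alpha>] by linarith
  qed
  then have "(39 / 10 + \<alpha>) * (1 / 20 + \<alpha>) * \<alpha> \<le> 50 * (1 + \<alpha>)\<^sup>2 * \<alpha>"
    using assms by (intro mult_right_mono) auto
  then have "(39 / 10 + \<alpha>) * \<alpha> * (1 / 20 + \<alpha>) \<le> (1 / 20) * \<alpha> * (1000 * (1 + \<alpha>)\<^sup>2)"
    by (simp add: mult_ac)
  then have "(39 / 10 + \<alpha>) * \<alpha> / (1000 * (1 + \<alpha>)\<^sup>2) \<le> (1 / 20) * \<alpha> / (1 / 20 + \<alpha>)"
    using assms by (subst frac_le_eq) (auto simp: divide_le_0_iff)
  then show ?thesis by (simp add: const_floor_def)
qed

section \<open>The oracle inequality\<close>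

text \<open>Completing the square: the mean of \<open>t\<close> is its inner product with
  \<open>s\<close>, so the contrast is a squared distance up to a constant and the centred
  process.\<close>

lemma (in iid_density_sample) pen_cost_eq:
  assumes "t \<in> l2_space \<mu>"
  shows "pen_cost \<mu> X n \<alpha> \<omega> t h c = (l2_norm \<mu> (\<lambda>x. t x - s x))\<^sup>2 - (l2_norm \<mu> s)\<^sup>2
    - 2 * emp_process \<omega> t + \<alpha> * (l2_norm \<mu> (\<lambda>x. t x - h x))\<^sup>2 + c"
  unfolding l2_norm_power2_diff[OF assms s_l2]
  by (simp add: pen_cost_def emp_process_def dens_mean_inner)

lemma (in iid_density_sample) norm_s_pos: "0 < l2_norm \<mu> s"
proof (rule ccontr)
  assume "\<not> 0 < l2_norm \<mu> s"
  then have "l2_norm \<mu> s = 0" using l2_norm_nonneg[of \<mu> s] by linarith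
  then have "(LINT x|\<mu>. (s x)\<^sup>2) = 0" by (simp flip: l2_norm_power2)
  then have "AE x in \<mu>. (s x)\<^sup>2 = 0"
    using integral_nonneg_eq_0_iff_AE[OF l2_space_integrable_power2[OF s_l2]] by simp
  then have "AE x in \<mu>. ennreal (s x) = 0" by eventually_elim simp
  then have "emeasure law (space \<mu>) = 0"
    unfolding law_def by (subst emeasure_density) (auto simp: nn_integral_0_iff_AE)
  then show False using L.emeasure_space_1 by simp
qed

text \<open>If both terms vanished, \<open>p\<close> would be zero almost surely under the law,
  hence orthogonal to \<open>s\<close>, yet at distance zero from \<open>s\<close>, which would give
  \<open>s\<close> norm zero. Positivity ensures that the deviation hypothesis on the models never
  divides by zero.\<close>

lemma (in model_sample) risk_pos:
  assumes p: "is_orth_proj \<mu> S s p"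
  shows "0 < (l2_norm \<mu> (\<lambda>x. s x - p x))\<^sup>2 + dens_mean \<mu> s (Psi \<mu> S) / real n"
proof (rule ccontr)
  assume neg: "\<not> ?thesis"
  have np: "0 < real n" using n_pos by simp
  have pS: "p \<in> S" using p by (simp add: is_orth_proj_def)
  have D0: "0 \<le> dens_mean \<mu> s (Psi \<mu> S)"
    unfolding integral_law[OF Psi_measurable, symmetric]
    by (intro integral_nonneg_AE) (use Psi_nonneg in auto)
  then have "0 \<le> dens_mean \<mu> s (Psi \<mu> S) / real n" using np by simp
  then have "dens_mean \<mu> s (Psi \<mu> S) / real n = 0" "(l2_norm \<mu> (\<lambda>x. s x - p x))\<^sup>2 = 0"
    using neg zero_le_power2[of "l2_norm \<mu> (\<lambda>x. s x - p x)"] by linarith+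
  then have D: "dens_mean \<mu> s (Psi \<mu> S) = 0" and sp: "l2_norm \<mu> (\<lambda>x. s x - p x) = 0" using np by auto
  let ?N = "l2_norm \<mu> p"
  have i: "integrable law (\<lambda>x. ?N\<^sup>2 * Psi \<mu> S x)"
    by (intro integrable_mult_right integrable_law[where C = "b\<^sup>2"]) (use Psi_nonneg Psi_le in auto)
  have pt: "(p x)\<^sup>2 \<le> ?N\<^sup>2 * Psi \<mu> S x" if x: "x \<in> space \<mu>" for x
  proof (cases "?N = 0")
    case True
    then show ?thesis using zero_of_norm_zero[OF pS _ x] by simp
  next
    case False
    have "(1 / ?N * p x)\<^sup>2 \<le> Psi \<mu> S x"
      unfolding Psi_def
    proof (rule cSUP_upper2[OF Psi_bdd[OF x]])
      show "(\<lambda>x. 1 / ?N * p x) \<in> {t \<in> S. l2_norm \<mu> t \<le> 1}"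
        using l2_subspace_cmult[OF subspace pS, of "1 / ?N"] l2_norm_cmult[of \<mu> "1 / ?N" p] by auto
    qed simp
    then have "?N\<^sup>2 * (1 / ?N * p x)\<^sup>2 \<le> ?N\<^sup>2 * Psi \<mu> S x" by (intro mult_left_mono) auto
    then show ?thesis using False by (simp add: power_divide)
  qed
  have "(LINT x|law. (p x)\<^sup>2) \<le> (LINT x|law. ?N\<^sup>2 * Psi \<mu> S x)"
    by (rule integral_mono_AE[OF integrable_law_power2[OF pS] i]) (use pt in auto)
  also have "\<dots> = 0" using D by (simp add: integral_law)
  finally have "(dens_mean \<mu> s p)\<^sup>2 \<le> 0" using mean_power2_le(1)[OF pS] by linarith
  then have "l2_inner \<mu> p s = 0" by (simp add: dens_mean_inner)
  then have "(l2_norm \<mu> s)\<^sup>2 = l2_inner \<mu> (\<lambda>x. s x - p x) s"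
    by (simp add: l2_inner_diff_left s_l2 S_l2[OF pS] l2_norm_power2_inner)
  also have "\<dots> \<le> 0"
    using l2_cauchy_schwarz[OF l2_space_diff[OF s_l2 S_l2[OF pS]] s_l2] sp by simp
  finally show False using norm_s_pos by simp
qed

text \<open>Deterministic at fixed \<open>\<omega>\<close>. The number \<open>c\<close> shifts all
  criteria alike and cancels. For the selected index the penalty pays for the fluctuation and leaves
  1 / 20 of the squared distance; for a competitor the fluctuation costs a second penalty.\<close>

lemma (in iid_density_sample) oracle_inequality:
  assumes S: "\<And>m. m \<in> \<M> \<Longrightarrow> S m \<subseteq> l2_space \<mu>"
    and q: "\<And>m t. m \<in> \<M> \<Longrightarrow> t \<in> S m \<Longrightarrow> 2 * \<bar>emp_process \<omega> t - c\<bar>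
      \<le> 19 / 20 * (l2_norm \<mu> (\<lambda>x. t x - s x))\<^sup>2 + pen m"
    and \<alpha>: "0 < \<alpha>"
    and est: "\<And>\<theta>. \<theta> \<in> \<Theta> \<Longrightarrow> shat \<theta> \<omega> \<in> l2_space \<mu> \<and> Mod \<theta> \<omega> \<subseteq> \<M> \<and> Mod \<theta> \<omega> \<noteq> {} \<and>
         (\<forall>m\<in>Mod \<theta> \<omega>. sbr \<theta> m \<omega> \<in> S m) \<and>
         bdd_below ((\<lambda>m. pen_cost \<mu> X n \<alpha> \<omega> (sbr \<theta> m \<omega>) (shat \<theta> \<omega>) (pen m)) ` Mod \<theta> \<omega>)"
    and pen: "\<And>m. m \<in> \<M> \<Longrightarrow> 0 \<le> pen m"
    and sel: "is_arg_min (crit \<mu> X n \<alpha> pen Mod shat sbr \<omega>) (\<lambda>\<theta>. \<theta> \<in> \<Theta>) \<theta>'"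
    and \<theta>: "\<theta> \<in> \<Theta>"
  shows "const_floor \<alpha> * (l2_norm \<mu> (\<lambda>x. shat \<theta>' \<omega> x - s x))\<^sup>2
    \<le> (l2_norm \<mu> (\<lambda>x. shat \<theta> \<omega> x - s x))\<^sup>2
      + (INF m\<in>Mod \<theta> \<omega>. (l2_norm \<mu> (\<lambda>x. sbr \<theta> m \<omega> x - shat \<theta> \<omega> x))\<^sup>2 + 2 * pen m)"
proof -
  define K where "K = - (l2_norm \<mu> s)\<^sup>2 - 2 * c"
  define k where "k = (1 / 20) * \<alpha> / (1 / 20 + \<alpha>)"
  let ?crit = "crit \<mu> X n \<alpha> pen Mod shat sbr \<omega>"
  let ?h = "shat \<theta>' \<omega>" and ?g = "shat \<theta> \<omega>"
  have \<theta>': "\<theta>' \<in> \<Theta>" and "?crit \<theta>' \<le> ?crit \<theta>"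
    using sel \<theta> by (auto simp: is_arg_min_def not_less)
  have lower: "k * (l2_norm \<mu> (\<lambda>x. ?h x - s x))\<^sup>2 + K \<le> ?crit \<theta>'"
    unfolding crit_def
  proof (rule cINF_greatest)
    show "Mod \<theta>' \<omega> \<noteq> {}" using est[OF \<theta>'] by blast
    fix m assume m: "m \<in> Mod \<theta>' \<omega>"
    let ?b = "sbr \<theta>' m \<omega>"
    have mM: "m \<in> \<M>" and b: "?b \<in> S m" using est[OF \<theta>'] m by auto
    have bl: "?b \<in> l2_space \<mu>" and hl: "?h \<in> l2_space \<mu>" using S[OF mM] b est[OF \<theta>'] by auto
    have "l2_norm \<mu> (\<lambda>x. ?h x - s x) = l2_norm \<mu> (\<lambda>x. (?b x - s x) + (?h x - ?b x))" by simp
    also have "\<dots> \<le> l2_norm \<mu> (\<lambda>x. ?b x - s x) + l2_norm \<mu> (\<lambda>x. ?h x - ?b x)"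
      by (rule l2_norm_triangle[OF l2_space_diff[OF bl s_l2] l2_space_diff[OF hl bl]])
    also have "l2_norm \<mu> (\<lambda>x. ?h x - ?b x) = l2_norm \<mu> (\<lambda>x. ?b x - ?h x)" by (rule l2_norm_minus)
    finally have "k * (l2_norm \<mu> (\<lambda>x. ?h x - s x))\<^sup>2
        \<le> 1 / 20 * (l2_norm \<mu> (\<lambda>x. ?b x - s x))\<^sup>2 + \<alpha> * (l2_norm \<mu> (\<lambda>x. ?b x - ?h x))\<^sup>2"
      unfolding k_def by (intro weighted_power2_sum_ge \<alpha>) auto
    then show "k * (l2_norm \<mu> (\<lambda>x. ?h x - s x))\<^sup>2 + K \<le> pen_cost \<mu> X n \<alpha> \<omega> ?b ?h (pen m)"
      using q[OF mM b] abs_ge_self[of "emp_process \<omega> ?b - c"] unfolding pen_cost_eq[OF bl] K_def by argo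
  qed
  \<comment> \<open>The competitor's distance is moved to the left, so that a bound for each
    \<open>m\<close> suffices for the infimum.\<close>
  have "const_floor \<alpha> * (l2_norm \<mu> (\<lambda>x. ?h x - s x))\<^sup>2 - (l2_norm \<mu> (\<lambda>x. ?g x - s x))\<^sup>2
      \<le> (INF m\<in>Mod \<theta> \<omega>. (l2_norm \<mu> (\<lambda>x. sbr \<theta> m \<omega> x - ?g x))\<^sup>2 + 2 * pen m)"
  proof (rule cINF_greatest)
    show "Mod \<theta> \<omega> \<noteq> {}" using est[OF \<theta>] by blast
    fix m assume m: "m \<in> Mod \<theta> \<omega>"
    let ?b = "sbr \<theta> m \<omega>"
    have mM: "m \<in> \<M>" and b: "?b \<in> S m" using est[OF \<theta>] m by auto
    have bl: "?b \<in> l2_space \<mu>" and gl: "?g \<in> l2_space \<mu>" using S[OF mM] b est[OF \<theta>] by auto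
    define u w z where "u = (l2_norm \<mu> (\<lambda>x. ?g x - s x))\<^sup>2" and "w = (l2_norm \<mu> (\<lambda>x. ?b x - ?g x))\<^sup>2"
      and "z = (l2_norm \<mu> (\<lambda>x. ?b x - s x))\<^sup>2"
    have "l2_norm \<mu> (\<lambda>x. ?b x - s x) = l2_norm \<mu> (\<lambda>x. (?b x - ?g x) + (?g x - s x))" by simp
    also have "\<dots> \<le> l2_norm \<mu> (\<lambda>x. ?b x - ?g x) + l2_norm \<mu> (\<lambda>x. ?g x - s x)"
      by (rule l2_norm_triangle[OF l2_space_diff[OF bl gl] l2_space_diff[OF gl s_l2]])
    finally have "z \<le> (l2_norm \<mu> (\<lambda>x. ?b x - ?g x) + l2_norm \<mu> (\<lambda>x. ?g x - s x))\<^sup>2"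
      unfolding z_def by (rule power_mono) simp
    also have "\<dots> \<le> 2 * w + 2 * u" unfolding u_def w_def
      using power2_sum_le_weighted[of 1 "l2_norm \<mu> (\<lambda>x. ?b x - ?g x)" "l2_norm \<mu> (\<lambda>x. ?g x - s x)"] by simp
    finally have z: "z \<le> 2 * w + 2 * u" .
    have "k * (l2_norm \<mu> (\<lambda>x. ?h x - s x))\<^sup>2 + K \<le> ?crit \<theta>" using lower \<open>?crit \<theta>' \<le> ?crit \<theta>\<close> by linarith
    also have "\<dots> \<le> pen_cost \<mu> X n \<alpha> \<omega> ?b ?g (pen m)"
      unfolding crit_def by (rule cINF_lower) (use est[OF \<theta>] m in auto)
    \<comment> \<open>39 / 20 is 1 plus the 19 / 20 lost to the fluctuation; the bound on
      \<open>z\<close> doubles it to 39 / 10.\<close>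
    also have "\<dots> \<le> 39 / 20 * z + \<alpha> * w + 2 * pen m + K"
      using q[OF mM b] abs_ge_minus_self[of "emp_process \<omega> ?b - c"]
      unfolding pen_cost_eq[OF bl] K_def u_def w_def z_def by argo
    also have "\<dots> \<le> (39 / 10 + \<alpha>) * (u + w + 2 * pen m) + K"
    proof -
      have "0 \<le> \<alpha> * u" "0 \<le> \<alpha> * pen m" using \<alpha> pen[OF mM] by (auto simp: u_def)
      moreover have "(39 / 10 + \<alpha>) * (u + w + 2 * pen m)
          = 39 / 10 * u + 39 / 10 * w + 39 / 5 * pen m + \<alpha> * u + \<alpha> * w + 2 * (\<alpha> * pen m)"
        by (simp add: field_simps)
      ultimately show ?thesis using z pen[OF mM] by linarith
    qed
    finally have "k * (l2_norm \<mu> (\<lambda>x. ?h x - s x))\<^sup>2 \<le> (39 / 10 + \<alpha>) * (u + w + 2 * pen m)" by simp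
    moreover have "(39 / 10 + \<alpha>) * (const_floor \<alpha> * (l2_norm \<mu> (\<lambda>x. ?h x - s x))\<^sup>2) \<le> k * (l2_norm \<mu> (\<lambda>x. ?h x - s x))\<^sup>2"
      using mult_right_mono[OF const_floor_le[OF \<alpha>] zero_le_power2[of "l2_norm \<mu> (\<lambda>x. ?h x - s x)"]]
      unfolding k_def by (simp only: mult.assoc)
    ultimately have "(39 / 10 + \<alpha>) * (const_floor \<alpha> * (l2_norm \<mu> (\<lambda>x. ?h x - s x))\<^sup>2)
        \<le> (39 / 10 + \<alpha>) * (u + w + 2 * pen m)" by (rule order_trans[rotated])
    then have "const_floor \<alpha> * (l2_norm \<mu> (\<lambda>x. ?h x - s x))\<^sup>2 \<le> u + w + 2 * pen m"
      by (rule mult_left_le_imp_le) (use \<alpha> in simp)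
    then show "const_floor \<alpha> * (l2_norm \<mu> (\<lambda>x. ?h x - s x))\<^sup>2 - (l2_norm \<mu> (\<lambda>x. ?g x - s x))\<^sup>2
        \<le> (l2_norm \<mu> (\<lambda>x. ?b x - ?g x))\<^sup>2 + 2 * pen m"
      by (simp add: u_def w_def)
  qed
  then show ?thesis by linarith
qed

text \<open>Each model receives the share \<open>pmf \<pi> m * \<delta>\<close> of the failure
  probability, and the shares sum to \<open>\<delta>\<close>.\<close>

lemma (in iid_density_sample) uniform_event:
  fixes \<M> :: "'m set" and \<pi> :: "'m pmf" and sm :: "'m \<Rightarrow> 'x \<Rightarrow> real"
  assumes e: "4 * sqrt e + e / 3 \<le> 1 / 2"
    and model: "\<And>m. m \<in> \<M> \<Longrightarrow> l2_subspace \<mu> (S m) \<and> l2_separable \<mu> (S m) \<and> Psi_bounded \<mu> (S m)"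
    and sm: "\<And>m. m \<in> \<M> \<Longrightarrow> is_orth_proj \<mu> (S m) s (sm m)"
    and \<pi>: "set_pmf \<pi> = \<M>" and \<delta>o: "0 < \<delta>o"
    and mo: "is_arg_min (\<lambda>m. risk \<mu> s n (S m) (sm m)) (\<lambda>m. m \<in> \<M>) mo"
    and dev: "\<And>m. m \<in> \<M> \<Longrightarrow> sup_norm \<mu> (\<lambda>x. sm m x - sm mo x) * ln (4 / (pmf \<pi> m * \<delta>o))
      / risk \<mu> s n (S m) (sm m) \<le> e"
    and \<delta>: "\<delta>o \<le> \<delta>" "\<delta> < 1" and nu: "0 < nu" "nu < 1" and L0: "L0 = 16 / ln 2 + 8"
    and pen: "\<And>m. m \<in> \<M> \<Longrightarrow> (5 / 2 + 2 * L0 * nu) * dens_mean \<mu> s (Psi \<mu> (S m)) / real n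
           + 2 * L0 * l2_norm \<mu> s / nu * r_term \<mu> n (S m) (pmf \<pi> m) \<delta>
           + 2 * L0 / nu ^ 3 * (r_term \<mu> n (S m) (pmf \<pi> m) \<delta>)\<^sup>2 \<le> pen m"
  shows "\<exists>A\<in>events. 1 - \<delta> \<le> prob A \<and> A \<subseteq> space \<Omega> \<and> (\<forall>\<omega>\<in>A. \<forall>m\<in>set_pmf \<pi>. \<forall>t\<in>S m.
    2 * \<bar>emp_process \<omega> t - emp_process \<omega> (sm mo)\<bar> \<le> 19 / 20 * (l2_norm \<mu> (\<lambda>x. t x - s x))\<^sup>2 + pen m)"
proof (rule pmf_union_bound)
  have np: "0 < real n" using n_pos by simp
  show "0 \<le> \<delta>" using \<delta>o \<delta> by simp
  have moM: "mo \<in> \<M>" and mo_le: "\<And>m. m \<in> \<M> \<Longrightarrow> risk \<mu> s n (S mo) (sm mo) \<le> risk \<mu> s n (S m) (sm m)"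
    using mo by (auto simp: is_arg_min_def not_less)
  define bm where "bm = (\<lambda>m. sqrt (sup_norm \<mu> (Psi \<mu> (S m))))"
  obtain x0 where x0: "x0 \<in> space \<mu>" using L.not_empty by auto
  have ms: "model_sample \<Omega> \<mu> s X n (S m) (bm m)" if "m \<in> \<M>" for m
    unfolding model_sample_def bm_def
    using model[OF that] x0 by (auto intro!: eval_bounded_model_Psi iid_density_sample_axioms)
  have smS: "sm m \<in> S m" if "m \<in> \<M>" for m using sm[OF that] by (simp add: is_orth_proj_def)
  have smb: "\<bar>sm m x\<bar> \<le> bm m * l2_norm \<mu> (sm m)" if "m \<in> \<M>" "x \<in> space \<mu>" for m x
    using eval_bounded_model.eval_bound[OF model_sample.axioms(2)[OF ms[OF that(1)]] smS[OF that(1)] that(2)] .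
  have sml: "sm m \<in> l2_space \<mu>" if "m \<in> \<M>" for m
    using model[OF that] smS[OF that] by (auto simp: l2_subspace_def)
  fix m assume "m \<in> set_pmf \<pi>"
  then have m: "m \<in> \<M>" using \<pi> by simp
  interpret model_sample \<Omega> \<mu> s X n "S m" "bm m" by (rule ms[OF m])
  define F where "F = sup_norm \<mu> (\<lambda>x. sm m x - sm mo x)"
  have F: "\<bar>sm m x - sm mo x\<bar> \<le> F" if "x \<in> space \<mu>" for x
    unfolding F_def
  proof (rule sup_norm_ge[OF _ that])
    fix y assume "y \<in> space \<mu>"
    from smb[OF m this] smb[OF moM this]
    show "\<bar>sm m y - sm mo y\<bar> \<le> bm m * l2_norm \<mu> (sm m) + bm mo * l2_norm \<mu> (sm mo)" by linarith
  qed
  have F0: "0 \<le> F" using F[OF x0] by linarith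
  define rho where "rho = (l2_norm \<mu> (\<lambda>x. s x - sm m x))\<^sup>2 + dens_mean \<mu> s (Psi \<mu> (S m)) / real n"
  have rho: "0 < rho" unfolding rho_def by (rule risk_pos[OF sm[OF m]])
  have risk: "risk \<mu> s n (S m) (sm m) = real n * rho" using np by (simp add: risk_def rho_def distrib_left)
  \<comment> \<open>Minimality of \<open>mo\<close> compares its bias with the risk of the current
    model.\<close>
  have "real n * (l2_norm \<mu> (\<lambda>x. s x - sm mo x))\<^sup>2 \<le> risk \<mu> s n (S mo) (sm mo)"
  proof -
    interpret o: model_sample \<Omega> \<mu> s X n "S mo" "bm mo" by (rule ms[OF moM])
    have "0 \<le> dens_mean \<mu> s (Psi \<mu> (S mo))"
      unfolding integral_law[OF o.Psi_measurable, symmetric]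
      by (intro integral_nonneg_AE) (use o.Psi_nonneg in auto)
    then show ?thesis by (simp add: risk_def)
  qed
  then have "real n * (l2_norm \<mu> (\<lambda>x. s x - sm mo x))\<^sup>2 \<le> real n * rho" using mo_le[OF m] risk by linarith
  then have rho_o: "(l2_norm \<mu> (\<lambda>x. s x - sm mo x))\<^sup>2 \<le> rho" using np by simp
  define w where "w = pmf \<pi> m"
  have w: "0 < w" "w \<le> 1" using m \<pi> by (auto simp: w_def pmf_positive_iff pmf_le_1)
  have \<delta>0: "0 < \<delta>" using \<delta>o \<delta> by linarith
  have wd: "0 < w * \<delta>" "w * \<delta> \<le> 1" using w \<delta>0 \<delta> by (auto intro: mult_le_one)
  \<comment> \<open>At these two levels the uniform bound uses half of the model's share, and each
    side of Bernstein's inequality a quarter.\<close>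
  define x where "x = ln (2 / (w * \<delta>))"
  define y where "y = ln (4 / (w * \<delta>))"
  have yx: "y = ln 2 + x"
  proof -
    have "4 / (w * \<delta>) = 2 * (2 / (w * \<delta>))" by simp
    then show ?thesis unfolding y_def x_def using wd by (metis ln_mult_pos zero_less_divide_iff zero_less_numeral)
  qed
  \<comment> \<open>The argument of the logarithm is at least 2, which supplies the
    \<open>2 / 3 \<le> x\<close> used for the radius.\<close>
  have xl: "ln 2 \<le> x"
  proof -
    have "2 \<le> 2 / (w * \<delta>)" using wd by (simp add: pos_le_divide_eq)
    then show ?thesis unfolding x_def by (intro ln_mono) auto
  qed
  have x: "2 / 3 \<le> x" using xl ln2_ge_two_thirds by linarith
  have y: "0 < y" "y \<le> 2 * x" using yx xl x by (auto simp: add_pos_pos)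
  have ex: "exp (- x) = w * \<delta> / 2" "exp (- y) = w * \<delta> / 4"
    using wd by (auto simp: x_def y_def exp_minus)
  \<comment> \<open>The deviation hypothesis is stated at \<open>\<delta>o\<close>, whose logarithm
    dominates the one at \<open>\<delta>\<close>.\<close>
  have yo: "y \<le> ln (4 / (w * \<delta>o))"
    unfolding y_def using w \<delta>o \<delta> by (intro ln_mono divide_left_mono mult_left_mono) auto
  have "F * ln (4 / (w * \<delta>o)) \<le> e * (real n * rho)"
    using dev[OF m] rho np by (simp add: risk F_def w_def pos_divide_le_eq)
  then have Fy: "F * y \<le> e * (real n * rho)" using mult_left_mono[OF yo F0] by linarith
  \<comment> \<open>Nonnegativity of \<open>e\<close> follows from the deviation bound, whose
    left-hand side is nonnegative.\<close>
  have e0: "0 \<le> e"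
  proof -
    have "0 \<le> e * (real n * rho)" using Fy mult_nonneg_nonneg[OF F0, of y] y by linarith
    moreover have "0 < real n * rho" using rho np by simp
    ultimately show ?thesis by (simp only: zero_le_mult_iff) linarith
  qed
  have r: "r_term \<mu> n (S m) (pmf \<pi> m) \<delta> = bm m * x / real n"
    by (simp add: r_term_def bm_def x_def w_def)
  obtain E where E: "E \<in> events" "prob E \<le> exp (- x) + 2 * exp (- y)"
    "\<forall>\<omega>\<in>space \<Omega> - E. \<forall>t\<in>S m. 2 * \<bar>emp_process \<omega> t - emp_process \<omega> (sm mo)\<bar>
      \<le> 19 / 20 * (l2_norm \<mu> (\<lambda>x. t x - s x))\<^sup>2 + pen m"
    using model_event[OF sm[OF m] sml[OF moM] F F0 rho_def rho rho_o e0 e x y Fy nu L0 r, of "pen m"] pen[OF m]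
    by auto
  have "exp (- x) + 2 * exp (- y) = pmf \<pi> m * \<delta>" by (simp add: ex w_def)
  then show "\<exists>E\<in>events. prob E \<le> pmf \<pi> m * \<delta> \<and> (\<forall>\<omega>\<in>space \<Omega> - E. \<forall>t\<in>S m.
      2 * \<bar>emp_process \<omega> t - emp_process \<omega> (sm mo)\<bar> \<le> 19 / 20 * (l2_norm \<mu> (\<lambda>x. t x - s x))\<^sup>2 + pen m)"
    using E by auto
qed

text \<open>An event \<open>A\<close> inside the set of good points is exhibited, because for
  arbitrary estimators and index set that set itself may fail to be measurable.\<close>

theorem theorem7:
  shows "\<exists>(L0::real) (L::real \<Rightarrow> real).
    L0 \<le> 16 / ln 2 + 8 \<and>
    (\<forall>\<alpha>>0. 0 < L \<alpha> \<and> const_floor \<alpha> \<le> L \<alpha>) \<and>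
    (\<forall>(\<Omega>::'w measure) (\<mu>::'x measure) (s::'x \<Rightarrow> real)
       (\<epsilon>::nat \<Rightarrow> real) (no::nat) (n::nat) (X::nat \<Rightarrow> 'w \<Rightarrow> 'x)
       (\<M>::'m set) (S::'m \<Rightarrow> ('x \<Rightarrow> real) set) (sm::'m \<Rightarrow> 'x \<Rightarrow> real)
       (\<pi>::'m pmf) (\<delta>o::real) (mo::'m) (\<delta>::real) (\<nu>::real) (pen::'m \<Rightarrow> real) (\<alpha>::real)
       (\<Theta>::'t set) (Mod::'t \<Rightarrow> 'w \<Rightarrow> 'm set)
       (shat::'t \<Rightarrow> 'w \<Rightarrow> 'x \<Rightarrow> real) (sbr::'t \<Rightarrow> 'm \<Rightarrow> 'w \<Rightarrow> 'x \<Rightarrow> real)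
       (\<theta>hat::'w \<Rightarrow> 't).
      prob_space \<Omega> \<longrightarrow>
      \<epsilon> \<longlonglongrightarrow> 0 \<longrightarrow>
      (\<forall>k\<ge>no. 4 * sqrt (\<epsilon> k) + \<epsilon> k / 3 \<le> 1 / 2) \<longrightarrow>
      n \<ge> no \<longrightarrow> n \<ge> 1 \<longrightarrow>
      prob_space.indep_vars \<Omega> (\<lambda>_. \<mu>) X {1..n} \<longrightarrow>
      (\<forall>i\<in>{1..n}. distributed \<Omega> \<mu> (X i) (\<lambda>x. ennreal (s x))) \<longrightarrow>
      (AE x in \<mu>. 0 \<le> s x) \<longrightarrow>
      s \<in> l2_space \<mu> \<longrightarrow>
      (\<forall>m\<in>\<M>. l2_subspace \<mu> (S m) \<and> l2_separable \<mu> (S m) \<and> Psi_bounded \<mu> (S m)) \<longrightarrow>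
      (\<forall>m\<in>\<M>. is_orth_proj \<mu> (S m) s (sm m)) \<longrightarrow>
      set_pmf \<pi> = \<M> \<longrightarrow>
      0 < \<delta>o \<longrightarrow> \<delta>o < 1 \<longrightarrow>
      is_arg_min (\<lambda>m. risk \<mu> s n (S m) (sm m)) (\<lambda>m. m \<in> \<M>) mo \<longrightarrow>
      (\<forall>m\<in>\<M>. sup_norm \<mu> (\<lambda>x. sm m x - sm mo x) * ln (4 / (pmf \<pi> m * \<delta>o))
                / risk \<mu> s n (S m) (sm m) \<le> \<epsilon> n) \<longrightarrow>
      \<delta>o \<le> \<delta> \<longrightarrow> \<delta> < 1 \<longrightarrow>
      0 < \<nu> \<longrightarrow> \<nu> < 1 \<longrightarrow>
      (\<forall>m\<in>\<M>. 0 \<le> pen m \<and>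
         pen m \<ge> (5 / 2 + 2 * L0 * \<nu>) * dens_mean \<mu> s (Psi \<mu> (S m)) / real n
           + 2 * L0 * l2_norm \<mu> s / \<nu> * r_term \<mu> n (S m) (pmf \<pi> m) \<delta>
           + 2 * L0 / \<nu> ^ 3 * (r_term \<mu> n (S m) (pmf \<pi> m) \<delta>)\<^sup>2) \<longrightarrow>
      0 < \<alpha> \<longrightarrow>
      (\<forall>\<omega>\<in>space \<Omega>. \<forall>\<theta>\<in>\<Theta>.
         shat \<theta> \<omega> \<in> l2_space \<mu> \<and> Mod \<theta> \<omega> \<subseteq> \<M> \<and> Mod \<theta> \<omega> \<noteq> {} \<and>
         (\<forall>m\<in>Mod \<theta> \<omega>. sbr \<theta> m \<omega> \<in> S m) \<and>
         bdd_below ((\<lambda>m. pen_cost \<mu> X n \<alpha> \<omega> (sbr \<theta> m \<omega>) (shat \<theta> \<omega>) (pen m)) ` Mod \<theta> \<omega>)) \<longrightarrow>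
      (\<forall>\<omega>\<in>space \<Omega>. is_arg_min (crit \<mu> X n \<alpha> pen Mod shat sbr \<omega>) (\<lambda>\<theta>. \<theta> \<in> \<Theta>) (\<theta>hat \<omega>)) \<longrightarrow>
      (\<exists>A\<in>sets \<Omega>. measure \<Omega> A \<ge> 1 - \<delta> \<and>
         (\<forall>\<omega>\<in>A. \<forall>\<theta>\<in>\<Theta>.
            L \<alpha> * (l2_norm \<mu> (\<lambda>x. shat (\<theta>hat \<omega>) \<omega> x - s x))\<^sup>2
              \<le> (l2_norm \<mu> (\<lambda>x. shat \<theta> \<omega> x - s x))\<^sup>2
                + (INF m\<in>Mod \<theta> \<omega>. (l2_norm \<mu> (\<lambda>x. sbr \<theta> m \<omega> x - shat \<theta> \<omega> x))\<^sup>2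
                                        + 2 * pen m))))"
proof (rule exI[of _ "16 / ln 2 + 8"], rule exI[of _ const_floor], intro conjI allI impI)
  fix \<alpha> :: real assume "0 < \<alpha>"
  then show "0 < const_floor \<alpha>" by (simp add: const_floor_def)
next
  fix \<Omega> :: "'w measure" and \<mu> :: "'x measure" and s \<epsilon> no n X \<M> S sm and \<pi> :: "'m pmf"
    and \<delta>o mo \<delta> \<nu> pen \<alpha> and \<Theta> :: "'t set" and Mod shat sbr \<theta>hat
  assume \<Omega>: "prob_space \<Omega>" and eps: "\<forall>k\<ge>no. 4 * sqrt (\<epsilon> k) + \<epsilon> k / 3 \<le> 1 / 2" "no \<le> n" and n: "1 \<le> n"
    and X: "prob_space.indep_vars \<Omega> (\<lambda>_. \<mu>) X {1..n}"
      "\<forall>i\<in>{1..n}. distributed \<Omega> \<mu> (X i) (\<lambda>x. ennreal (s x))"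
    and s: "AE x in \<mu>. 0 \<le> s x" "s \<in> l2_space \<mu>"
    and S: "\<forall>m\<in>\<M>. l2_subspace \<mu> (S m) \<and> l2_separable \<mu> (S m) \<and> Psi_bounded \<mu> (S m)"
    and sm: "\<forall>m\<in>\<M>. is_orth_proj \<mu> (S m) s (sm m)" and \<pi>: "set_pmf \<pi> = \<M>" and \<delta>o: "0 < \<delta>o"
    and mo: "is_arg_min (\<lambda>m. risk \<mu> s n (S m) (sm m)) (\<lambda>m. m \<in> \<M>) mo"
    and dev: "\<forall>m\<in>\<M>. sup_norm \<mu> (\<lambda>x. sm m x - sm mo x) * ln (4 / (pmf \<pi> m * \<delta>o))
                / risk \<mu> s n (S m) (sm m) \<le> \<epsilon> n"
    and \<delta>: "\<delta>o \<le> \<delta>" "\<delta> < 1" and \<nu>: "0 < \<nu>" "\<nu> < 1"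
    and pen: "\<forall>m\<in>\<M>. 0 \<le> pen m \<and>
         pen m \<ge> (5 / 2 + 2 * (16 / ln 2 + 8) * \<nu>) * dens_mean \<mu> s (Psi \<mu> (S m)) / real n
           + 2 * (16 / ln 2 + 8) * l2_norm \<mu> s / \<nu> * r_term \<mu> n (S m) (pmf \<pi> m) \<delta>
           + 2 * (16 / ln 2 + 8) / \<nu> ^ 3 * (r_term \<mu> n (S m) (pmf \<pi> m) \<delta>)\<^sup>2"
    and \<alpha>: "0 < \<alpha>"
    and est: "\<forall>\<omega>\<in>space \<Omega>. \<forall>\<theta>\<in>\<Theta>.
         shat \<theta> \<omega> \<in> l2_space \<mu> \<and> Mod \<theta> \<omega> \<subseteq> \<M> \<and> Mod \<theta> \<omega> \<noteq> {} \<and>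
         (\<forall>m\<in>Mod \<theta> \<omega>. sbr \<theta> m \<omega> \<in> S m) \<and>
         bdd_below ((\<lambda>m. pen_cost \<mu> X n \<alpha> \<omega> (sbr \<theta> m \<omega>) (shat \<theta> \<omega>) (pen m)) ` Mod \<theta> \<omega>)"
    and sel: "\<forall>\<omega>\<in>space \<Omega>. is_arg_min (crit \<mu> X n \<alpha> pen Mod shat sbr \<omega>) (\<lambda>\<theta>. \<theta> \<in> \<Theta>) (\<theta>hat \<omega>)"
  interpret prob_space \<Omega> by (rule \<Omega>)
  interpret iid_density_sample \<Omega> \<mu> s X n
    by unfold_locales (use n X s in auto)
  have e: "4 * sqrt (\<epsilon> n) + \<epsilon> n / 3 \<le> 1 / 2" using eps by blast
  obtain A where A: "A \<in> events" "1 - \<delta> \<le> prob A" "A \<subseteq> space \<Omega>"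
    and good: "\<And>\<omega> m t. \<omega> \<in> A \<Longrightarrow> m \<in> \<M> \<Longrightarrow> t \<in> S m \<Longrightarrow>
      2 * \<bar>emp_process \<omega> t - emp_process \<omega> (sm mo)\<bar> \<le> 19 / 20 * (l2_norm \<mu> (\<lambda>x. t x - s x))\<^sup>2 + pen m"
    using uniform_event[OF e bspec[OF S] bspec[OF sm] \<pi> \<delta>o mo bspec[OF dev] \<delta> \<nu> refl
        conjunct2[OF bspec[OF pen]]] \<pi> by blast
  show "\<exists>A\<in>sets \<Omega>. measure \<Omega> A \<ge> 1 - \<delta> \<and>
         (\<forall>\<omega>\<in>A. \<forall>\<theta>\<in>\<Theta>.
            const_floor \<alpha> * (l2_norm \<mu> (\<lambda>x. shat (\<theta>hat \<omega>) \<omega> x - s x))\<^sup>2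
              \<le> (l2_norm \<mu> (\<lambda>x. shat \<theta> \<omega> x - s x))\<^sup>2
                + (INF m\<in>Mod \<theta> \<omega>. (l2_norm \<mu> (\<lambda>x. sbr \<theta> m \<omega> x - shat \<theta> \<omega> x))\<^sup>2
                                        + 2 * pen m))"
  proof (intro bexI[OF _ A(1)] conjI ballI A(2))
    fix \<omega> \<theta> assume \<omega>: "\<omega> \<in> A" and \<theta>: "\<theta> \<in> \<Theta>"
    have sp: "\<omega> \<in> space \<Omega>" using A(3) \<omega> by blast
    show "const_floor \<alpha> * (l2_norm \<mu> (\<lambda>x. shat (\<theta>hat \<omega>) \<omega> x - s x))\<^sup>2
              \<le> (l2_norm \<mu> (\<lambda>x. shat \<theta> \<omega> x - s x))\<^sup>2
                + (INF m\<in>Mod \<theta> \<omega>. (l2_norm \<mu> (\<lambda>x. sbr \<theta> m \<omega> x - shat \<theta> \<omega> x))\<^sup>2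
                                        + 2 * pen m)"
    \<comment> \<open>The common shift \<open>c\<close> is the process at \<open>sm mo\<close>, the
      same for all models and indices.\<close>
    proof (rule oracle_inequality[OF _ good[OF \<omega>] \<alpha> bspec[OF bspec[OF est sp]] _ bspec[OF sel sp] \<theta>])
      show "S m \<subseteq> l2_space \<mu>" if "m \<in> \<M>" for m using S that by (auto simp: l2_subspace_def)
      show "0 \<le> pen m" if "m \<in> \<M>" for m using pen that by blast
    qed
  qed
qed simp_all

end
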